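(* Consider the OPE associated with ${\rm d}\mu_0(x)=\frac{\sqrt{4-x^2}}{2\pi}\chi_{[-2,2]}(x)\,{\rm d}x$ (recurrence coefficients $a_n\equiv1$, $b_n\equiv0$). Fix $x_0\in(-2,2)$ and $0<\alpha<1$. Let $N\in\mathbb{N}$, $\eta_1,\dots,\eta_N\in\mathbb{C}$ with $\operatorname{Im}\eta_j>0$, $c_1,\dots,c_N\in\mathbb{R}$, and $f(x)=\sum_{j=1}^Nc_j\operatorname{Im}\frac{1}{x-\eta_j}$. Then $$X^{(n)}_{f,\alpha,x_0}-\mathbb{E}X^{(n)}_{f,\alpha,x_0}\to N(0,\sigma_f^2)$$ in distribution, where $\sigma_f^2=\frac{1}{4\pi^2}\iint_{\mathbb{R}^2}\left(\frac{f(x)-f(y)}{x-y}\right)^2{\rm d}x\,{\rm d}y$.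
   Context: The OPE of size $n$ for a measure $\mu$ is the probability measure on $\mathbb{R}^n$ proportional to $\prod_{i<j}(x_i-x_j)^2\,{\rm d}\mu(x_1)\cdots{\rm d}\mu(x_n)$; $X^{(n)}_{f,\alpha,x_0}=\sum_{j=1}^nf(n^\alpha(x_j-x_0))$ and $\mathbb{E}$ is expectation under the OPE. *)

theory Defs
  imports "HOL-Probability.Probability"
begin

definition mu0_density :: "real \<Rightarrow> real" where
  "mu0_density x = indicator {-2..2} x * sqrt (4 - x\<^sup>2) / (2 * pi)"

definition ope_weight :: "nat \<Rightarrow> (nat \<Rightarrow> real) \<Rightarrow> real" where
  "ope_weight n x =
     (\<Prod>i<n. \<Prod>j<n. if i < j then (x i - x j)\<^sup>2 else 1) * (\<Prod>i<n. mu0_density (x i))"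

definition ope_Z :: "nat \<Rightarrow> real" where
  "ope_Z n = integral\<^sup>L (PiM {..<n} (\<lambda>_. lborel)) (ope_weight n)"

definition ope :: "nat \<Rightarrow> (nat \<Rightarrow> real) measure" where
  "ope n = density (PiM {..<n} (\<lambda>_. lborel)) (\<lambda>x. ennreal (ope_weight n x / ope_Z n))"

definition lin_stat :: "(real \<Rightarrow> real) \<Rightarrow> real \<Rightarrow> real \<Rightarrow> nat \<Rightarrow> (nat \<Rightarrow> real) \<Rightarrow> real" where
  "lin_stat f \<alpha> x0 n x = (\<Sum>j<n. f (real n powr \<alpha> * (x j - x0)))"

definition gaussian0 :: "real \<Rightarrow> real measure" where
  "gaussian0 s2 = (if s2 = 0 then return borel 0
                   else density lborel (normal_density 0 (sqrt s2)))"

definition sigma2 :: "(real \<Rightarrow> real) \<Rightarrow> real" where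
  "sigma2 f = 1 / (4 * pi\<^sup>2) *
     integral\<^sup>L (lborel :: (real \<times> real) measure) (\<lambda>(x, y). ((f x - f y) / (x - y))\<^sup>2)"

end

theory Submission
  imports Defs "HOL-Complex_Analysis.Complex_Analysis" "HOL-Real_Asymp.Real_Asymp"
    "Jordan_Normal_Form.Char_Poly"
begin

text \<open>
  Write \<open>y = z + 1/z\<close> with \<open>|z| = 1\<close>. By Cauchy's determinant and Andreief's identity, for any \<open>n\<close>
  points \<open>x\<^sub>k\<close> of the unit disc,
  \<open>E \<Prod>\<^sub>i \<Prod>\<^sub>k 1 / (1 + x\<^sub>k\<^sup>2 - x\<^sub>k y\<^sub>i) = \<Prod>\<^sub>k\<^sub><\<^sub>l 1 / (1 - x\<^sub>k x\<^sub>l)\<close>,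
  because \<open>\<integral> U\<^sub>j(y) / (1 + x\<^sup>2 - x y) d\<mu>\<^sub>0 = x\<^sup>j\<close> for the Chebyshev polynomials of the second kind.
  If the test function is \<open>v\<^sub>0 + V(z) + V(1/z)\<close> with \<open>V(z) = \<Sum>\<^sub>k v\<^sub>k z\<^sup>k\<close>, then on the mesoscopic scale
  \<open>V\<close> is bounded on a disc of radius \<open>1 + c n\<^sup>-\<^sup>\<alpha>\<close>, so the Taylor polynomial \<open>\<Prod>\<^sub>k (1 - x\<^sub>k z)\<close> of
  degree \<open>n\<close> approximates \<open>exp (- \<tau> V)\<close> up to an error of order \<open>exp (- c n\<^sup>1\<^sup>-\<^sup>\<alpha>)\<close>. Expanding
  \<open>\<Prod>\<^sub>k\<^sub><\<^sub>l (1 - x\<^sub>k x\<^sub>l)\<close> in power sums, whose values are \<open>k \<tau> v\<^sub>k\<close> up to that error, gives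
  \<open>E exp (\<tau> X) \<approx> exp (n \<tau> v\<^sub>0 + \<tau>\<^sup>2/2 \<Sum>\<^sub>k k v\<^sub>k\<^sup>2 - \<tau> \<Sum>\<^sub>k v\<^sub>2\<^sub>k)\<close> for every complex \<open>\<tau>\<close>.
  For resolvents the \<open>v\<^sub>k\<close> are explicit and \<open>\<Sum>\<^sub>k k v\<^sub>k\<^sup>2\<close> tends to the stated variance.
\<close>

section \<open>Determinants\<close>

hide_const (open) Determinants.det

no_notation inner (infix \<open>\<bullet>\<close> 70)

text \<open>Cauchy's determinant is square, so the symbol must be imitated by a product of exactly n
  factors 1 - x_k z, and the identity needs every x_k in the unit disc. The latter holds because an
  exponential has no zeros and the truncation error is small on a disc of radius larger than 1. Both
  demands are compatible since \<alpha> < 1: a margin of order n^-\<alpha> suffices for a polynomial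
  of degree n. The replacement error is relative to exp (Re \<tau> X). On the imaginary axis this
  factor is 1. For real \<tau> the exponential moment occurs on both sides of the estimate and is
  absorbed, its coefficient being small. Real \<tau> are needed because the statistic is centred at
  its true mean, while the expansion yields the explicit centring - \<Sum> v_2k; convergence of real
  exponential moments shows that the two agree in the limit. The limiting variance is matched in
  closed form: \<Sum> k v_k^2 and \<open>sigma2 f\<close> are both double sums over pairs of
  resolvents, compared term by term.\<close>

definition vandermonde :: "nat \<Rightarrow> (nat \<Rightarrow> 'a::comm_ring_1) \<Rightarrow> 'a" where
  "vandermonde n x = (\<Prod>i<n. \<Prod>j<n. if i < j then x j - x i else 1)"

lemma prod_pairs_Suc:
  fixes g :: "nat \<Rightarrow> nat \<Rightarrow> 'a::comm_monoid_mult"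
  shows "(\<Prod>i<Suc n. \<Prod>j<Suc n. if i < j then g i j else 1) =
         (\<Prod>i<n. \<Prod>j<n. if i < j then g i j else 1) * (\<Prod>i<n. g i n)"
proof -
  have "(\<Prod>j<n. if n < j then g n j else 1) = 1"
    by (intro prod.neutral) auto
  then show ?thesis
    by (simp add: prod.distrib)
qed

text \<open>The matrix of values is the Vandermonde matrix times the coefficient matrix. The second
  determinant is 1 for monic families; for the Lagrange-type basis of Cauchy's determinant it is an
  unknown that gets computed by evaluating at special points.\<close>

lemma det_poly_eval:
  fixes p :: "nat \<Rightarrow> 'a::comm_ring_1 poly"
  assumes "\<And>j. j < n \<Longrightarrow> degree (p j) < n"
  shows "det (mat n n (\<lambda>(i, j). poly (p j) (x i))) =
         det (mat n n (\<lambda>(i, j). x i ^ j)) * det (mat n n (\<lambda>(k, j). coeff (p j) k))"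
proof -
  have "mat n n (\<lambda>(i, j). poly (p j) (x i)) =
        mat n n (\<lambda>(i, j). x i ^ j) * mat n n (\<lambda>(k, j). coeff (p j) k)"
    (is "_ = ?V * ?C")
  proof (rule eq_matI)
    fix i j assume "i < dim_row (?V * ?C)" "j < dim_col (?V * ?C)"
    then have ij: "i < n" "j < n" by auto
    have "poly (p j) (x i) = (\<Sum>k\<le>degree (p j). coeff (p j) k * x i ^ k)"
      by (simp add: poly_altdef)
    also have "\<dots> = (\<Sum>k=0..<n. coeff (p j) k * x i ^ k)"
      using assms[OF ij(2)] by (intro sum.mono_neutral_left) (auto simp: coeff_eq_0)
    finally show "mat n n (\<lambda>(i, j). poly (p j) (x i)) $$ (i, j) = (?V * ?C) $$ (i, j)"
      using ij by (simp add: scalar_prod_def mult.commute)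
  qed auto
  then show ?thesis
    by (simp add: det_mult[of _ n])
qed

lemma det_monic_coeffs:
  fixes p :: "nat \<Rightarrow> 'a::comm_ring_1 poly"
  assumes deg: "\<And>j. j < n \<Longrightarrow> degree (p j) \<le> j" and mon: "\<And>j. j < n \<Longrightarrow> coeff (p j) j = 1"
  shows "det (mat n n (\<lambda>(k, j). coeff (p j) k)) = 1"
proof -
  have "det (mat n n (\<lambda>(k, j). coeff (p j) k)) = prod_list (diag_mat (mat n n (\<lambda>(k, j). coeff (p j) k)))"
    by (rule det_upper_triangular[where n=n])
       (auto simp: upper_triangular_def intro!: coeff_eq_0 le_less_trans[OF deg])
  also have "\<dots> = 1"
    by (simp add: prod_list_diag_prod mon)
  finally show ?thesis .
qed

lemma det_vandermonde: "det (mat n n (\<lambda>(i, j). x i ^ j)) = vandermonde n (x :: nat \<Rightarrow> 'a::idom)"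
proof (induction n)
  case 0
  then show ?case by (simp add: vandermonde_def)
next
  case (Suc n)
  define q where "q = (\<Prod>i<n. [:- x i, 1:])"
  have q_deg: "degree q = n" and q_lead: "coeff q n = 1"
  proof -
    show *: "degree q = n" unfolding q_def by (subst degree_prod_eq_sum_degree) auto
    have "lead_coeff q = 1" unfolding q_def by (simp add: lead_coeff_prod)
    with * show "coeff q n = 1" by simp
  qed
  \<comment> \<open>Replacing the last column by the values of \<open>q\<close> is unimodular and kills all its entries but the last.\<close>
  define p where "p j = (if j = n then q else monom 1 j)" for j
  let ?A = "mat (Suc n) (Suc n) (\<lambda>(i, j). poly (p j) (x i))"
  have "det ?A = det (mat (Suc n) (Suc n) (\<lambda>(i, j). x i ^ j)) * det (mat (Suc n) (Suc n) (\<lambda>(k, j). coeff (p j) k))"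
    by (rule det_poly_eval) (auto simp: p_def q_deg degree_monom_eq)
  also have "det (mat (Suc n) (Suc n) (\<lambda>(k, j). coeff (p j) k)) = 1"
    by (rule det_monic_coeffs) (auto simp: p_def q_deg q_lead degree_monom_eq)
  finally have 1: "det (mat (Suc n) (Suc n) (\<lambda>(i, j). x i ^ j)) = det ?A" by simp
  have q0: "poly q (x i) = 0" if "i < n" for i
    using that by (auto simp: q_def poly_prod intro!: prod_zero bexI[of _ i])
  have "det ?A = (\<Sum>i<Suc n. ?A $$ (i, n) * cofactor ?A i n)"
    by (rule laplace_expansion_column) auto
  also have "\<dots> = poly q (x n) * cofactor ?A n n"
    by (simp add: p_def q0)
  also have "cofactor ?A n n = det (mat n n (\<lambda>(i, j). x i ^ j))"
    unfolding cofactor_def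
  proof -
    have "mat_delete ?A n n = mat n n (\<lambda>(i, j). x i ^ j)"
      by (rule eq_matI) (auto simp: mat_delete_def p_def poly_monom)
    then show "(- 1) ^ (n + n) * det (mat_delete ?A n n) = det (mat n n (\<lambda>(i, j). x i ^ j))" by simp
  qed
  also have "poly q (x n) = (\<Prod>i<n. x n - x i)"
    by (simp add: q_def poly_prod)
  finally show ?case
    unfolding 1 vandermonde_def prod_pairs_Suc using Suc
    by (simp only: vandermonde_def mult.commute)
qed

text \<open>Expanding both determinants gives a double sum over permutations in which every term is
  a product over the coordinates, so Fubini turns it into a product of one-dimensional
  integrals.\<close>

lemma andreief:
  fixes \<phi> \<psi> :: "nat \<Rightarrow> real \<Rightarrow> complex"
  assumes int: "\<And>j k. j < n \<Longrightarrow> k < n \<Longrightarrow> integrable lborel (\<lambda>y. \<phi> j y * \<psi> k y)"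
  shows "(\<integral>y. det (mat n n (\<lambda>(i, j). \<phi> j (y i))) * det (mat n n (\<lambda>(i, k). \<psi> k (y i))) \<partial>PiM {..<n} (\<lambda>_. lborel)) =
           fact n * det (mat n n (\<lambda>(j, k). \<integral>y. \<phi> j y * \<psi> k y \<partial>lborel))"
proof -
  interpret product_sigma_finite "\<lambda>_::nat. lborel :: real measure"
    by (simp add: product_sigma_finite_def sigma_finite_lborel)
  let ?P = "{p. p permutes {0..<n}}"
  have lt: "p i < n" if "p \<in> ?P" "i < n" for p i
    using that permutes_in_image[of p "{0..<n}" i] by auto
  let ?M = "PiM {..<n} (\<lambda>_. lborel :: real measure)"
  have expand: "det (mat n n (\<lambda>(i, j). \<phi> j (y i))) * det (mat n n (\<lambda>(i, k). \<psi> k (y i))) =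
     (\<Sum>p\<in>?P. \<Sum>r\<in>?P. signof p * signof r * (\<Prod>i\<in>{..<n}. \<phi> (p i) (y i) * \<psi> (r i) (y i)))" for y
  proof -
    have a: "det (mat n n (\<lambda>(i, j). \<phi> j (y i))) = (\<Sum>p\<in>?P. signof p * (\<Prod>i<n. \<phi> (p i) (y i)))"
      by (subst det_def'[of _ n]) (auto simp: lessThan_atLeast0 lt intro!: sum.cong prod.cong)
    have b: "det (mat n n (\<lambda>(i, j). \<psi> j (y i))) = (\<Sum>p\<in>?P. signof p * (\<Prod>i<n. \<psi> (p i) (y i)))"
      by (subst det_def'[of _ n]) (auto simp: lessThan_atLeast0 lt intro!: sum.cong prod.cong)
    show ?thesis
      unfolding a b sum_product by (simp add: prod.distrib mult_ac)
  qed
  have I: "integrable ?M (\<lambda>y. \<Prod>i\<in>{..<n}. \<phi> (p i) (y i) * \<psi> (r i) (y i))" if "p \<in> ?P" "r \<in> ?P" for p r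
    by (rule product_integrable_prod) (simp, rule int, (rule lt, rule that, simp)+)
  let ?G = "mat n n (\<lambda>(j, k). \<integral>y. \<phi> j y * \<psi> k y \<partial>lborel)"
  have "(\<integral>y. det (mat n n (\<lambda>(i, j). \<phi> j (y i))) * det (mat n n (\<lambda>(i, k). \<psi> k (y i))) \<partial>?M) =
     (\<Sum>p\<in>?P. \<integral>y. (\<Sum>r\<in>?P. signof p * signof r * (\<Prod>i\<in>{..<n}. \<phi> (p i) (y i) * \<psi> (r i) (y i))) \<partial>?M)"
    unfolding expand
    by (rule Bochner_Integration.integral_sum) (intro Bochner_Integration.integrable_sum integrable_mult_right I)
  also have "\<dots> = (\<Sum>p\<in>?P. \<Sum>r\<in>?P. \<integral>y. signof p * signof r * (\<Prod>i\<in>{..<n}. \<phi> (p i) (y i) * \<psi> (r i) (y i)) \<partial>?M)"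
    by (intro sum.cong refl Bochner_Integration.integral_sum integrable_mult_right I)
  also have "\<dots> = (\<Sum>p\<in>?P. \<Sum>r\<in>?P. signof p * signof r * (\<Prod>i\<in>{..<n}. \<integral>y. \<phi> (p i) y * \<psi> (r i) y \<partial>lborel))"
  proof (intro sum.cong refl)
    fix p r assume pr: "p \<in> ?P" "r \<in> ?P"
    have "(\<integral>y. (\<Prod>i\<in>{..<n}. \<phi> (p i) (y i) * \<psi> (r i) (y i)) \<partial>?M) =
        (\<Prod>i\<in>{..<n}. \<integral>y. \<phi> (p i) y * \<psi> (r i) y \<partial>lborel)"
      by (rule product_integral_prod) (simp, rule int, (rule lt, rule pr, simp)+)
    then show "(\<integral>y. signof p * signof r * (\<Prod>i\<in>{..<n}. \<phi> (p i) (y i) * \<psi> (r i) (y i)) \<partial>?M) =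
        signof p * signof r * (\<Prod>i\<in>{..<n}. \<integral>y. \<phi> (p i) y * \<psi> (r i) y \<partial>lborel)"
      by (subst integral_mult_right_zero) simp
  qed
  \<comment> \<open>For fixed \<open>p\<close> the sum over \<open>r\<close> is the Leibniz
    expansion of \<open>?G\<close> with its rows permuted by \<open>p\<close>. This brings a second
    sign of \<open>p\<close>, which cancels the first, and the outer sum counts n! equal
    terms.\<close>
  also have "\<dots> = (\<Sum>p\<in>?P. signof p * (signof p * det ?G))"
  proof (rule sum.cong[OF refl])
    fix p assume p: "p \<in> ?P"
    have "signof p * det ?G = det (mat n n (\<lambda>(i, j). ?G $$ (p i, j)))"
      by (subst det_permute_rows[of _ n]) (use p in auto)
    also have "\<dots> = (\<Sum>r\<in>?P. signof r * (\<Prod>i<n. \<integral>y. \<phi> (p i) y * \<psi> (r i) y \<partial>lborel))"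
      by (subst det_def'[of _ n]) (auto simp: lessThan_atLeast0 lt[OF p] lt intro!: sum.cong prod.cong)
    finally show "(\<Sum>r\<in>?P. signof p * signof r * (\<Prod>i\<in>{..<n}. \<integral>y. \<phi> (p i) y * \<psi> (r i) y \<partial>lborel))
        = signof p * (signof p * det ?G)"
      by (simp add: sum_distrib_left mult.assoc)
  qed
  also have "\<dots> = (\<Sum>p\<in>?P. det ?G)"
    by (intro sum.cong refl) (auto simp: sign_def)
  also have "\<dots> = fact n * det ?G"
    using card_permutations[of "{0..<n}" n] by simp
  finally show ?thesis .
qed

section \<open>Chebyshev polynomials and the semicircle law\<close>

text \<open>At y = z + 1/z the quadratic splits into (1 - x z)(1 - x/z). Hence a product of such
  quadratics over k is q(z) q(1/z) with q(z) = \<Prod> (1 - x_k z), which is how a polynomial in z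
  enters.\<close>

lemma quadratic_factor_cis:
  "1 + x\<^sup>2 - x * complex_of_real (2 * cos t) = (1 - x * cis t) * (1 - x * cis (- t))"
proof -
  have a: "cis t + cis (- t) = complex_of_real (2 * cos t)"
    by (simp add: complex_eq_iff)
  have b: "cis t * cis (- t) = 1"
    by (simp add: cis_mult)
  have "(1 - x * cis t) * (1 - x * cis (- t)) = 1 + x\<^sup>2 * (cis t * cis (- t)) - x * (cis t + cis (- t))"
    by (simp add: algebra_simps power2_eq_square)
  then show ?thesis unfolding a b by simp
qed

text \<open>Each of the two factors 1 - x z with |z| = 1 is at least 1 - |x| in modulus. The bound
  is uniform over the support, so it serves both for nonvanishing and for dominated
  convergence.\<close>

lemma norm_quadratic_ge:
  fixes x :: complex
  assumes "y \<in> {-2..2::real}" "norm x < 1"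
  shows "(1 - norm x)\<^sup>2 \<le> norm (1 + x\<^sup>2 - x * complex_of_real y)"
proof -
  have y: "y = 2 * cos (arccos (y / 2))"
    using assms(1) by (subst cos_arccos) auto
  have *: "1 - norm x \<le> norm (1 - x * cis t)" for t
    using norm_triangle_ineq2[of 1 "x * cis t"] by (simp add: norm_mult)
  show ?thesis
    by (subst y, subst quadratic_factor_cis)
       (use assms(2) in \<open>auto simp: norm_mult power2_eq_square intro!: mult_mono *\<close>)
qed

lemma quadratic_nonzero:
  fixes x :: complex
  assumes "y \<in> {-2..2::real}" "norm x < 1"
  shows "1 + x\<^sup>2 - x * complex_of_real y \<noteq> 0"
proof -
  have "0 < (1 - norm x)\<^sup>2" using assms(2) by simp
  then show ?thesis using norm_quadratic_ge[OF assms] by auto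
qed

lemma mu0_integrable:
  fixes g :: "real \<Rightarrow> complex"
  assumes "continuous_on {-2..2} g"
  shows "integrable lborel (\<lambda>y. mu0_density y *\<^sub>R g y)"
proof -
  have "set_integrable lborel {-2..2} (\<lambda>y. (sqrt (4 - y\<^sup>2) / (2 * pi)) *\<^sub>R g y)"
    by (intro borel_integrable_atLeastAtMost' continuous_intros assms) auto
  then show ?thesis
    unfolding set_integrable_def mu0_density_def by simp
qed

lemma mu0_integral:
  fixes g :: "real \<Rightarrow> complex"
  assumes g: "continuous_on {-2..2} g"
  shows "(\<integral>y. mu0_density y *\<^sub>R g y \<partial>lborel) =
         (2 / pi) *\<^sub>R integral {0..pi} (\<lambda>t. (sin t)\<^sup>2 *\<^sub>R g (2 * cos t))"
proof -
  define f where "f y = (sqrt (4 - y\<^sup>2) / (2 * pi)) *\<^sub>R g y" for y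
  have f: "continuous_on {-2..2} f"
    unfolding f_def by (intro continuous_intros g) auto
  have img: "(\<lambda>t. 2 * cos t) ` {0..pi} \<subseteq> {-2..2::real}"
  proof safe
    fix t :: real
    show "2 * cos t \<in> {-2..2}" using cos_ge_minus_one[of t] cos_le_one[of t] by simp
  qed
  have "(\<integral>y. mu0_density y *\<^sub>R g y \<partial>lborel) = (LBINT y:{-2..2}. f y)"
    unfolding set_lebesgue_integral_def mu0_density_def f_def by (intro Bochner_Integration.integral_cong) auto
  also have "\<dots> = (LBINT y=ereal (-2)..ereal 2. f y)"
    by (subst interval_integral_Icc) auto
  \<comment> \<open>2 cos t runs from 2 down to -2 on [0, pi]; reversing the limits compensates the
    negative derivative - 2 sin t.\<close>
  also have "\<dots> = - (LBINT y=ereal (2 * cos 0)..ereal (2 * cos pi). f y)"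
    by (subst interval_integral_endpoints_reverse) simp
  also have "(LBINT y=ereal (2 * cos 0)..ereal (2 * cos pi). f y) = (LBINT t=ereal 0..ereal pi. (- 2 * sin t) *\<^sub>R f (2 * cos t))"
    by (rule interval_integral_substitution_finite[symmetric])
       (auto intro!: derivative_eq_intros continuous_intros continuous_on_subset[OF f img])
  also have "\<dots> = (LBINT t:{0..pi}. (- 2 * sin t) *\<^sub>R f (2 * cos t))"
    by (subst interval_integral_Icc) auto
  also have "\<dots> = integral {0..pi} (\<lambda>t. (- 2 * sin t) *\<^sub>R f (2 * cos t))"
    by (intro set_borel_integral_eq_integral(2) borel_integrable_atLeastAtMost' continuous_intros
          continuous_on_compose2[OF f _ img])
  also have "\<dots> = integral {0..pi} (\<lambda>t. (- (2 / pi)) *\<^sub>R ((sin t)\<^sup>2 *\<^sub>R g (2 * cos t)))"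
  proof (intro integral_cong)
    fix t assume t: "t \<in> {0..pi}"
    have "4 - (2 * cos t)\<^sup>2 = (2 * sin t)\<^sup>2"
      by (simp add: power_mult_distrib sin_squared_eq)
    then have "sqrt (4 - (2 * cos t)\<^sup>2) = 2 * sin t"
      using t sin_ge_zero[of t] by (simp only: real_sqrt_abs) auto
    then show "(- 2 * sin t) *\<^sub>R f (2 * cos t) = (- (2 / pi)) *\<^sub>R ((sin t)\<^sup>2 *\<^sub>R g (2 * cos t))"
      unfolding f_def by (simp add: power2_eq_square)
  qed
  also have "\<dots> = (- (2 / pi)) *\<^sub>R integral {0..pi} (\<lambda>t. (sin t)\<^sup>2 *\<^sub>R g (2 * cos t))"
    by (rule integral_cmul)
  finally show ?thesis by simp
qed

text \<open>Rescaled to [-2, 2], so that U_n(2 cos t) = sin ((n+1) t) / sin t. In this scaling the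
  polynomials are monic and at the same time orthonormal for the semicircle law; the recursion is
  the one with a_n = 1 and b_n = 0.\<close>

fun chebyshev_U :: "nat \<Rightarrow> complex poly" where
  "chebyshev_U 0 = 1"
| "chebyshev_U (Suc 0) = [:0, 1:]"
| "chebyshev_U (Suc (Suc n)) = [:0, 1:] * chebyshev_U (Suc n) - chebyshev_U n"

lemma chebyshev_U_monic: "degree (chebyshev_U n) \<le> n \<and> coeff (chebyshev_U n) n = 1"
proof (induction n rule: chebyshev_U.induct)
  case (3 n)
  have "degree (pCons 0 (chebyshev_U (Suc n))) \<le> Suc (Suc n)"
    using 3 degree_pCons_le[of 0 "chebyshev_U (Suc n)"] by linarith
  moreover have "coeff (chebyshev_U n) (Suc (Suc n)) = 0"
    using 3 by (intro coeff_eq_0) linarith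
  ultimately show ?case
    using 3 by (auto intro!: degree_diff_le)
qed auto

lemma chebyshev_U_sin:
  "poly (chebyshev_U n) (complex_of_real (2 * cos t)) * sin t = sin (real (Suc n) * t)"
proof (induction n rule: chebyshev_U.induct)
  case 2
  show ?case using sin_double[of t] by (simp flip: of_real_mult add: mult_ac)
next
  case (3 n)
  have "poly (chebyshev_U (Suc (Suc n))) (complex_of_real (2 * cos t)) * sin t =
        2 * cos t * (poly (chebyshev_U (Suc n)) (2 * cos t) * sin t) - poly (chebyshev_U n) (2 * cos t) * sin t"
    by (simp add: algebra_simps)
  also have "\<dots> = complex_of_real (2 * cos t * sin (real (Suc (Suc n)) * t) - sin (real (Suc n) * t))"
    using 3 by simp
  also have "2 * cos t * sin (real (Suc (Suc n)) * t) - sin (real (Suc n) * t) = sin (real (Suc (Suc (Suc n))) * t)"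
    using sin_add[of "real (Suc (Suc n)) * t" t] sin_diff[of "real (Suc (Suc n)) * t" t]
    by (simp add: algebra_simps)
  finally show ?case .
qed auto

lemma has_integral_sin_sin:
  "((\<lambda>t. sin (real (Suc j) * t) * sin (real (Suc k) * t)) has_integral (if j = k then pi / 2 else 0)) {0..pi}"
proof -
  have c: "((\<lambda>t. cos (of_int m * t)) has_integral (if m = 0 then pi else 0)) {0..pi}" for m :: int
  proof (cases "m = 0")
    case True
    then show ?thesis using has_integral_const_real[of "1::real" 0 pi] by simp
  next
    case False
    have "((\<lambda>t. cos (of_int m * t)) has_integral (sin (of_int m * pi) / of_int m - sin (of_int m * 0) / of_int m)) {0..pi}"
      using False
      by (intro fundamental_theorem_of_calculus)
         (auto intro!: derivative_eq_intros simp flip: has_real_derivative_iff_has_vector_derivative)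
    with False show ?thesis by (simp add: mult.commute[of _ pi])
  qed
  have "((\<lambda>t. (cos (of_int (int j - int k) * t) - cos (of_int (int j + int k + 2) * t)) / 2) has_integral
         ((if int j - int k = 0 then pi else 0) - (if int j + int k + 2 = 0 then pi else 0)) / 2) {0..pi}"
    by (intro has_integral_divide has_integral_diff c)
  then show ?thesis
    by (rule has_integral_eq_rhs[OF has_integral_eq, rotated])
       (auto simp: sin_times_sin algebra_simps)
qed

text \<open>The finite form of the generating function \<Sum> x^k sin ((k+1) t) = sin t / (1 + x^2 -
  2 x cos t). The induction step is the three-term recurrence of sin (k t), and the remainder is
  explicit, so no series has to be integrated term by term.\<close>

lemma sin_geometric_partial:
  fixes x :: complex
  shows "complex_of_real (sin t) = (1 + x\<^sup>2 - x * of_real (2 * cos t)) * (\<Sum>k<K. x ^ k * of_real (sin (real (Suc k) * t)))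
           + x ^ K * of_real (sin (real (Suc K) * t)) - x ^ Suc K * of_real (sin (real K * t))"
proof (induction K)
  case (Suc K)
  have "sin (real (Suc (Suc K)) * t) + sin (real K * t) = 2 * cos t * sin (real (Suc K) * t)"
    using sin_add[of "real (Suc K) * t" t] sin_diff[of "real (Suc K) * t" t]
    by (simp add: algebra_simps)
  then have *: "of_real (sin (real (Suc (Suc K)) * t)) + of_real (sin (real K * t)) =
       complex_of_real (2 * cos t) * of_real (sin (real (Suc K) * t))"
    by (metis of_real_add of_real_mult)
  define A where "A = complex_of_real (sin (real (Suc (Suc K)) * t))"
  define B where "B = complex_of_real (sin (real K * t))"
  define C where "C = complex_of_real (sin (real (Suc K) * t))"
  have A: "A = complex_of_real (2 * cos t) * C - B"
    using * unfolding A_def B_def C_def by (simp add: algebra_simps)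
  show ?case
    by (subst Suc.IH, unfold sum.lessThan_Suc A_def[symmetric] B_def[symmetric] C_def[symmetric] A)
       (simp add: algebra_simps power2_eq_square)
qed simp

text \<open>With y = 2 cos t the weight supplies sin t twice: one factor turns U_j into sin ((j+1)
  t), the other turns 1/(1 + x^2 - x y) into the generating function of the sines. Orthogonality of
  the sines then selects the coefficient x^j.\<close>

lemma mu0_chebyshev_stieltjes:
  assumes x: "norm x < 1"
  shows "(\<integral>y. mu0_density y *\<^sub>R (poly (chebyshev_U j) (of_real y) / (1 + x\<^sup>2 - x * of_real y)) \<partial>lborel) = x ^ j"
    (is "?J = _")
proof -
  define e where "e t = 1 + x\<^sup>2 - x * complex_of_real (2 * cos t)" for t
  have two: "2 * cos t \<in> {-2..2::real}" for t
    using cos_ge_minus_one[of t] cos_le_one[of t] by simp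
  have e0: "e t \<noteq> 0" for t
    unfolding e_def by (rule quadratic_nonzero[OF two x])
  have e_ge: "(1 - norm x)\<^sup>2 \<le> norm (e t)" for t
    unfolding e_def by (rule norm_quadratic_ge[OF two x])
  have e_cont: "continuous_on A e" for A
    unfolding e_def by (intro continuous_intros)
  define s where "s k t = complex_of_real (sin (real k * t))" for k t
  have s_cont: "continuous_on A (s k)" for A k
    unfolding s_def by (intro continuous_intros)
  have s_le: "norm (s k t) \<le> 1" for k t
    unfolding s_def by simp
  have "?J = (2 / pi) *\<^sub>R integral {0..pi} (\<lambda>t. (sin t)\<^sup>2 *\<^sub>R (poly (chebyshev_U j) (of_real (2 * cos t)) / e t))"
    unfolding e_def
    by (rule mu0_integral) (intro continuous_intros, use quadratic_nonzero x in auto)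
  also have "\<dots> = (2 / pi) *\<^sub>R integral {0..pi} (\<lambda>t. s (Suc j) t * (of_real (sin t) / e t))"
    unfolding s_def chebyshev_U_sin[symmetric]
    by (simp add: scaleR_conv_of_real power2_eq_square mult_ac)
  finally have J: "?J = (2 / pi) *\<^sub>R integral {0..pi} (\<lambda>t. s (Suc j) t * (of_real (sin t) / e t))" .
  \<comment> \<open>K > j puts the index j into the partial sum. The remainder is at most 2 |x|^K /
    (1 - |x|)^2 pointwise; the interval length pi and the prefactor 2/pi turn the 2 into 4.\<close>
  have bound: "norm (?J - x ^ j) \<le> 4 / (1 - norm x)\<^sup>2 * norm x ^ K" if K: "K > j" for K
  proof -
    define r where "r t = s (Suc j) t * (x ^ K * s (Suc K) t - x ^ Suc K * s K t) / e t" for t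
    have r_int: "r integrable_on {0..pi}"
      unfolding r_def by (intro integrable_continuous_real continuous_intros s_cont e_cont) (use e0 in auto)
    have split: "s (Suc j) t * (of_real (sin t) / e t) = (\<Sum>k<K. x ^ k * (s (Suc j) t * s (Suc k) t)) + r t" for t
    proof -
      have "of_real (sin t) = e t * (\<Sum>k<K. x ^ k * s (Suc k) t) + x ^ K * s (Suc K) t - x ^ Suc K * s K t"
        unfolding e_def s_def by (rule sin_geometric_partial)
      then have "s (Suc j) t * (of_real (sin t) / e t) =
          s (Suc j) t * (\<Sum>k<K. x ^ k * s (Suc k) t) + r t"
        using e0[of t] by (simp add: r_def divide_simps) (simp add: algebra_simps)
      then show ?thesis by (simp add: sum_distrib_left mult_ac)
    qed
    have "((\<lambda>t. \<Sum>k<K. x ^ k * (s (Suc j) t * s (Suc k) t)) has_integral (\<Sum>k<K. x ^ k * of_real (if j = k then pi / 2 else 0))) {0..pi}"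
      unfolding s_def of_real_mult[symmetric]
      by (intro has_integral_sum has_integral_mult_right has_integral_of_real has_integral_sin_sin) auto
    then have "((\<lambda>t. s (Suc j) t * (of_real (sin t) / e t)) has_integral (x ^ j * (pi / 2) + integral {0..pi} r)) {0..pi}"
      unfolding split using K
      by (intro has_integral_add[OF _ integrable_integral[OF r_int]]) (auto simp: if_distrib sum.delta cong: if_cong)
    then have "?J = (2 / pi) *\<^sub>R (x ^ j * (pi / 2) + integral {0..pi} r)"
      unfolding J by (simp add: integral_unique)
    moreover have "(2 / pi) *\<^sub>R (x ^ j * complex_of_real (pi / 2)) = x ^ j"
      by (simp add: scaleR_conv_of_real)
    ultimately have "?J - x ^ j = (2 / pi) *\<^sub>R integral {0..pi} r"
      by (simp only: scaleR_add_right) simp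
    moreover have "norm (integral {0..pi} r) \<le> (2 * norm x ^ K / (1 - norm x)\<^sup>2) * (pi - 0)"
    proof (rule integral_bound)
      show "continuous_on {0..pi} r"
        unfolding r_def by (intro continuous_intros s_cont e_cont) (use e0 in auto)
      fix t
      have "norm (x ^ K * s (Suc K) t - x ^ Suc K * s K t) \<le> norm x ^ K * 1 + norm x ^ Suc K * 1"
        by (rule order.trans[OF norm_triangle_ineq4])
           (use s_le[of _ t] x in \<open>auto simp: norm_mult norm_power intro!: add_mono mult_left_le mult_left_mono\<close>)
      also have "\<dots> \<le> 2 * norm x ^ K"
        using x by (simp add: mult_left_le_one_le)
      finally have a: "norm (x ^ K * s (Suc K) t - x ^ Suc K * s K t) \<le> 2 * norm x ^ K" .
      have "norm (r t) = norm (s (Suc j) t) * norm (x ^ K * s (Suc K) t - x ^ Suc K * s K t) / norm (e t)"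
        by (simp add: r_def norm_mult norm_divide)
      also have "\<dots> \<le> 1 * (2 * norm x ^ K) / (1 - norm x)\<^sup>2"
        using x by (intro frac_le mult_mono s_le a e_ge) auto
      finally show "norm (r t) \<le> 2 * norm x ^ K / (1 - norm x)\<^sup>2" by simp
    qed auto
    moreover have "norm ((2 / pi) *\<^sub>R integral {0..pi} r) = 2 / pi * norm (integral {0..pi} r)"
      by simp
    moreover have "2 / pi * (2 * norm x ^ K / (1 - norm x)\<^sup>2 * (pi - 0)) = 4 / (1 - norm x)\<^sup>2 * norm x ^ K"
      by simp
    ultimately show ?thesis
      by (metis (no_types, lifting) mult_left_mono divide_nonneg_nonneg pi_ge_zero zero_le_numeral)
  qed
  have "(\<lambda>K. 4 / (1 - norm x)\<^sup>2 * norm x ^ K) \<longlonglongrightarrow> 4 / (1 - norm x)\<^sup>2 * 0"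
    using x by (intro tendsto_intros LIMSEQ_power_zero) auto
  then have "norm (?J - x ^ j) \<le> 4 / (1 - norm x)\<^sup>2 * 0"
    by (rule LIMSEQ_le_const) (intro exI[of _ "Suc j"] allI impI bound, linarith)
  then show ?thesis by simp
qed

section \<open>An exact expectation\<close>

lemma det_scale_rows:
  fixes a :: "nat \<Rightarrow> nat \<Rightarrow> 'a::comm_ring_1"
  shows "det (mat n n (\<lambda>(i, j). c i * a i j)) = (\<Prod>i<n. c i) * det (mat n n (\<lambda>(i, j). a i j))"
proof -
  have lt: "p i < n" if "p permutes {0..<n}" "i < n" for p i
    using that permutes_in_image[of p "{0..<n}" i] by auto
  have A: "det (mat n n (\<lambda>(i, j). b i j)) = (\<Sum>p | p permutes {0..<n}. signof p * (\<Prod>i<n. b i (p i)))"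
    for b :: "nat \<Rightarrow> nat \<Rightarrow> 'a"
    by (subst det_def'[of _ n]) (auto simp: lessThan_atLeast0 lt intro!: sum.cong prod.cong)
  show ?thesis
    unfolding A by (simp add: prod.distrib sum_distrib_left mult_ac)
qed

lemma det_monic_poly_eval:
  fixes p :: "nat \<Rightarrow> 'a::idom poly"
  assumes "\<And>j. degree (p j) \<le> j" "\<And>j. coeff (p j) j = 1"
  shows "det (mat n n (\<lambda>(i, j). poly (p j) (x i))) = vandermonde n x"
  by (subst det_poly_eval) (auto simp: det_monic_coeffs assms det_vandermonde intro: le_less_trans[OF assms(1)])

lemma prod_offdiag_pairs:
  fixes g :: "nat \<Rightarrow> nat \<Rightarrow> 'a::comm_monoid_mult"
  shows "(\<Prod>k<n. \<Prod>l\<in>{..<n} - {k}. g k l) = (\<Prod>k<n. \<Prod>l<n. if k < l then g k l * g l k else 1)"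
proof (induction n)
  case (Suc n)
  have 1: "(\<Prod>l\<in>{..<Suc n} - {k}. g k l) = g k n * (\<Prod>l\<in>{..<n} - {k}. g k l)" if "k < n" for k
  proof -
    have "{..<Suc n} - {k} = insert n ({..<n} - {k})" using that by auto
    then show ?thesis by simp
  qed
  have 2: "{..<Suc n} - {n} = {..<n}" by auto
  have "(\<Prod>k<Suc n. \<Prod>l\<in>{..<Suc n} - {k}. g k l) = (\<Prod>k<n. g k n * (\<Prod>l\<in>{..<n} - {k}. g k l)) * (\<Prod>l<n. g n l)"
    by (simp add: 1 2)
  also have "\<dots> = (\<Prod>k<n. \<Prod>l\<in>{..<n} - {k}. g k l) * (\<Prod>k<n. g k n * g n k)"
    by (simp add: prod.distrib mult_ac)
  finally show ?case
    unfolding prod_pairs_Suc Suc .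
qed simp

lemma vandermonde_nonzero:
  fixes x :: "nat \<Rightarrow> 'a::idom"
  assumes "inj_on x {..<n}"
  shows "vandermonde n x \<noteq> 0"
  using assms unfolding vandermonde_def by (auto simp: inj_on_def)

lemma ope_weight_vandermonde:
  "complex_of_real (ope_weight n y) = (\<Prod>i<n. complex_of_real (mu0_density (y i))) * (vandermonde n (\<lambda>i. complex_of_real (y i)))\<^sup>2"
proof -
  have "(\<Prod>i<n. \<Prod>j<n. if i < j then (y i - y j)\<^sup>2 else 1) = (\<Prod>i<n. \<Prod>j<n. if i < j then y j - y i else 1)\<^sup>2"
    unfolding prod_power_distrib by (intro prod.cong refl) (auto simp: power2_commute)
  moreover have "vandermonde n (\<lambda>i. complex_of_real (y i)) = complex_of_real (\<Prod>i<n. \<Prod>j<n. if i < j then y j - y i else 1)"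
    unfolding vandermonde_def of_real_prod by (intro prod.cong refl) auto
  ultimately show ?thesis
    unfolding ope_weight_def by simp
qed

lemma mu0_density_eq_0: "y \<notin> {-2..2} \<Longrightarrow> mu0_density y = 0"
  unfolding mu0_density_def by auto

lemma ope_weight_eq_0: "i < n \<Longrightarrow> y i \<notin> {-2..2} \<Longrightarrow> ope_weight n y = 0"
  unfolding ope_weight_def using mu0_density_eq_0[of "y i"] prod_zero[of "{..<n}" "\<lambda>i. mu0_density (y i)"]
  by auto

text \<open>Since 1 + x^2 - x y = x (x + 1/x - y), this is Cauchy's determinant for the nodes y_i
  and w_k = x_k + 1/x_k. The factors 1 - x_k x_l arise because w_l - w_k contains 1 - x_k x_l
  besides x_l - x_k; inside the unit disc they do not vanish, so the w_k are distinct when the x_k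
  are.\<close>

lemma cauchy_determinant_quotient:
  fixes x :: "nat \<Rightarrow> complex"
  assumes inj: "inj_on x {..<n}" and nz: "\<And>k. k < n \<Longrightarrow> x k \<noteq> 0" and lt1: "\<And>k. k < n \<Longrightarrow> norm (x k) < 1"
    and e: "\<And>i k. i < n \<Longrightarrow> k < n \<Longrightarrow> 1 + (x k)\<^sup>2 - x k * y i \<noteq> 0"
  shows "vandermonde n y / (\<Prod>i<n. \<Prod>k<n. 1 + (x k)\<^sup>2 - x k * y i) * vandermonde n x =
         (\<Prod>k<n. \<Prod>l<n. if k < l then 1 / (1 - x k * x l) else 1) * det (mat n n (\<lambda>(i, k). 1 / (1 + (x k)\<^sup>2 - x k * y i)))"
proof -
  \<comment> \<open>Lagrange-type basis: its values at the points \<open>x\<^sub>i + 1/x\<^sub>i\<close> form a diagonal matrix, which yields \<open>d\<close>.\<close>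
  define L where "L k = (\<Prod>l\<in>{..<n} - {k}. [:1 + (x l)\<^sup>2, - x l:])" for k
  have degL: "degree (L k) < n" if "k < n" for k
  proof -
    have "degree (L k) \<le> sum (degree \<circ> (\<lambda>l. [:1 + (x l)\<^sup>2, - x l:])) ({..<n} - {k})"
      unfolding L_def by (rule degree_prod_sum_le) auto
    also have "\<dots> \<le> (\<Sum>l\<in>{..<n} - {k}. 1)"
      by (intro sum_mono) auto
    also have "\<dots> < n" using that by (simp add: card_Diff_singleton)
    finally show ?thesis .
  qed
  have polyL: "poly (L k) u = (\<Prod>l\<in>{..<n} - {k}. 1 + (x l)\<^sup>2 - x l * u)" for k u
    unfolding L_def by (simp add: poly_prod mult.commute)
  define d where "d = det (mat n n (\<lambda>(k, j). coeff (L j) k))"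
  have detL: "det (mat n n (\<lambda>(i, j). poly (L j) (u i))) = vandermonde n u * d" for u
    unfolding d_def by (subst det_poly_eval) (auto simp: degL det_vandermonde)
  define w where "w i = x i + 1 / x i" for i
  have x1: "1 - x k * x l \<noteq> 0" if "k < n" "l < n" for k l
  proof -
    have "norm (x k * x l) < 1" using lt1[OF that(1)] lt1[OF that(2)]
      by (metis mult_less_le_imp_less mult_1 norm_ge_zero norm_mult nz norm_eq_zero zero_less_norm_iff that(2) less_imp_le)
    then show ?thesis by auto
  qed
  have wdiff: "w l - w k = (x l - x k) * (x k * x l - 1) / (x k * x l)" if "k < n" "l < n" for k l
    using nz that by (simp add: w_def field_simps)
  have winj: "inj_on w {..<n}"
  proof (rule inj_onI)
    fix k l assume kl: "k \<in> {..<n}" "l \<in> {..<n}" "w k = w l"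
    then have "(x l - x k) * (x k * x l - 1) = 0"
      using wdiff[of k l] nz by auto
    then have "x k = x l" using x1[of k l] kl by auto
    then show "k = l" using inj kl by (auto simp: inj_on_def)
  qed
  have "vandermonde n w * d = det (mat n n (\<lambda>(i, j). poly (L j) (w i)))"
    by (simp add: detL)
  also have "\<dots> = prod_list (diag_mat (mat n n (\<lambda>(i, j). poly (L j) (w i))))"
  proof (rule det_upper_triangular[where n=n])
    have "poly (L j) (w i) = 0" if "j < i" "i < n" for i j
      unfolding polyL by (rule prod_zero) (use that nz[of i] in \<open>auto simp: w_def field_simps power2_eq_square intro!: bexI[of _ i]\<close>)
    then show "upper_triangular (mat n n (\<lambda>(i, j). poly (L j) (w i)))"
      by (auto simp: upper_triangular_def)
  qed auto
  also have "\<dots> = (\<Prod>k<n. poly (L k) (w k))"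
    by (simp add: prod_list_diag_prod lessThan_atLeast0)
  also have "\<dots> = (\<Prod>k<n. \<Prod>l\<in>{..<n} - {k}. (1 - x l * x k) * (x k - x l) / x k)"
    unfolding polyL using nz
    by (intro prod.cong refl) (auto simp: w_def field_simps power2_eq_square)
  \<comment> \<open>Each unordered pair contributes the off-diagonal entries for (k, l) and for (l,
    k). Their product is w_l - w_k times (1 - x_k x_l)(x_l - x_k), so the Vandermonde product of
    \<open>w\<close> splits off and cancels, leaving \<open>d\<close>.\<close>
  also have "\<dots> = vandermonde n w * (\<Prod>k<n. \<Prod>l<n. if k < l then (1 - x k * x l) * (x l - x k) else 1)"
    unfolding prod_offdiag_pairs vandermonde_def prod.distrib[symmetric]
    by (intro prod.cong refl) (use nz in \<open>auto simp: wdiff field_simps\<close>)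
  finally have d: "d = (\<Prod>k<n. \<Prod>l<n. if k < l then (1 - x k * x l) * (x l - x k) else 1)"
    using vandermonde_nonzero[OF winj] by simp
  define Q where "Q = (\<Prod>k<n. \<Prod>l<n. if k < l then 1 / (1 - x k * x l) else 1)"
  have Qd: "Q * d = vandermonde n x"
    unfolding Q_def d vandermonde_def prod.distrib[symmetric]
    by (intro prod.cong refl) (use x1 in auto)
  define E where "E = (\<Prod>i<n. \<Prod>k<n. 1 + (x k)\<^sup>2 - x k * y i)"
  have E0: "E \<noteq> 0" unfolding E_def using e by auto
  have "vandermonde n y * d = det (mat n n (\<lambda>(i, j). poly (L j) (y i)))"
    by (simp add: detL)
  also have "mat n n (\<lambda>(i, j). poly (L j) (y i)) =
     mat n n (\<lambda>(i, j). (\<Prod>k<n. 1 + (x k)\<^sup>2 - x k * y i) * (1 / (1 + (x j)\<^sup>2 - x j * y i)))"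
  proof (rule cong_mat)
    fix i j assume ij: "i < n" "j < n"
    have "(\<Prod>k<n. 1 + (x k)\<^sup>2 - x k * y i) = (1 + (x j)\<^sup>2 - x j * y i) * poly (L j) (y i)"
      unfolding polyL using ij by (subst prod.remove[of _ j]) auto
    then show "(\<lambda>(i, j). poly (L j) (y i)) (i, j) = (\<lambda>(i, j). (\<Prod>k<n. 1 + (x k)\<^sup>2 - x k * y i) * (1 / (1 + (x j)\<^sup>2 - x j * y i))) (i, j)"
      using e[OF ij] by simp
  qed auto
  also have "det \<dots> = E * det (mat n n (\<lambda>(i, k). 1 / (1 + (x k)\<^sup>2 - x k * y i)))"
    unfolding det_scale_rows E_def ..
  finally have "vandermonde n y * d / E = det (mat n n (\<lambda>(i, k). 1 / (1 + (x k)\<^sup>2 - x k * y i)))"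
    using E0 by simp
  then show ?thesis
    unfolding Q_def[symmetric] E_def[symmetric] Qd[symmetric]
    by (metis (no_types, lifting) mult.commute mult.left_commute times_divide_eq_left)
qed

text \<open>The squared Vandermonde product of the weight is shared out: one copy becomes the
  determinant of the Chebyshev polynomials, the other together with the denominator becomes Cauchy's
  determinant. Andreief's identity reduces the integral to the matrix of x_k^j, whose determinant
  cancels the Vandermonde product of \<open>x\<close>.\<close>

lemma ope_weight_rational_integral_distinct:
  fixes x :: "nat \<Rightarrow> complex"
  assumes inj: "inj_on x {..<n}" and nz: "\<And>k. k < n \<Longrightarrow> x k \<noteq> 0" and lt1: "\<And>k. k < n \<Longrightarrow> norm (x k) < 1"
  shows "(\<integral>y. complex_of_real (ope_weight n y) / (\<Prod>i<n. \<Prod>k<n. 1 + (x k)\<^sup>2 - x k * of_real (y i)) \<partial>PiM {..<n} (\<lambda>_. lborel)) =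
           fact n * (\<Prod>k<n. \<Prod>l<n. if k < l then 1 / (1 - x k * x l) else 1)"
proof -
  define Q where "Q = (\<Prod>k<n. \<Prod>l<n. if k < l then 1 / (1 - x k * x l) else 1)"
  define \<phi> where "\<phi> j u = complex_of_real (mu0_density u) * poly (chebyshev_U j) (of_real u)" for j u
  define \<psi> where "\<psi> k u = 1 / (1 + (x k)\<^sup>2 - x k * complex_of_real u)" for k u
  let ?F = "\<lambda>y. complex_of_real (ope_weight n y) / (\<Prod>i<n. \<Prod>k<n. 1 + (x k)\<^sup>2 - x k * of_real (y i))"
  let ?D = "\<lambda>y. det (mat n n (\<lambda>(i, j). \<phi> j (y i))) * det (mat n n (\<lambda>(i, k). \<psi> k (y i)))"
  have vx: "vandermonde n x \<noteq> 0" using inj by (rule vandermonde_nonzero)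
  have detphi: "det (mat n n (\<lambda>(i, j). \<phi> j (y i))) = (\<Prod>i<n. complex_of_real (mu0_density (y i))) * vandermonde n (\<lambda>i. of_real (y i))" for y
    unfolding \<phi>_def det_scale_rows using chebyshev_U_monic
    by (subst det_monic_poly_eval[of chebyshev_U n "\<lambda>i. complex_of_real (y i)"]) auto
  have FD: "?F = (\<lambda>y. Q / vandermonde n x * ?D y)"
  proof
    fix y :: "nat \<Rightarrow> real"
    show "?F y = Q / vandermonde n x * ?D y"
    proof (cases "\<forall>i<n. y i \<in> {-2..2}")
      case True
      have "vandermonde n (\<lambda>i. complex_of_real (y i)) / (\<Prod>i<n. \<Prod>k<n. 1 + (x k)\<^sup>2 - x k * of_real (y i)) * vandermonde n x =
           Q * det (mat n n (\<lambda>(i, k). \<psi> k (y i)))"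
        unfolding Q_def \<psi>_def
        by (rule cauchy_determinant_quotient[OF inj nz lt1]) (use True quadratic_nonzero lt1 in auto)
      then have "vandermonde n (\<lambda>i. complex_of_real (y i)) / (\<Prod>i<n. \<Prod>k<n. 1 + (x k)\<^sup>2 - x k * of_real (y i)) =
           Q / vandermonde n x * det (mat n n (\<lambda>(i, k). \<psi> k (y i)))"
        using vx by (simp add: field_simps)
      then have "?F y = (\<Prod>i<n. complex_of_real (mu0_density (y i))) * vandermonde n (\<lambda>i. of_real (y i)) *
           (Q / vandermonde n x * det (mat n n (\<lambda>(i, k). \<psi> k (y i))))"
        unfolding ope_weight_vandermonde power2_eq_square[of "vandermonde n (\<lambda>i. complex_of_real (y i))"]
        by (metis (no_types, lifting) mult.assoc times_divide_eq_right)
      then show ?thesis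
        unfolding detphi by (simp add: mult_ac)
    next
      case False
      then obtain i where i: "i < n" "y i \<notin> {-2..2}" by auto
      have "(\<Prod>i<n. complex_of_real (mu0_density (y i))) = 0"
        using i mu0_density_eq_0 by (auto intro!: prod_zero)
      then show ?thesis unfolding detphi using ope_weight_eq_0[of i n y] i by simp
    qed
  qed
  have phipsi: "\<phi> j u * \<psi> k u = mu0_density u *\<^sub>R (poly (chebyshev_U j) (of_real u) / (1 + (x k)\<^sup>2 - x k * of_real u))" for j k u
    unfolding \<phi>_def \<psi>_def by (simp add: scaleR_conv_of_real)
  have int: "integrable lborel (\<lambda>u. \<phi> j u * \<psi> k u)" if "k < n" for j k
    unfolding phipsi
    by (rule mu0_integrable) (intro continuous_intros, use quadratic_nonzero lt1 that in auto)
  have "integral\<^sup>L (PiM {..<n} (\<lambda>_. lborel)) ?F = Q / vandermonde n x * integral\<^sup>L (PiM {..<n} (\<lambda>_. lborel)) ?D"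
    unfolding FD by (rule integral_mult_right_zero)
  also have "integral\<^sup>L (PiM {..<n} (\<lambda>_. lborel)) ?D = fact n * det (mat n n (\<lambda>(j, k). \<integral>u. \<phi> j u * \<psi> k u \<partial>lborel))"
    by (rule andreief) (rule int)
  also have "mat n n (\<lambda>(j, k). \<integral>u. \<phi> j u * \<psi> k u \<partial>lborel) = transpose_mat (mat n n (\<lambda>(k, j). x k ^ j))"
    by (rule eq_matI) (auto simp: phipsi mu0_chebyshev_stieltjes lt1)
  also have "det \<dots> = vandermonde n x"
    by (simp add: det_transpose[of _ n] det_vandermonde)
  finally show ?thesis
    using vx by (simp add: Q_def)
qed

section \<open>Positivity, measurability and integrability of the OPE weight\<close>

lemma mu0_density_nonneg: "0 \<le> mu0_density u"
proof (cases "u \<in> {-2..2}")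
  case True
  then have "u\<^sup>2 \<le> 2\<^sup>2" by (subst abs_le_square_iff[symmetric]) auto
  then show ?thesis by (simp add: mu0_density_def)
qed (simp add: mu0_density_eq_0)

lemma ope_weight_nonneg: "0 \<le> ope_weight n y"
  unfolding ope_weight_def
  by (intro mult_nonneg_nonneg prod_nonneg) (auto intro: mu0_density_nonneg)

lemma mu0_density_measurable [measurable]: "mu0_density \<in> borel_measurable borel"
  unfolding mu0_density_def by measurable

lemma ope_weight_measurable [measurable]: "ope_weight n \<in> borel_measurable (PiM {..<n} (\<lambda>_. lborel))"
proof -
  have "(\<lambda>x. if i < j then (x i - x j)\<^sup>2 else 1 :: real) \<in> borel_measurable (PiM {..<n} (\<lambda>_. lborel))"
    if "i < n" "j < n" for i j
    using that by (cases "i < j") auto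
  then show ?thesis
    unfolding ope_weight_def by (intro borel_measurable_times borel_measurable_prod) auto
qed

lemma ope_weight_integrable: "integrable (PiM {..<n} (\<lambda>_. lborel)) (ope_weight n)"
proof -
  interpret product_sigma_finite "\<lambda>_::nat. lborel :: real measure"
    by (simp add: product_sigma_finite_def sigma_finite_lborel)
  have "integrable lborel (\<lambda>y. Re (mu0_density y *\<^sub>R 1))"
    by (intro integrable_Re mu0_integrable continuous_intros)
  then have "integrable lborel mu0_density" by simp
  \<comment> \<open>Two points of [-2, 2] differ by at most 4, so every squared difference is at
    most 16; the bound also covers the factors 1 of the remaining index pairs.\<close>
  then have I: "integrable (PiM {..<n} (\<lambda>_. lborel)) (\<lambda>y. (\<Prod>i<n. \<Prod>j<n. 16) * (\<Prod>i<n. mu0_density (y i)))"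
    by (intro integrable_mult_right product_integrable_prod) auto
  show ?thesis
  proof (rule Bochner_Integration.integrable_bound[OF I])
    have "ope_weight n y \<le> (\<Prod>i<n. \<Prod>j<n. 16) * (\<Prod>i<n. mu0_density (y i))" for y
    proof (cases "\<forall>i<n. y i \<in> {-2..2}")
      case True
      have "(if i < j then (y i - y j)\<^sup>2 else 1) \<le> 16" if "i < n" "j < n" for i j
      proof -
        have "y i \<in> {-2..2}" "y j \<in> {-2..2}" using True that by blast+
        then have "\<bar>y i - y j\<bar> \<le> 4" by (auto simp: abs_le_iff)
        then have "(y i - y j)\<^sup>2 \<le> 4\<^sup>2" by (subst abs_le_square_iff[symmetric]) simp
        then show ?thesis by simp
      qed
      then show ?thesis
        unfolding ope_weight_def by (intro mult_right_mono prod_mono prod_nonneg conjI mu0_density_nonneg) auto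
    next
      case False
      then obtain i where "i < n" "y i \<notin> {-2..2}" by auto
      then have "ope_weight n y = 0" by (rule ope_weight_eq_0)
      then show ?thesis by (simp add: prod_nonneg mu0_density_nonneg)
    qed
    then show "AE y in PiM {..<n} (\<lambda>_. lborel). norm (ope_weight n y) \<le> norm ((\<Prod>i<n. \<Prod>j<n. 16) * (\<Prod>i<n. mu0_density (y i)))"
      by (intro AE_I2) (auto simp: ope_weight_nonneg abs_mult prod_nonneg mu0_density_nonneg)
  qed measurable
qed

text \<open>For b \<noteq> 0 a zero forces m + 1 = - b / a, so at most one index is excluded. This
  provides the generic perturbation of a finite family of points.\<close>

lemma eventually_nonzero_perturbed:
  fixes a b :: complex
  assumes "a \<noteq> 0 \<or> b \<noteq> 0"
  shows "\<forall>\<^sub>F m in sequentially. a + b / of_nat (Suc m) \<noteq> 0"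
proof (cases "b = 0")
  case True
  then show ?thesis using assms by simp
next
  case False
  have "finite {m. a + b / of_nat (Suc m) = 0}"
  proof (rule finite_subset[of _ "{m. of_nat (Suc m) = - b / a}"])
    show "{m. a + b / of_nat (Suc m) = 0} \<subseteq> {m. of_nat (Suc m) = - b / a}"
    proof safe
      fix m assume *: "a + b / of_nat (Suc m) = 0"
      have s0: "(of_nat (Suc m) :: complex) \<noteq> 0" by (simp only: of_nat_eq_0_iff)
      have "a * of_nat (Suc m) = - b" using * s0
        by (metis add_eq_0_iff2 divide_eq_minus_1_iff eq_divide_eq minus_divide_left)
      moreover from this have "a \<noteq> 0" using False by auto
      ultimately show "of_nat (Suc m) = - b / a" by (simp add: field_simps)
    qed
    have "inj (\<lambda>m. of_nat (Suc m) :: complex)"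
      by (rule injI) (simp only: of_nat_eq_iff)
    from finite_vimageI[OF _ this, of "{- b / a}"]
    show "finite {m. (of_nat (Suc m) :: complex) = - b / a}"
      by (simp add: vimage_def)
  qed
  then show ?thesis
    by (subst cofinite_eq_sequentially[symmetric]) (simp add: eventually_cofinite)
qed

lemma norm_inverse_quadratics_le:
  fixes x :: "nat \<Rightarrow> complex"
  assumes r: "r < 1" "\<And>k. k < n \<Longrightarrow> norm (x k) \<le> r" and y: "\<And>i. i < n \<Longrightarrow> y i \<in> {-2..2::real}"
  shows "norm (1 / (\<Prod>i<n. \<Prod>k<n. 1 + (x k)\<^sup>2 - x k * of_real (y i))) \<le> (\<Prod>i<n. \<Prod>k<n. 1 / (1 - r)\<^sup>2)"
proof -
  have "norm (1 / (\<Prod>i<n. \<Prod>k<n. 1 + (x k)\<^sup>2 - x k * of_real (y i))) =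
      (\<Prod>i<n. \<Prod>k<n. 1 / norm (1 + (x k)\<^sup>2 - x k * of_real (y i)))"
    by (simp add: norm_divide prod_dividef flip: prod_norm)
  also have "\<dots> \<le> (\<Prod>i<n. \<Prod>k<n. 1 / (1 - r)\<^sup>2)"
  proof (intro prod_mono conjI prod_nonneg divide_left_mono; (simp; fail)?)
    fix i k assume ik: "i \<in> {..<n}" "k \<in> {..<n}"
    have "(1 - r)\<^sup>2 \<le> (1 - norm (x k))\<^sup>2"
      using r ik by (intro power_mono) auto
    also have "\<dots> \<le> norm (1 + (x k)\<^sup>2 - x k * of_real (y i))"
      using r(1) r(2)[of k] y ik by (intro norm_quadratic_ge) auto
    finally show le: "(1 - r)\<^sup>2 \<le> norm (1 + (x k)\<^sup>2 - x k * of_real (y i))" .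
    have "0 < (1 - r)\<^sup>2" using r(1) by simp
    with le show "0 < norm (1 + (x k)\<^sup>2 - x k * of_real (y i)) * (1 - r)\<^sup>2"
      by (intro mult_pos_pos) linarith+
  qed
  finally show ?thesis .
qed

lemma ope_weight_rational_integral:
  fixes x :: "nat \<Rightarrow> complex"
  assumes lt1: "\<And>k. k < n \<Longrightarrow> norm (x k) < 1"
  shows "(\<integral>y. complex_of_real (ope_weight n y) / (\<Prod>i<n. \<Prod>k<n. 1 + (x k)\<^sup>2 - x k * of_real (y i)) \<partial>PiM {..<n} (\<lambda>_. lborel)) =
           fact n * (\<Prod>k<n. \<Prod>l<n. if k < l then 1 / (1 - x k * x l) else 1)"
proof -
  \<comment> \<open>For large \<open>m\<close> the perturbed points are distinct and nonzero; let \<open>m\<close> tend to infinity.\<close>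
  define X where "X m k = x k + of_nat (Suc k) / of_nat (Suc m)" for m k
  have Xlim: "(\<lambda>m. X m k) \<longlonglongrightarrow> x k" for k
  proof -
    have "(\<lambda>m. x k + of_nat (Suc k) * inverse (of_nat (Suc m))) \<longlonglongrightarrow> x k + of_nat (Suc k) * 0"
      by (intro tendsto_intros lim_inverse_n[THEN LIMSEQ_Suc])
    then show ?thesis by (simp add: X_def divide_inverse)
  qed
  obtain r where r: "r < 1" "\<And>k. k < n \<Longrightarrow> norm (x k) < r"
  proof -
    \<comment> \<open>Inserting 0 keeps the maximum meaningful for \<open>n = 0\<close>; the
      midpoint between it and 1 leaves room for the perturbation.\<close>
    define M where "M = Max (insert 0 ((\<lambda>k. norm (x k)) ` {..<n}))"
    have "M < 1" unfolding M_def using lt1 by (subst Max_less_iff) auto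
    moreover have "norm (x k) \<le> M" if "k < n" for k unfolding M_def using that by (intro Max_ge) auto
    ultimately show ?thesis by (intro that[of "(1 + M) / 2"]) force+
  qed
  define good where "good m \<longleftrightarrow> (\<forall>k\<in>{..<n}. X m k \<noteq> 0) \<and> (\<forall>k\<in>{..<n}. norm (X m k) < r) \<and>
      (\<forall>k\<in>{..<n}. \<forall>l\<in>{..<n} - {k}. X m k - X m l \<noteq> 0)" for m
  have "\<forall>\<^sub>F m in sequentially. good m"
    unfolding good_def
  proof (intro eventually_conj eventually_ball_finite ballI finite_lessThan finite_Diff)
    fix k assume k: "k \<in> {..<n}"
    show "\<forall>\<^sub>F m in sequentially. X m k \<noteq> 0"
      unfolding X_def by (intro eventually_nonzero_perturbed disjI2) (simp only: of_nat_eq_0_iff)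
    show "\<forall>\<^sub>F m in sequentially. norm (X m k) < r"
      using tendsto_norm[OF Xlim[of k]] r(2)[of k] k by (intro order_tendstoD(2)[of _ "norm (x k)"]) auto
    fix l assume l: "l \<in> {..<n} - {k}"
    have "X m k - X m l = (x k - x l) + (of_nat (Suc k) - of_nat (Suc l)) / of_nat (Suc m)" for m
      unfolding X_def by (simp only: diff_divide_distrib) simp
    moreover have "(of_nat (Suc k) - of_nat (Suc l) :: complex) \<noteq> 0"
      using l by (simp only: right_minus_eq of_nat_eq_iff) auto
    ultimately show "\<forall>\<^sub>F m in sequentially. X m k - X m l \<noteq> 0"
      using eventually_nonzero_perturbed[OF disjI2] by presburger
  qed
  then obtain m0 where m0: "\<And>m. m \<ge> m0 \<Longrightarrow> good m"
    unfolding eventually_sequentially by blast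
  define Y where "Y m = X (m + m0)" for m
  have Ylim: "(\<lambda>m. Y m k) \<longlonglongrightarrow> x k" for k
    unfolding Y_def by (rule LIMSEQ_ignore_initial_segment[OF Xlim])
  have Y: "Y m k \<noteq> 0" "norm (Y m k) < r" if "k < n" for m k
    using m0[of "m + m0"] that unfolding Y_def good_def by auto
  have Yinj: "inj_on (Y m) {..<n}" for m
    using m0[of "m + m0"] unfolding Y_def good_def inj_on_def by fastforce
  let ?P = "PiM {..<n} (\<lambda>_. lborel :: real measure)"
  define F where "F x y = complex_of_real (ope_weight n y) / (\<Prod>i<n. \<Prod>k<n. 1 + (x k)\<^sup>2 - x k * complex_of_real (y i))" for x y
  have meas: "F x \<in> borel_measurable ?P" for x
    unfolding F_def by (intro borel_measurable_divide borel_measurable_prod) auto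
  have 1: "(\<lambda>m. integral\<^sup>L ?P (F (Y m))) \<longlonglongrightarrow> integral\<^sup>L ?P (F x)"
  proof (rule integral_dominated_convergence[where w="\<lambda>y. ope_weight n y * (\<Prod>i<n. \<Prod>k<n. 1 / (1 - r)\<^sup>2)"])
    show "AE y in ?P. (\<lambda>m. F (Y m) y) \<longlonglongrightarrow> F x y"
    proof (rule AE_I2)
      fix y
      show "(\<lambda>m. F (Y m) y) \<longlonglongrightarrow> F x y"
      proof (cases "\<forall>i<n. y i \<in> {-2..2}")
        case True
        then have "(\<Prod>i<n. \<Prod>k<n. 1 + (x k)\<^sup>2 - x k * complex_of_real (y i)) \<noteq> 0"
          using quadratic_nonzero lt1 by auto
        then show ?thesis unfolding F_def by (intro tendsto_intros tendsto_prod Ylim)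
      next
        case False
        then obtain i where "i < n" "y i \<notin> {-2..2}" by auto
        then have "ope_weight n y = 0" by (rule ope_weight_eq_0)
        then show ?thesis by (simp add: F_def)
      qed
    qed
    fix m
    show "AE y in ?P. norm (F (Y m) y) \<le> ope_weight n y * (\<Prod>i<n. \<Prod>k<n. 1 / (1 - r)\<^sup>2)"
    proof (rule AE_I2)
      fix y
      show "norm (F (Y m) y) \<le> ope_weight n y * (\<Prod>i<n. \<Prod>k<n. 1 / (1 - r)\<^sup>2)"
      proof (cases "\<forall>i<n. y i \<in> {-2..2}")
        case True
        have "norm (F (Y m) y) = ope_weight n y * norm (1 / (\<Prod>i<n. \<Prod>k<n. 1 + (Y m k)\<^sup>2 - Y m k * of_real (y i)))"
          unfolding F_def by (simp add: norm_divide ope_weight_nonneg)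
        also have "\<dots> \<le> ope_weight n y * (\<Prod>i<n. \<Prod>k<n. 1 / (1 - r)\<^sup>2)"
          by (intro mult_left_mono norm_inverse_quadratics_le ope_weight_nonneg)
             (use True r(1) Y(2)[THEN less_imp_le] in auto)
        finally show ?thesis .
      next
        case False
        then obtain i where "i < n" "y i \<notin> {-2..2}" by auto
        then have "ope_weight n y = 0" by (rule ope_weight_eq_0)
        then show ?thesis by (simp add: F_def)
      qed
    qed
  qed (auto intro!: meas ope_weight_integrable)
  have 2: "integral\<^sup>L ?P (F (Y m)) = fact n * (\<Prod>k<n. \<Prod>l<n. if k < l then 1 / (1 - Y m k * Y m l) else 1)" for m
    unfolding F_def using Y r(1)
    by (intro ope_weight_rational_integral_distinct Yinj) (auto intro: less_trans[OF Y(2)])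
  have 3: "(\<lambda>m. fact n * (\<Prod>k<n. \<Prod>l<n. if k < l then 1 / (1 - Y m k * Y m l) else 1)) \<longlonglongrightarrow>
      fact n * (\<Prod>k<n. \<Prod>l<n. if k < l then 1 / (1 - x k * x l) else 1)"
  proof (intro tendsto_mult tendsto_const tendsto_prod)
    fix k l assume kl: "k \<in> {..<n}" "l \<in> {..<n}"
    have "norm (x k * x l) < 1"
      using mult_strict_mono'[of "norm (x k)" 1 "norm (x l)" 1] lt1 kl by (simp add: norm_mult)
    then have "1 - x k * x l \<noteq> 0" by auto
    then show "(\<lambda>m. if k < l then 1 / (1 - Y m k * Y m l) else 1) \<longlonglongrightarrow> (if k < l then 1 / (1 - x k * x l) else 1)"
      by (auto intro!: tendsto_intros Ylim)
  qed
  show ?thesis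
    using LIMSEQ_unique[OF 1[unfolded 2] 3] unfolding F_def .
qed

text \<open>With all x_k = 0 every denominator and every pair factor is 1, so the n! of Andreief's
  identity is exactly the normalising constant.\<close>

lemma ope_Z_eq_fact: "ope_Z n = fact n"
proof -
  have "(\<integral>y. complex_of_real (ope_weight n y) \<partial>PiM {..<n} (\<lambda>_. lborel)) = fact n"
    using ope_weight_rational_integral[of n "\<lambda>_. 0"] by (simp cong: if_cong)
  then show ?thesis
    unfolding ope_Z_def by (simp add: integral_complex_of_real) (metis of_real_eq_iff of_real_fact)
qed

lemma prob_space_ope: "prob_space (ope n)"
proof
  have "emeasure (ope n) (space (ope n)) = (\<integral>\<^sup>+y. ennreal (ope_weight n y / ope_Z n) \<partial>PiM {..<n} (\<lambda>_. lborel))"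
    unfolding ope_def by (subst emeasure_density) (auto intro!: nn_integral_cong)
  also have "\<dots> = ennreal (\<integral>y. ope_weight n y / ope_Z n \<partial>PiM {..<n} (\<lambda>_. lborel))"
    by (intro nn_integral_eq_integral) (auto intro!: ope_weight_integrable simp: ope_Z_eq_fact ope_weight_nonneg)
  also have "(\<integral>y. ope_weight n y / ope_Z n \<partial>PiM {..<n} (\<lambda>_. lborel)) = 1"
    using ope_Z_eq_fact[of n] by (simp flip: ope_Z_def)
  finally show "emeasure (ope n) (space (ope n)) = 1" by simp
qed

lemma AE_ope_support: "AE y in ope n. \<forall>i<n. y i \<in> {-2..2}"
proof -
  have "0 < ennreal (ope_weight n y / ope_Z n) \<longrightarrow> (\<forall>i<n. y i \<in> {-2..2})" for y
    by (metis ope_weight_eq_0 div_0 ennreal_0 less_irrefl)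
  then show ?thesis
    unfolding ope_def by (subst AE_density) auto
qed

lemma ope_expectation_rational:
  fixes x :: "nat \<Rightarrow> complex"
  assumes "\<And>k. k < n \<Longrightarrow> norm (x k) < 1"
  shows "(\<integral>y. 1 / (\<Prod>i<n. \<Prod>k<n. 1 + (x k)\<^sup>2 - x k * of_real (y i)) \<partial>ope n) =
         (\<Prod>k<n. \<Prod>l<n. if k < l then 1 / (1 - x k * x l) else 1)"
proof -
  have "(\<integral>y. 1 / (\<Prod>i<n. \<Prod>k<n. 1 + (x k)\<^sup>2 - x k * of_real (y i)) \<partial>ope n) =
     (\<integral>y. (ope_weight n y / ope_Z n) *\<^sub>R (1 / (\<Prod>i<n. \<Prod>k<n. 1 + (x k)\<^sup>2 - x k * complex_of_real (y i))) \<partial>PiM {..<n} (\<lambda>_. lborel))"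
    unfolding ope_def
    by (intro integral_density) (auto intro!: borel_measurable_divide borel_measurable_prod AE_I2 simp: ope_weight_nonneg ope_Z_eq_fact)
  also have "\<dots> = (\<integral>y. (1 / fact n) * (complex_of_real (ope_weight n y) / (\<Prod>i<n. \<Prod>k<n. 1 + (x k)\<^sup>2 - x k * of_real (y i))) \<partial>PiM {..<n} (\<lambda>_. lborel))"
    by (simp add: ope_Z_eq_fact scaleR_conv_of_real)
  also have "\<dots> = (1 / fact n) * (fact n * (\<Prod>k<n. \<Prod>l<n. if k < l then 1 / (1 - x k * x l) else 1))"
    by (subst integral_mult_right_zero) (simp only: ope_weight_rational_integral[OF assms])
  finally show ?thesis by simp
qed

lemma measurable_ope [measurable_cong]: "sets (ope n) = sets (PiM {..<n} (\<lambda>_. borel))"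
  unfolding ope_def by (simp cong: sets_PiM_cong)

section \<open>Polynomial approximation of the symbol\<close>

text \<open>The term at m = 0 is 1 / 0 = 0, so the series really starts at m = 1. The same
  convention makes the zeroth normalised power sum vanish below.\<close>

lemma neg_Ln_sums:
  assumes "norm (w :: complex) < 1"
  shows "(\<lambda>m. w ^ m / of_nat m) sums (- Ln (1 - w))"
  using sums_minus[OF Ln_series'[of "- w"]] assms by simp

lemma power_series_coeff_bound:
  fixes h :: "complex \<Rightarrow> complex"
  assumes sums: "\<And>z. norm z < R \<Longrightarrow> (\<lambda>m. a m * z ^ m) sums h z"
    and r: "0 < r" "r < R" and B: "\<And>z. norm z < R \<Longrightarrow> norm (h z) \<le> B"
  shows "norm (a m) \<le> B / r ^ m"
proof -
  have hol: "h holomorphic_on ball 0 R"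
    by (rule power_series_holomorphic[where a=a]) (use sums in auto)
  have "h has_fps_expansion Abs_fps a"
  proof (rule has_fps_expansionI)
    have "eventually (\<lambda>u. u \<in> ball 0 R) (nhds (0::complex))"
      using r by (intro eventually_nhds_in_open) auto
    then show "\<forall>\<^sub>F u in nhds 0. (\<lambda>n. fps_nth (Abs_fps a) n * u ^ n) sums h u"
      by eventually_elim (use sums in auto)
  qed
  from fps_nth_fps_expansion[OF this, of m] have "a m = (deriv ^^ m) h 0 / fact m"
    by simp
  moreover have "norm ((deriv ^^ m) h 0) \<le> fact m * B / r ^ m"
  proof (rule Cauchy_inequality)
    show "h holomorphic_on ball 0 r" using hol by (rule holomorphic_on_subset) (use r in auto)
    show "continuous_on (cball 0 r) h"
      by (rule holomorphic_on_imp_continuous_on, rule holomorphic_on_subset[OF hol]) (use r in auto)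
  qed (use r B in auto)
  ultimately show ?thesis
    by (simp add: norm_divide divide_le_eq mult.commute)
qed

lemma sum_pairs_mult:
  fixes a :: "nat \<Rightarrow> complex"
  shows "(\<Sum>k<n. \<Sum>l<n. if k < l then a k * a l else 0) = ((\<Sum>k<n. a k)\<^sup>2 - (\<Sum>k<n. (a k)\<^sup>2)) / 2"
proof (induction n)
  case (Suc n)
  have "(\<Sum>l<n. if n < l then a n * a l else 0) = 0"
    by (intro sum.neutral) auto
  then have "(\<Sum>k<Suc n. \<Sum>l<Suc n. if k < l then a k * a l else 0) =
      (\<Sum>k<n. \<Sum>l<n. if k < l then a k * a l else 0) + (\<Sum>k<n. a k) * a n"
    by (simp add: sum.distrib sum_distrib_right)
  then show ?case
    unfolding Suc by (simp add: power2_eq_square field_simps)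
qed simp

text \<open>Summing -Ln (1 - x_k x_l) = \<Sum> (x_k x_l)^m / m over pairs gives (P_m^2 - P_2m) / (2
  m) for the power sums P_m = m \<open>g m\<close>. The squares become the variance of the limit,
  the terms \<open>g (2 * m)\<close> the asymptotic mean.\<close>

lemma prod_pairs_eq_exp:
  fixes x :: "nat \<Rightarrow> complex"
  assumes lt1: "\<And>k. k < n \<Longrightarrow> norm (x k) < 1"
  defines "g \<equiv> \<lambda>m. (\<Sum>k<n. x k ^ m) / of_nat m"
  shows "\<exists>S. (\<lambda>m. of_nat m * (g m)\<^sup>2 / 2 - g (2 * m)) sums S \<and>
             (\<Prod>k<n. \<Prod>l<n. if k < l then 1 / (1 - x k * x l) else 1) = exp S"
proof -
  have xx: "norm (x k * x l) < 1" if "k < n" "l < n" for k l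
    using mult_strict_mono'[of "norm (x k)" 1 "norm (x l)" 1] lt1 that by (simp add: norm_mult)
  define S where "S = (\<Sum>k<n. \<Sum>l<n. if k < l then - Ln (1 - x k * x l) else 0)"
  have "(\<lambda>m. \<Sum>k<n. \<Sum>l<n. if k < l then (x k * x l) ^ m / of_nat m else 0) sums S"
    unfolding S_def
    by (intro sums_sum) (use neg_Ln_sums[OF xx] in auto)
  moreover have "(\<Sum>k<n. \<Sum>l<n. if k < l then (x k * x l) ^ m / of_nat m else 0) =
      of_nat m * (g m)\<^sup>2 / 2 - g (2 * m)" for m
  proof -
    have "(\<Sum>k<n. \<Sum>l<n. if k < l then (x k * x l) ^ m / of_nat m else 0) =
        (\<Sum>k<n. \<Sum>l<n. if k < l then x k ^ m * x l ^ m else 0) / of_nat m"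
      unfolding sum_divide_distrib by (intro sum.cong refl) (auto simp: power_mult_distrib)
    also have "\<dots> = of_nat m * (g m)\<^sup>2 / 2 - g (2 * m)"
      unfolding sum_pairs_mult g_def by (cases "m = 0") (auto simp: field_simps power2_eq_square power_mult)
    finally show ?thesis .
  qed
  moreover have "(\<Prod>k<n. \<Prod>l<n. if k < l then 1 / (1 - x k * x l) else 1) = exp S"
    unfolding S_def exp_sum[OF finite_lessThan]
  proof (intro prod.cong refl)
    fix k l assume kl: "k \<in> {..<n}" "l \<in> {..<n}"
    then have "1 - x k * x l \<noteq> 0" using xx[of k l] by auto
    then show "(if k < l then 1 / (1 - x k * x l) else 1) = exp (if k < l then - Ln (1 - x k * x l) else 0)"
      by (simp add: exp_minus inverse_eq_divide)
  qed
  ultimately show ?thesis by auto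
qed

text \<open>The reversed polynomial \<Sum> F_l u^(n-l) is monic of degree n because
  \<open>F 0 = 1\<close>, so it always has n roots. Some of them are 0 when \<open>F n\<close>
  vanishes, which keeps the number of factors equal to n.\<close>

lemma polynomial_product_form:
  fixes F :: "nat \<Rightarrow> complex"
  assumes "F 0 = 1"
  shows "\<exists>x. \<forall>z. (\<Sum>l\<le>n. F l * z ^ l) = (\<Prod>k<n. 1 - x k * z)"
proof -
  define P where "P = (\<Sum>l\<le>n. monom (F l) (n - l))"
  have coeffn: "coeff P n = 1"
  proof -
    have "coeff P n = (\<Sum>l\<le>n. if n - l = n then F l else 0)"
      unfolding P_def by (simp add: coeff_sum)
    also have "\<dots> = (\<Sum>l\<le>n. if l = 0 then F l else 0)"
      by (intro sum.cong refl) auto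
    finally show ?thesis using assms by simp
  qed
  moreover have "degree P \<le> n"
    unfolding P_def by (intro degree_sum_le) (auto intro: order.trans[OF degree_monom_le])
  ultimately have deg: "degree P = n"
    by (metis le_antisym le_degree zero_neq_one)
  obtain as where as: "Polynomial.smult (coeff P (degree P)) (\<Prod>a\<leftarrow>as. [:- a, 1:]) = P" "length as = degree P"
    using fundamental_theorem_algebra_factorized by blast
  have polyP: "poly P u = (\<Prod>k<n. u - as ! k)" for u
  proof -
    have "poly P u = (\<Prod>a\<leftarrow>as. u - a)"
    proof -
      have P: "P = (\<Prod>a\<leftarrow>as. [:- a, 1:])"
        using as(1) coeffn deg by simp
      show ?thesis
        unfolding P by (induction as) (simp_all add: left_diff_distrib)
    qed
    also have "\<dots> = (\<Prod>k<n. u - as ! k)"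
      using as(2) deg by (subst prod.list_conv_set_nth) (simp add: lessThan_atLeast0)
    finally show ?thesis .
  qed
  have "(\<Sum>l\<le>n. F l * z ^ l) = (\<Prod>k<n. 1 - as ! k * z)" for z
  proof (cases "z = 0")
    case True
    then show ?thesis using assms by (simp add: power_0_left if_distrib cong: if_cong)
  next
    case False
    have "(\<Sum>l\<le>n. F l * z ^ l) = z ^ n * poly P (1 / z)"
      unfolding P_def poly_sum sum_distrib_left
      by (intro sum.cong refl) (use False in \<open>auto simp: poly_monom power_divide power_diff field_simps\<close>)
    also have "\<dots> = (\<Prod>k<n. z * (1 / z - as ! k))"
      unfolding polyP prod.distrib by simp
    also have "\<dots> = (\<Prod>k<n. 1 - as ! k * z)"
      using False by (intro prod.cong refl) (simp add: field_simps)
    finally show ?thesis .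
  qed
  then show ?thesis by (intro exI[of _ "\<lambda>k. as ! k"]) auto
qed

text \<open>Differentiating exp D = 1 gives D' = 0, so D keeps its value at the centre. Two
  logarithms of one function are thereby identified without following branches.\<close>

lemma exp_eq_1_imp_zero:
  fixes D :: "complex \<Rightarrow> complex"
  assumes hol: "D holomorphic_on ball 0 R" and "0 < R" and D0: "D 0 = 0"
    and exp1: "\<And>z. z \<in> ball 0 R \<Longrightarrow> exp (D z) = 1"
    and z: "z \<in> ball 0 R"
  shows "D z = 0"
proof -
  have "\<exists>c. \<forall>z\<in>ball 0 R. D z = c"
  proof (rule has_field_derivative_zero_constant)
    fix w assume w: "w \<in> ball (0::complex) R"
    have d: "(D has_field_derivative deriv D w) (at w)"
      using holomorphic_derivI[OF hol _ w] by simp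
    then have "((\<lambda>z. exp (D z)) has_field_derivative exp (D w) * deriv D w) (at w)"
      by (auto intro!: derivative_eq_intros)
    moreover have "((\<lambda>z. exp (D z)) has_field_derivative 0) (at w)"
      by (rule has_field_derivative_transform_within_open[of "\<lambda>_. 1" _ _ "ball 0 R"])
         (use w exp1 in auto)
    ultimately have "exp (D w) * deriv D w = 0" by (rule DERIV_unique)
    then show "(D has_field_derivative 0) (at w within ball 0 R)"
      using d by (auto intro: has_field_derivative_at_within)
  qed simp
  then show ?thesis using D0 z \<open>0 < R\<close> by (metis centre_in_ball)
qed

text \<open>Everything is read off from G = q exp (\<tau> V), where q is the Taylor polynomial of
  exp (- \<tau> V) and G is within \<eta> of 1 on the disc of radius s^-2. So q has no zeros there,
  and all x_k lie in the unit disc; the coefficients of -Ln G are the deviations of the power sums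
  from \<tau> v; and at 2 cos t the product of the quadratics is q(z) q(1/z), where G(z) and G(1/z)
  become \<open>g\<close> and \<open>g'\<close>.\<close>

lemma szego_polynomial_approximation:
  fixes v :: "nat \<Rightarrow> real" and \<tau> :: complex and s C :: real and n :: nat
  assumes s: "0 < s" "s < 1" and v0: "v 0 = 0"
    and summ: "summable (\<lambda>k. \<bar>v k\<bar> / s ^ (4 * k))" and C: "(\<Sum>k. \<bar>v k\<bar> / s ^ (4 * k)) \<le> C"
  defines "A \<equiv> exp (norm \<tau> * C)"
  defines "\<eta> \<equiv> A\<^sup>2 * s ^ n / (1 - s)"
  assumes small: "\<eta> \<le> 1 / 4"
  shows "\<exists>x S. (\<forall>k<n. norm (x k) < 1) \<and>
     (\<Prod>k<n. \<Prod>l<n. if k < l then 1 / (1 - x k * x l) else 1) = exp S \<and>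
     norm (S - (\<tau>\<^sup>2 / 2 * of_real (\<Sum>m. real m * (v m)\<^sup>2) - \<tau> * of_real (\<Sum>m. v (2 * m))))
       \<le> 2 * \<eta> * (norm \<tau> * C + 2) / (1 - s)\<^sup>2 \<and>
     (\<forall>t. \<exists>g g'. norm (g - 1) \<le> \<eta> \<and> norm (g' - 1) \<le> \<eta> \<and>
        (\<Prod>k<n. 1 + (x k)\<^sup>2 - x k * complex_of_real (2 * cos t)) =
          exp (- \<tau> * of_real (\<Sum>k. v k * (2 * cos (real k * t)))) * (g * g'))"
proof -
  have vb: "\<bar>v k\<bar> / s ^ (4 * k) \<le> C" for k
    using sum_le_suminf[OF summ, of "{k}"] C s by simp
  have C0: "0 \<le> C" using vb[of 0] by (simp add: v0)
  have v_le: "\<bar>v k\<bar> \<le> C * s ^ k" for k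
  proof -
    have "\<bar>v k\<bar> \<le> C * s ^ (4 * k)" using vb[of k] s by (simp add: field_simps)
    also have "\<dots> \<le> C * s ^ k" using s C0 by (intro mult_left_mono power_decreasing) auto
    finally show ?thesis .
  qed
  have v_le_C: "\<bar>v k\<bar> \<le> C" for k
    using v_le[of k] s C0 by (meson mult_left_le order_trans power_le_one less_imp_le)
  have A1: "1 \<le> A" unfolding A_def using C0 by simp
  have eta0: "0 \<le> \<eta>" unfolding \<eta>_def using s A1 by simp
  \<comment> \<open>One factor of s is spent per estimate: V is bounded on radius s^-4, the
    coefficients of F are estimated on s^-3, the Taylor remainder on s^-2, and the coefficients of
    the logarithm on s^-1. This explains the exponent 4 in the hypothesis.\<close>
  have rad: "1 / s ^ 2 < 1 / s ^ 3" "1 / s ^ 3 < 1 / s ^ 4" "1 / s < 1 / s ^ 2" "1 < 1 / s"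
    using s by (auto simp: field_simps power_numeral_reduce)
  define V where "V z = (\<Sum>k. complex_of_real (v k) * z ^ k)" for z
  have V_term: "norm (complex_of_real (v k) * z ^ k) \<le> \<bar>v k\<bar> / s ^ (4 * k)" if "norm z \<le> 1 / s ^ 4" for z k
  proof -
    have "norm z ^ k \<le> (1 / s ^ 4) ^ k" using that by (intro power_mono) auto
    also have "\<dots> = 1 / s ^ (4 * k)" by (simp add: power_divide power_mult)
    finally show ?thesis
      using mult_left_mono[of "norm z ^ k" "1 / s ^ (4 * k)" "\<bar>v k\<bar>"] by (simp add: norm_mult norm_power)
  qed
  have V_summable: "summable (\<lambda>k. complex_of_real (v k) * z ^ k)" if "norm z \<le> 1 / s ^ 4" for z
    by (rule summable_comparison_test'[OF summ, of 0]) (use V_term[OF that] in auto)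
  have V_sums: "(\<lambda>k. complex_of_real (v k) * z ^ k) sums V z" if "norm z \<le> 1 / s ^ 4" for z
    unfolding V_def using V_summable[OF that] by (rule summable_sums)
  have V_le: "norm (V z) \<le> C" if "norm z \<le> 1 / s ^ 4" for z
    unfolding V_def using norm_suminf_le[OF V_term[OF that] summ] C by linarith
  have V_hol: "V holomorphic_on ball 0 (1 / s ^ 4)"
    by (rule power_series_holomorphic[where a="\<lambda>k. complex_of_real (v k)"]) (use V_sums in auto)
  have V0: "V 0 = 0"
    using sums_unique2[OF V_sums[of 0] powser_sums_zero] s v0 by simp
  define F where "F z = exp (- \<tau> * V z)" for z
  have F_hol: "F holomorphic_on ball 0 (1 / s ^ 4)"
    unfolding F_def by (intro holomorphic_intros V_hol)
  have tauV: "norm (\<tau> * V z) \<le> norm \<tau> * C" if "norm z \<le> 1 / s ^ 4" for z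
    using mult_left_mono[OF V_le[OF that], of "norm \<tau>"] by (simp add: norm_mult)
  have F_le: "norm (F z) \<le> A" and invF_le: "norm (exp (\<tau> * V z)) \<le> A" if "norm z \<le> 1 / s ^ 4" for z
    unfolding F_def A_def using tauV[OF that] norm_exp[of "- \<tau> * V z"] norm_exp[of "\<tau> * V z"]
    by (force intro: order.trans)+
  define a where "a l = (deriv ^^ l) F 0 / fact l" for l
  have F_sums: "(\<lambda>l. a l * z ^ l) sums F z" if "norm z < 1 / s ^ 4" for z
    using holomorphic_power_series[OF F_hol, of z] that by (simp add: a_def)
  have a0: "a 0 = 1" by (simp add: a_def F_def V0)
  have a_le: "norm (a l) \<le> A * s ^ (3 * l)" for l
  proof -
    have "norm (a l) \<le> A / (1 / s ^ 3) ^ l"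
      using s rad by (intro power_series_coeff_bound[OF F_sums]) (auto intro!: F_le)
    then show ?thesis by (simp add: power_divide power_mult)
  qed
  define q where "q z = (\<Sum>l\<le>n. a l * z ^ l)" for z
  have q_approx: "norm (q z - F z) \<le> A * s ^ n / (1 - s)" if z: "norm z \<le> 1 / s ^ 2" for z
  proof -
    have lt: "norm z < 1 / s ^ 4" using z rad by linarith
    have "F z = (\<Sum>l. a l * z ^ l)" using F_sums[OF lt] by (rule sums_unique)
    also have "\<dots> = (\<Sum>l. a (l + Suc n) * z ^ (l + Suc n)) + (\<Sum>l<Suc n. a l * z ^ l)"
      using F_sums[OF lt] by (intro suminf_split_initial_segment sums_summable)
    finally have "norm (q z - F z) = norm (\<Sum>l. a (l + Suc n) * z ^ (l + Suc n))"
      unfolding q_def lessThan_Suc_atMost by (simp add: norm_minus_commute)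
    also have "\<dots> \<le> (\<Sum>l. A * s ^ n * s ^ l)"
    proof (rule norm_suminf_le)
      fix l
      have "norm (a m * z ^ m) \<le> A * s ^ m" for m
      proof -
        have "norm z ^ m \<le> (1 / s ^ 2) ^ m" using z by (intro power_mono) auto
        then have "norm (a m * z ^ m) \<le> A * s ^ (3 * m) * (1 / s ^ 2) ^ m"
          unfolding norm_mult norm_power using a_le[of m] A1 s by (intro mult_mono) auto
        also have "\<dots> = A * s ^ m"
        proof -
          have "s ^ (3 * m) = s ^ m * s ^ (2 * m)" by (simp flip: power_add)
          then show ?thesis using s by (simp add: power_divide power_mult)
        qed
        finally show ?thesis .
      qed
      from this[of "l + Suc n"] have "norm (a (l + Suc n) * z ^ (l + Suc n)) \<le> A * s ^ (l + Suc n)" .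
      also have "\<dots> \<le> A * s ^ (n + l)" using A1 s by (intro mult_left_mono power_decreasing) auto
      finally show "norm (a (l + Suc n) * z ^ (l + Suc n)) \<le> A * s ^ n * s ^ l"
        by (simp add: power_add mult_ac)
    qed (use s in \<open>auto intro!: summable_mult summable_geometric\<close>)
    also have "\<dots> = A * s ^ n / (1 - s)"
      using s by (subst suminf_mult) (auto simp: suminf_geometric intro!: summable_geometric)
    finally show ?thesis .
  qed
  define G where "G z = q z * exp (\<tau> * V z)" for z
  have qFG: "q z = F z * G z" for z
    unfolding F_def G_def by (simp add: exp_minus field_simps)
  \<comment> \<open>One \<open>A\<close> comes from the Taylor coefficients of F, the other from exp
    (\<tau> V); together they give the square in \<open>\<eta>\<close>.\<close>
  have G1: "norm (G z - 1) \<le> \<eta>" if z: "norm z \<le> 1 / s ^ 2" for z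
  proof -
    have z4: "norm z \<le> 1 / s ^ 4" using z rad by linarith
    have "G z - 1 = (q z - F z) * exp (\<tau> * V z)"
      unfolding G_def F_def by (simp add: exp_minus field_simps)
    then have "norm (G z - 1) \<le> (A * s ^ n / (1 - s)) * A"
      unfolding norm_mult using q_approx[OF z] invF_le[OF z4] A1 s
      by (simp only: norm_mult) (intro mult_mono, auto)
    then show ?thesis unfolding \<eta>_def by (simp add: power2_eq_square mult_ac)
  qed
  have G0: "G z \<noteq> 0" if "norm z \<le> 1 / s ^ 2" for z
    using G1[OF that] small by auto
  obtain x where x: "\<And>z. q z = (\<Prod>k<n. 1 - x k * z)"
    using polynomial_product_form[of a n] a0 unfolding q_def by auto
  \<comment> \<open>Otherwise 1/x_k would be a zero of q in the disc where q = F G and neither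
    factor vanishes.\<close>
  have x_lt: "norm (x k) < s ^ 2" if k: "k < n" for k
  proof (rule ccontr)
    assume *: "\<not> norm (x k) < s ^ 2"
    then have x0: "x k \<noteq> 0" using s by auto
    have "norm (1 / x k) \<le> 1 / s ^ 2" using * s x0 by (auto simp: norm_divide intro!: divide_left_mono mult_pos_pos)
    then have "q (1 / x k) \<noteq> 0" using G0[of "1 / x k"] by (simp add: qFG F_def)
    moreover have "q (1 / x k) = 0" unfolding x using k x0 by (auto intro!: prod_zero)
    ultimately show False by simp
  qed
  have x_lt1: "norm (x k) < 1" if "k < n" for k
    using x_lt[OF that] s by (meson less_le_trans power_le_one less_imp_le)
  have xz: "norm (x k * z) < 1" if "k < n" "norm z < 1 / s ^ 2" for k z
  proof -
    have "norm (x k * z) < s ^ 2 * (1 / s ^ 2)"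
      unfolding norm_mult using x_lt[OF that(1)] that(2) s by (intro mult_strict_mono) auto
    then show ?thesis using s by simp
  qed
  define L where "L z = (\<Sum>k<n. - Ln (1 - x k * z))" for z
  have nonpos: "1 - w \<notin> \<real>\<^sub>\<le>\<^sub>0" if "norm w < 1" for w :: complex
    using complex_Re_le_cmod[of w] that by (auto simp: complex_nonpos_Reals_iff)
  have L_hol: "L holomorphic_on ball 0 (1 / s ^ 2)"
    unfolding L_def by (intro holomorphic_intros nonpos) (use xz in auto)
  have G_nonpos: "G z \<notin> \<real>\<^sub>\<le>\<^sub>0" if "norm z \<le> 1 / s ^ 2" for z
    using nonpos[of "1 - G z"] G1[OF that] small by (simp add: norm_minus_commute)
  have sub: "ball 0 (1 / s ^ 2) \<subseteq> ball (0::complex) (1 / s ^ 4)"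
    using rad by (intro subset_ball) linarith
  have G_hol: "G holomorphic_on ball 0 (1 / s ^ 2)"
    unfolding G_def q_def by (intro holomorphic_intros holomorphic_on_subset[OF V_hol sub])
  \<comment> \<open>Both \<open>- L\<close> and \<open>Ln G - \<tau> V\<close> are logarithms of \<open>q\<close> vanishing at the origin.\<close>
  define D where "D z = L z - \<tau> * V z + Ln (G z)" for z
  have D_hol: "D holomorphic_on ball 0 (1 / s ^ 2)"
    unfolding D_def
    by (intro holomorphic_intros L_hol G_hol holomorphic_on_subset[OF V_hol sub] G_nonpos) auto
  have D_eq: "D z = 0" if z: "norm z < 1 / s ^ 2" for z
  proof (rule exp_eq_1_imp_zero[OF D_hol])
    show "D 0 = 0" by (simp add: D_def L_def V0 G_def x)
    fix w assume "w \<in> ball (0::complex) (1 / s ^ 2)"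
    then have w: "norm w < 1 / s ^ 2" by simp
    have "exp (L w) = 1 / q w"
      unfolding L_def x exp_sum[OF finite_lessThan] prod_dividef[symmetric, of "\<lambda>_. 1", simplified]
    proof (intro prod.cong refl)
      fix k assume "k \<in> {..<n}"
      then have "1 - x k * w \<noteq> 0" using xz[of k w] w by auto
      then show "exp (- Ln (1 - x k * w)) = 1 / (1 - x k * w)"
        by (simp add: exp_minus inverse_eq_divide)
    qed
    moreover have "exp (D w) = exp (L w) * (exp (- \<tau> * V w) * exp (Ln (G w)))"
      unfolding D_def exp_add[symmetric] by (simp add: algebra_simps)
    moreover have "exp (Ln (G w)) = G w" using G0[of w] w by simp
    moreover have "q w \<noteq> 0" using G0[of w] w by (simp add: qFG F_def)
    ultimately show "exp (D w) = 1" by (simp add: qFG F_def)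
  qed (use z s in auto)
  define g where "g m = (\<Sum>k<n. x k ^ m) / of_nat m" for m
  \<comment> \<open>The deviation of the normalised power sum from its target \<tau> v. By
    \<open>D_eq\<close> these numbers are the power series coefficients of -Ln G.\<close>
  define h where "h m = g m - \<tau> * of_real (v m)" for m
  have L_sums: "(\<lambda>m. g m * z ^ m) sums L z" if z: "norm z < 1 / s ^ 2" for z
  proof -
    have "(\<lambda>m. \<Sum>k<n. (x k * z) ^ m / of_nat m) sums L z"
      unfolding L_def by (intro sums_sum neg_Ln_sums) (use xz z in auto)
    moreover have "(\<Sum>k<n. (x k * z) ^ m / of_nat m) = g m * z ^ m" for m
      unfolding g_def by (simp add: power_mult_distrib sum_divide_distrib[symmetric] sum_distrib_right[symmetric])
    ultimately show ?thesis by simp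
  qed
  have h_sums: "(\<lambda>m. h m * z ^ m) sums (- Ln (G z))" if z: "norm z < 1 / s ^ 2" for z
  proof -
    have "(\<lambda>m. g m * z ^ m - \<tau> * (of_real (v m) * z ^ m)) sums (L z - \<tau> * V z)"
      using z rad by (intro sums_diff sums_mult L_sums V_sums) auto
    moreover have "L z - \<tau> * V z = - Ln (G z)"
      using D_eq[OF z] unfolding D_def by (simp add: eq_neg_iff_add_eq_0)
    ultimately show ?thesis unfolding h_def by (simp add: algebra_simps)
  qed
  \<comment> \<open>|Ln G| is at most 2 \<eta> on the disc of radius s^-2. Cauchy's estimate on the
    circle of radius 1/s adds the decay s^m, which is what makes the deviations summable with the
    weight m.\<close>
  have h_le: "norm (h m) \<le> 2 * \<eta> * s ^ m" for m
  proof -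
    have "norm (h m) \<le> (2 * \<eta>) / (1 / s) ^ m"
    proof (rule power_series_coeff_bound[OF h_sums])
      fix z :: complex assume z: "norm z < 1 / s ^ 2"
      then have "norm (Ln (1 + (G z - 1))) \<le> 2 * norm (G z - 1)"
        using G1[of z] small by (intro norm_Ln_le) auto
      then show "norm (- Ln (G z)) \<le> 2 * \<eta>" using G1[of z] z by simp
    qed (use s rad in auto)
    then show ?thesis by (simp add: power_divide)
  qed
  have h0: "h 0 = 0" by (simp add: h_def g_def v0)
  obtain S where S: "(\<lambda>m. of_nat m * (g m)\<^sup>2 / 2 - g (2 * m)) sums S"
      "(\<Prod>k<n. \<Prod>l<n. if k < l then 1 / (1 - x k * x l) else 1) = exp S"
    using prod_pairs_eq_exp[of n x] x_lt1 unfolding g_def by blast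
  have geo: "summable (\<lambda>m. real m * s ^ m)" "(\<Sum>m. real m * s ^ m) \<le> 1 / (1 - s)\<^sup>2"
  proof -
    have *: "(\<lambda>m. real (Suc m) * s ^ m) sums (1 / (1 - s)\<^sup>2)"
      using s geometric_deriv_sums[of s] by simp
    show **: "summable (\<lambda>m. real m * s ^ m)"
      by (rule summable_comparison_test'[OF sums_summable[OF *], of 0]) (use s in auto)
    show "(\<Sum>m. real m * s ^ m) \<le> 1 / (1 - s)\<^sup>2"
      unfolding sums_unique[OF *] using s by (intro suminf_le ** sums_summable[OF *]) auto
  qed
  define T where "T = \<tau>\<^sup>2 / 2 * of_real (\<Sum>m. real m * (v m)\<^sup>2) - \<tau> * of_real (\<Sum>m. v (2 * m))"
  have "summable (\<lambda>m. real m * (v m)\<^sup>2)"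
  proof (rule summable_comparison_test'[OF summable_mult[OF geo(1), of "C * C"], of 0])
    fix m
    have "\<bar>v m\<bar> * \<bar>v m\<bar> \<le> C * (C * s ^ m)"
      using v_le[of m] v_le_C[of m] C0 by (intro mult_mono) auto
    then have "real m * (\<bar>v m\<bar> * \<bar>v m\<bar>) \<le> real m * (C * (C * s ^ m))"
      by (rule mult_left_mono) simp
    then show "norm (real m * (v m)\<^sup>2) \<le> C * C * (real m * s ^ m)"
      by (simp add: power2_eq_square mult_ac abs_mult)
  qed
  moreover have "summable (\<lambda>m. v (2 * m))"
  proof (rule summable_comparison_test'[of "\<lambda>m. C * s ^ m" 0])
    fix m
    have "\<bar>v (2 * m)\<bar> \<le> C * s ^ (2 * m)" by (rule v_le)
    also have "\<dots> \<le> C * s ^ m" using s C0 by (intro mult_left_mono power_decreasing) auto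
    finally show "norm (v (2 * m)) \<le> C * s ^ m" by simp
  qed (use s in \<open>auto intro!: summable_mult summable_geometric\<close>)
  ultimately have "(\<lambda>m. \<tau>\<^sup>2 / 2 * of_real (real m * (v m)\<^sup>2) - \<tau> * of_real (v (2 * m))) sums T"
    unfolding T_def by (intro sums_diff sums_mult sums_of_real summable_sums)
  \<comment> \<open>With g = \<tau> v + h, the difference g^2 - (\<tau> v)^2 equals h (2 \<tau> v +
    h), so every term of the error carries a factor \<open>h\<close>.\<close>
  from sums_diff[OF S(1) this]
  have ST: "(\<lambda>m. of_nat m * (h m * (2 * \<tau> * of_real (v m) + h m)) / 2 - h (2 * m)) sums (S - T)"
    by (simp add: h_def algebra_simps power2_eq_square add_divide_distrib diff_divide_distrib)
  have "norm (S - T) \<le> (\<Sum>m. 2 * \<eta> * (norm \<tau> * C + 2) * (real m * s ^ m))"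
    unfolding sums_unique[OF ST]
  proof (rule norm_suminf_le)
    fix m
    show "norm (of_nat m * (h m * (2 * \<tau> * of_real (v m) + h m)) / 2 - h (2 * m)) \<le>
        2 * \<eta> * (norm \<tau> * C + 2) * (real m * s ^ m)"
    \<comment> \<open>The majorant m s^m vanishes at m = 0, where \<open>h0\<close> is needed; for m
      \<ge> 1 it also dominates the term of \<open>h (2 * m)\<close>, since s^(2m) \<le> s^m \<le> m
      s^m.\<close>
    proof (cases "m = 0")
      case True
      then show ?thesis by (simp add: h0)
    next
      case False
      have "norm (h m) \<le> 2 * \<eta> * 1"
        using h_le[of m] eta0 s power_le_one[of s m] by (meson mult_left_mono order_trans less_imp_le mult_nonneg_nonneg zero_le_numeral)
      then have h1: "norm (h m) \<le> 1" using small by linarith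
      have "norm (2 * \<tau> * of_real (v m) + h m) \<le> 2 * (norm \<tau> * \<bar>v m\<bar>) + norm (h m)"
        by (rule order.trans[OF norm_triangle_ineq]) (simp add: norm_mult)
      also have "\<dots> \<le> 2 * (norm \<tau> * C) + 2"
        using h1 mult_left_mono[OF v_le_C[of m], of "norm \<tau>"] by simp
      finally have b: "norm (2 * \<tau> * of_real (v m) + h m) \<le> 2 * (norm \<tau> * C) + 2" .
      have "norm (of_nat m * (h m * (2 * \<tau> * of_real (v m) + h m)) / 2) =
          real m * (norm (h m) * norm (2 * \<tau> * of_real (v m) + h m)) / 2"
        by (simp only: norm_mult norm_divide norm_of_nat norm_numeral)
      also have "\<dots> \<le> real m * ((2 * \<eta> * s ^ m) * (2 * (norm \<tau> * C) + 2)) / 2"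
        using h_le[of m] b eta0 s by (intro divide_right_mono mult_left_mono mult_mono) auto
      finally have 1: "norm (of_nat m * (h m * (2 * \<tau> * of_real (v m) + h m)) / 2) \<le>
          2 * \<eta> * (norm \<tau> * C + 1) * (real m * s ^ m)"
        by (simp add: algebra_simps)
      have "norm (h (2 * m)) \<le> 2 * \<eta> * s ^ (2 * m)" by (rule h_le)
      also have "\<dots> \<le> 2 * \<eta> * (real m * s ^ m)"
      proof (intro mult_left_mono)
        have "s ^ (2 * m) \<le> 1 * s ^ m" using s by (simp add: power_decreasing)
        also have "\<dots> \<le> real m * s ^ m" using False s by (intro mult_right_mono) auto
        finally show "s ^ (2 * m) \<le> real m * s ^ m" .
      qed (use eta0 in auto)
      finally have 2: "norm (h (2 * m)) \<le> 2 * \<eta> * (real m * s ^ m)" .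
      show ?thesis
        using norm_triangle_ineq4[of "of_nat m * (h m * (2 * \<tau> * of_real (v m) + h m)) / 2" "h (2 * m)"] 1 2
        by (simp add: algebra_simps)
    qed
  qed (intro summable_mult geo)
  also have "\<dots> = 2 * \<eta> * (norm \<tau> * C + 2) * (\<Sum>m. real m * s ^ m)"
    by (rule suminf_mult[OF geo(1)])
  also have "\<dots> \<le> 2 * \<eta> * (norm \<tau> * C + 2) * (1 / (1 - s)\<^sup>2)"
    using eta0 C0 geo(2) by (intro mult_left_mono) auto
  finally have ST_le: "norm (S - T) \<le> 2 * \<eta> * (norm \<tau> * C + 2) / (1 - s)\<^sup>2" by simp
  have one: "norm (cis t) \<le> 1 / s ^ 2" "norm (cis t) \<le> 1 / s ^ 4" for t
    using rad by auto
  have angle: "\<exists>g g'. norm (g - 1) \<le> \<eta> \<and> norm (g' - 1) \<le> \<eta> \<and>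
        (\<Prod>k<n. 1 + (x k)\<^sup>2 - x k * complex_of_real (2 * cos t)) =
          exp (- \<tau> * of_real (\<Sum>k. v k * (2 * cos (real k * t)))) * (g * g')" for t
  proof (intro exI conjI)
    show "norm (G (cis t) - 1) \<le> \<eta>" "norm (G (cis (- t)) - 1) \<le> \<eta>"
      by (intro G1 one)+
    have "(\<lambda>k. of_real (v k) * cis t ^ k + of_real (v k) * cis (- t) ^ k) sums (V (cis t) + V (cis (- t)))"
      by (intro sums_add V_sums one)
    moreover have "of_real (v k) * cis t ^ k + of_real (v k) * cis (- t) ^ k = complex_of_real (v k * (2 * cos (real k * t)))" for k
      unfolding Complex.DeMoivre by (simp add: complex_eq_iff)
    ultimately have c: "(\<lambda>k. complex_of_real (v k * (2 * cos (real k * t)))) sums (V (cis t) + V (cis (- t)))"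
      by simp
    from sums_Re[OF c] have r: "(\<lambda>k. v k * (2 * cos (real k * t))) sums Re (V (cis t) + V (cis (- t)))"
      by (simp only: Re_complex_of_real)
    have VV: "V (cis t) + V (cis (- t)) = of_real (\<Sum>k. v k * (2 * cos (real k * t)))"
      unfolding sums_unique[OF r, symmetric] by (rule sums_unique2[OF c sums_of_real[OF r]])
    have "(\<Prod>k<n. 1 + (x k)\<^sup>2 - x k * complex_of_real (2 * cos t)) = q (cis t) * q (cis (- t))"
      unfolding quadratic_factor_cis prod.distrib x ..
    also have "\<dots> = exp (- \<tau> * (V (cis t) + V (cis (- t)))) * (G (cis t) * G (cis (- t)))"
      unfolding qFG F_def ring_distribs exp_add by (simp add: mult_ac)
    finally show "(\<Prod>k<n. 1 + (x k)\<^sup>2 - x k * complex_of_real (2 * cos t)) =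
          exp (- \<tau> * of_real (\<Sum>k. v k * (2 * cos (real k * t)))) * (G (cis t) * G (cis (- t)))"
      unfolding VV .
  qed
  show ?thesis
    using x_lt1 S(2) ST_le angle unfolding T_def by blast
qed

section \<open>Laplace transform of linear statistics\<close>

lemma norm_prod_near_1:
  fixes g :: "nat \<Rightarrow> complex"
  assumes g: "\<And>i. i < n \<Longrightarrow> norm (g i - 1) \<le> \<delta>" and d: "0 \<le> \<delta>" "real n * \<delta> \<le> 1"
  shows "norm ((\<Prod>i<n. g i) - 1) \<le> 2 * (real n * \<delta>)"
proof -
  have "norm ((\<Prod>i<n. g i) - 1) = norm ((\<Prod>i<n. 1 + (g i - 1)) - 1)" by simp
  also have "\<dots> \<le> (\<Prod>i<n. 1 + norm (g i - 1)) - 1"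
    by (rule norm_prod_minus1_le_prod_minus1)
  also have "(\<Prod>i<n. 1 + norm (g i - 1)) \<le> (\<Prod>i<n. exp \<delta>)"
    using g by (intro prod_mono conjI) (auto intro: add_nonneg_nonneg order.trans[OF _ exp_ge_add_one_self])
  also have "\<dots> = exp (real n * \<delta>)" by (simp add: exp_of_nat_mult)
  also have "exp (real n * \<delta>) \<le> 1 + real n * \<delta> + (real n * \<delta>)\<^sup>2"
    using d by (intro exp_bound) auto
  also have "(real n * \<delta>)\<^sup>2 \<le> real n * \<delta>"
    using d by (simp add: power2_eq_square mult_left_le)
  finally show ?thesis by (simp add: mult.commute)
qed

text \<open>The weights s^(-4k) are at least 1, so the cosine series is dominated by twice the
  weighted sum. Such a bound on the support gives all the integrability under the OPE.\<close>

lemma cosine_series_bound: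
  fixes v :: "nat \<Rightarrow> real" and s C :: real and W :: "real \<Rightarrow> real"
  assumes s: "0 < s" "s < 1"
    and summ: "summable (\<lambda>k. \<bar>v k\<bar> / s ^ (4 * k))" and C: "(\<Sum>k. \<bar>v k\<bar> / s ^ (4 * k)) \<le> C"
    and W: "\<And>t. W (2 * cos t) = (\<Sum>k. v k * (2 * cos (real k * t)))"
    and u: "u \<in> {-2..2}"
  shows "\<bar>W u\<bar> \<le> 2 * C"
proof -
  have u: "u = 2 * cos (arccos (u / 2))" using u by (subst cos_arccos) auto
  have "norm (W (2 * cos t)) \<le> (\<Sum>k. 2 * (\<bar>v k\<bar> / s ^ (4 * k)))" for t
    unfolding W
  proof (rule norm_suminf_le)
    fix k
    have "s ^ (4 * k) \<le> 1" using s by (simp add: power_le_one)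
    then have "\<bar>v k\<bar> \<le> \<bar>v k\<bar> / s ^ (4 * k)" using s by (simp add: le_divide_eq mult_left_le)
    moreover have "\<bar>v k\<bar> * \<bar>cos (real k * t)\<bar> \<le> \<bar>v k\<bar>" by (simp add: mult_left_le)
    ultimately show "norm (v k * (2 * cos (real k * t))) \<le> 2 * (\<bar>v k\<bar> / s ^ (4 * k))"
      by (simp add: abs_mult)
  qed (rule summable_mult[OF summ])
  also have "(\<Sum>k. 2 * (\<bar>v k\<bar> / s ^ (4 * k))) \<le> 2 * C"
    using C suminf_mult[OF summ, of 2] by simp
  finally show ?thesis by (subst u) simp
qed

lemma ope_linear_statistic_integrable:
  fixes W :: "real \<Rightarrow> real" and a :: real and b :: complex and n :: nat
  assumes W_meas [measurable]: "W \<in> borel_measurable borel" and W_le: "\<And>u. u \<in> {-2..2} \<Longrightarrow> \<bar>W u\<bar> \<le> K"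
  defines "X \<equiv> \<lambda>y. \<Sum>i<n. W (y i)"
  shows "integrable (ope n) X"
    and "integrable (ope n) (\<lambda>y. exp (a * X y))"
    and "integrable (ope n) (\<lambda>y. exp (b * of_real (X y)))"
proof -
  interpret prob_space "ope n" by (rule prob_space_ope)
  have X_le: "\<bar>X y\<bar> \<le> real n * K" if "\<forall>i<n. y i \<in> {-2..2}" for y
  proof -
    have "\<bar>X y\<bar> \<le> (\<Sum>i<n. \<bar>W (y i)\<bar>)" unfolding X_def by (rule sum_abs)
    also have "\<dots> \<le> (\<Sum>i<n. K)" using that by (intro sum_mono W_le) auto
    finally show ?thesis by simp
  qed
  have X_meas [measurable]: "X \<in> borel_measurable (ope n)"
    unfolding X_def by measurable
  have AE_X: "AE y in ope n. \<bar>X y\<bar> \<le> real n * K"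
    using AE_ope_support[of n] by eventually_elim (rule X_le)
  show "integrable (ope n) X"
    by (rule integrable_const_bound[of _ "real n * K"]) (use AE_X in auto)
  have exp_le: "AE y in ope n. exp (a * X y) \<le> exp (\<bar>a\<bar> * (real n * K))" for a
    using AE_X
  proof eventually_elim
    case (elim y)
    have "a * X y \<le> \<bar>a\<bar> * \<bar>X y\<bar>" by (metis abs_ge_self abs_mult)
    also have "\<dots> \<le> \<bar>a\<bar> * (real n * K)" by (intro mult_left_mono elim) auto
    finally show ?case by simp
  qed
  show "integrable (ope n) (\<lambda>y. exp (a * X y))"
    by (rule integrable_const_bound[of _ "exp (\<bar>a\<bar> * (real n * K))"]) (use exp_le[of a] in auto)
  show "integrable (ope n) (\<lambda>y. exp (b * of_real (X y)))"
    by (rule integrable_const_bound[of _ "exp (\<bar>Re b\<bar> * (real n * K))"]) (use exp_le[of "Re b"] in auto)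
qed

text \<open>The product \<open>T\<close> that replaces exp (\<tau> X) has the exact expectation exp
  S. The quotient exp (\<tau> X) / T is a product of 2n numbers close to 1, so the pointwise error
  is relative, and this is why the bound contains the exponential moment at Re \<tau>.\<close>

lemma ope_laplace_approximation:
  fixes v :: "nat \<Rightarrow> real" and \<tau> :: complex and s C :: real and n :: nat and W :: "real \<Rightarrow> real"
  assumes s: "0 < s" "s < 1" and v0: "v 0 = 0"
    and summ: "summable (\<lambda>k. \<bar>v k\<bar> / s ^ (4 * k))" and C: "(\<Sum>k. \<bar>v k\<bar> / s ^ (4 * k)) \<le> C"
    and W_meas [measurable]: "W \<in> borel_measurable borel"
    and W: "\<And>t. W (2 * cos t) = (\<Sum>k. v k * (2 * cos (real k * t)))"
    and n: "0 < n"
  defines "\<epsilon> \<equiv> (exp (norm \<tau> * C))\<^sup>2 * (real n * s ^ n / (1 - s) ^ 3)"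
  assumes small: "\<epsilon> \<le> 1 / 12"
  defines "X \<equiv> \<lambda>y. \<Sum>i<n. W (y i)"
  shows "\<exists>S. norm (S - (\<tau>\<^sup>2 / 2 * of_real (\<Sum>m. real m * (v m)\<^sup>2) - \<tau> * of_real (\<Sum>m. v (2 * m)))) \<le> 2 * \<epsilon> * (norm \<tau> * C + 2) \<and>
     norm ((\<integral>y. exp (\<tau> * of_real (X y)) \<partial>ope n) - exp S) \<le> 12 * \<epsilon> * (\<integral>y. exp (Re \<tau> * X y) \<partial>ope n)"
proof -
  interpret prob_space "ope n" by (rule prob_space_ope)
  define A where "A = exp (norm \<tau> * C)"
  define \<eta> where "\<eta> = A\<^sup>2 * s ^ n / (1 - s)"
  have eta0: "0 \<le> \<eta>" unfolding \<eta>_def A_def using s by simp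
  \<comment> \<open>A single quantity controls all errors: \<eta> itself, n \<eta> for the product
    over the particles, and \<eta> / (1 - s)^2 for the exponent S.\<close>
  have eps: "real n * \<eta> / (1 - s)\<^sup>2 = \<epsilon>"
    unfolding \<eta>_def \<epsilon>_def A_def by (simp add: power_numeral_reduce)
  have s2: "0 < (1 - s)\<^sup>2" "(1 - s)\<^sup>2 \<le> 1" using s by (auto simp: power_le_one)
  have n_eta: "real n * \<eta> \<le> \<epsilon>"
    unfolding eps[symmetric] using s2 eta0 by (simp add: le_divide_eq mult_left_le)
  have eta_s: "\<eta> / (1 - s)\<^sup>2 \<le> \<epsilon>"
    unfolding eps[symmetric] using s2 eta0 n by (intro divide_right_mono) (auto simp: mult_le_cancel_right1)
  have eta_le: "\<eta> \<le> \<epsilon>"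
    using mult_right_mono[of 1 "real n" \<eta>] n eta0 n_eta by simp
  have eps0: "0 \<le> \<epsilon>" using eta0 eta_le by linarith
  have eta14: "\<eta> \<le> 1 / 4" using eta_le small by linarith
  from szego_polynomial_approximation[OF s v0 summ C, of \<tau> n, folded A_def, folded \<eta>_def, OF eta14]
  obtain x S where xS: "(\<forall>k<n. norm (x k) < 1) \<and>
     (\<Prod>k<n. \<Prod>l<n. if k < l then 1 / (1 - x k * x l) else 1) = exp S \<and>
     norm (S - (\<tau>\<^sup>2 / 2 * of_real (\<Sum>m. real m * (v m)\<^sup>2) - \<tau> * of_real (\<Sum>m. v (2 * m))))
       \<le> 2 * \<eta> * (norm \<tau> * C + 2) / (1 - s)\<^sup>2 \<and>
     (\<forall>t. \<exists>g g'. norm (g - 1) \<le> \<eta> \<and> norm (g' - 1) \<le> \<eta> \<and>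
        (\<Prod>k<n. 1 + (x k)\<^sup>2 - x k * complex_of_real (2 * cos t)) =
          exp (- \<tau> * of_real (\<Sum>k. v k * (2 * cos (real k * t)))) * (g * g'))"
    by (elim exE)
  note x1 = xS[THEN conjunct1, rule_format]
  note prodS = xS[THEN conjunct2, THEN conjunct1]
  note S_le = xS[THEN conjunct2, THEN conjunct2, THEN conjunct1]
  note ang = xS[THEN conjunct2, THEN conjunct2, THEN conjunct2, THEN spec]
  have C0: "0 \<le> C"
    using C suminf_nonneg[OF summ] s by (auto intro: order.trans)
  have S_le': "norm (S - (\<tau>\<^sup>2 / 2 * of_real (\<Sum>m. real m * (v m)\<^sup>2) - \<tau> * of_real (\<Sum>m. v (2 * m)))) \<le> 2 * \<epsilon> * (norm \<tau> * C + 2)"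
  proof -
    have "2 * \<eta> * (norm \<tau> * C + 2) / (1 - s)\<^sup>2 = (\<eta> / (1 - s)\<^sup>2) * (2 * (norm \<tau> * C + 2))" by simp
    also have "\<dots> \<le> \<epsilon> * (2 * (norm \<tau> * C + 2))"
      using eta_s C0 by (intro mult_right_mono) auto
    finally show ?thesis using S_le by (simp add: mult_ac)
  qed
  have W_le: "\<bar>W u\<bar> \<le> 2 * C" if "u \<in> {-2..2}" for u
    by (rule cosine_series_bound[OF s summ C W that])
  have E_int: "integrable (ope n) (\<lambda>y. exp (a * of_real (X y)))" for a :: complex
    unfolding X_def by (rule ope_linear_statistic_integrable[OF W_meas W_le])
  have E_int_re: "integrable (ope n) (\<lambda>y. exp (a * X y))" for a
    unfolding X_def by (rule ope_linear_statistic_integrable[OF W_meas W_le])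
  have X_meas [measurable]: "X \<in> borel_measurable (ope n)"
    unfolding X_def by measurable
  define T where "T y = 1 / (\<Prod>i<n. \<Prod>k<n. 1 + (x k)\<^sup>2 - x k * complex_of_real (y i))" for y
  have T_meas [measurable]: "T \<in> borel_measurable (ope n)"
    unfolding T_def by measurable
  have T_approx: "norm (exp (\<tau> * of_real (X y)) - T y) \<le> 12 * \<epsilon> * exp (Re \<tau> * X y)"
    if y: "\<forall>i<n. y i \<in> {-2..2}" for y
  proof -
    define good where "good i g g' \<longleftrightarrow> norm (g - 1) \<le> \<eta> \<and> norm (g' - 1) \<le> \<eta> \<and>
        (\<Prod>k<n. 1 + (x k)\<^sup>2 - x k * complex_of_real (y i)) = exp (- \<tau> * of_real (W (y i))) * (g * g')" for i g g'
    have "\<exists>g g'. good i g g'" if "i < n" for i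
    proof -
      have yi: "2 * cos (arccos (y i / 2)) = y i"
        using y that by (subst cos_arccos) auto
      show ?thesis
        using ang[of "arccos (y i / 2)"] unfolding W[symmetric] yi good_def .
    qed
    then obtain g g' where gg: "\<And>i. i < n \<Longrightarrow> good i (g i) (g' i)"
      by metis
    have g: "norm (g i - 1) \<le> \<eta>" "norm (g' i - 1) \<le> \<eta>"
      "(\<Prod>k<n. 1 + (x k)\<^sup>2 - x k * complex_of_real (y i)) = exp (- \<tau> * of_real (W (y i))) * (g i * g' i)"
      if "i < n" for i
      using gg[OF that] unfolding good_def by blast+
    define P where "P = (\<Prod>i<n. g i * g' i)"
    have "norm (g i * g' i - 1) \<le> 3 * \<eta>" if "i < n" for i
    proof -
      have "g i * g' i - 1 = (g i - 1) * (g' i - 1) + (g i - 1) + (g' i - 1)" by (simp add: algebra_simps)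
      then have "norm (g i * g' i - 1) \<le> norm ((g i - 1) * (g' i - 1)) + norm (g i - 1) + norm (g' i - 1)"
        by (simp only:) (intro order.trans[OF norm_triangle_ineq] add_mono norm_triangle_ineq order_refl)
      also have "norm ((g i - 1) * (g' i - 1)) \<le> \<eta> * 1"
        unfolding norm_mult using g(1,2)[OF that] eta0 eta_le small by (intro mult_mono) auto
      finally show ?thesis using g(1,2)[OF that] by simp
    qed
    \<comment> \<open>Each particle deviates by at most 3 \<eta>, and the product estimate doubles
      the total, giving 6 \<epsilon>. With \<epsilon> \<le> 1/12 this is at most 1/2, so |P| \<ge>
      1/2, and dividing by P leads to the constant 12.\<close>
    then have "norm (P - 1) \<le> 2 * (real n * (3 * \<eta>))"
      unfolding P_def using eta0 n_eta small by (intro norm_prod_near_1) auto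
    then have P1: "norm (P - 1) \<le> 6 * \<epsilon>" using n_eta by simp
    have P_ge: "1 / 2 \<le> norm P"
      using norm_triangle_ineq2[of 1 "1 - P"] P1 small by (simp add: norm_minus_commute)
    then have P0: "P \<noteq> 0" by auto
    have "(\<Prod>i<n. \<Prod>k<n. 1 + (x k)\<^sup>2 - x k * complex_of_real (y i)) = exp (- \<tau> * of_real (X y)) * P"
    proof -
      have "(\<Prod>i<n. \<Prod>k<n. 1 + (x k)\<^sup>2 - x k * complex_of_real (y i)) =
          (\<Prod>i<n. exp (- \<tau> * of_real (W (y i))) * (g i * g' i))"
        by (intro prod.cong refl g(3)) auto
      also have "\<dots> = exp (\<Sum>i<n. - \<tau> * of_real (W (y i))) * P"
        unfolding prod.distrib[of "\<lambda>i. exp (- \<tau> * of_real (W (y i)))"] P_def exp_sum[OF finite_lessThan] ..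
      also have "(\<Sum>i<n. - \<tau> * complex_of_real (W (y i))) = - \<tau> * of_real (X y)"
        unfolding X_def by (simp add: sum_distrib_left)
      finally show ?thesis .
    qed
    then have "T y = exp (\<tau> * of_real (X y)) / P"
      unfolding T_def by (simp add: exp_minus divide_inverse)
    then have "exp (\<tau> * of_real (X y)) - T y = exp (\<tau> * of_real (X y)) * ((P - 1) / P)"
      using P0 by (simp add: field_simps)
    also have "norm \<dots> = exp (Re \<tau> * X y) * (norm (P - 1) / norm P)"
      by (simp add: norm_mult norm_divide)
    also have "\<dots> \<le> exp (Re \<tau> * X y) * (6 * \<epsilon> / (1 / 2))"
      using P1 P_ge eps0 by (intro mult_left_mono frac_le) auto
    finally show ?thesis by (simp add: mult_ac)
  qed
  have D_int: "integrable (ope n) (\<lambda>y. exp (\<tau> * of_real (X y)) - T y)"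
  proof (rule Bochner_Integration.integrable_bound)
    show "integrable (ope n) (\<lambda>y. 12 * \<epsilon> * exp (Re \<tau> * X y))"
      by (intro integrable_mult_right E_int_re)
    show "AE y in ope n. norm (exp (\<tau> * of_real (X y)) - T y) \<le> norm (12 * \<epsilon> * exp (Re \<tau> * X y))"
      using AE_ope_support[of n] by eventually_elim (use T_approx eps0 in \<open>auto simp: abs_mult\<close>)
  qed measurable
  have T_int: "integrable (ope n) T"
    using Bochner_Integration.integrable_diff[OF E_int[of \<tau>] D_int] by simp
  have "(\<integral>y. exp (\<tau> * of_real (X y)) \<partial>ope n) - exp S = (\<integral>y. exp (\<tau> * of_real (X y)) - T y \<partial>ope n)"
  proof -
    have "integral\<^sup>L (ope n) T = exp S"
      unfolding T_def prodS[symmetric] by (rule ope_expectation_rational) (rule x1)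
    then show ?thesis
      using Bochner_Integration.integral_diff[OF E_int[of \<tau>] T_int] by simp
  qed
  also have "norm \<dots> \<le> (\<integral>y. norm (exp (\<tau> * of_real (X y)) - T y) \<partial>ope n)"
    by (rule integral_norm_bound)
  also have "\<dots> \<le> (\<integral>y. 12 * \<epsilon> * exp (Re \<tau> * X y) \<partial>ope n)"
    using AE_ope_support[of n] D_int
    by (intro integral_mono_AE integrable_norm integrable_mult_right E_int_re) (auto elim!: eventually_mono intro!: T_approx)
  also have "\<dots> = 12 * \<epsilon> * (\<integral>y. exp (Re \<tau> * X y) \<partial>ope n)"
    by simp
  finally show "\<exists>S. norm (S - (\<tau>\<^sup>2 / 2 * of_real (\<Sum>m. real m * (v m)\<^sup>2) - \<tau> * of_real (\<Sum>m. v (2 * m)))) \<le> 2 * \<epsilon> * (norm \<tau> * C + 2) \<and>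
     norm ((\<integral>y. exp (\<tau> * of_real (X y)) \<partial>ope n) - exp S) \<le> 12 * \<epsilon> * (\<integral>y. exp (Re \<tau> * X y) \<partial>ope n)"
    using S_le' by blast
qed

text \<open>Nothing here refers to resolvents. Required are coefficients summable with a uniform
  bound at radius s^-4, a margin 1 - s that is wide enough compared with 1/n (\<open>rate\<close>),
  and convergence of \<Sum> k v_k^2.\<close>

theorem ope_mesoscopic_characteristic_limit:
  fixes v :: "nat \<Rightarrow> nat \<Rightarrow> real" and s :: "nat \<Rightarrow> real" and W :: "nat \<Rightarrow> real \<Rightarrow> real" and C \<sigma>2 :: real
  assumes s: "\<forall>\<^sub>F n in sequentially. 0 < s n \<and> s n < 1"
    and v0: "\<And>n. v n 0 = 0"
    and summ: "\<forall>\<^sub>F n in sequentially. summable (\<lambda>k. \<bar>v n k\<bar> / s n ^ (4 * k)) \<and> (\<Sum>k. \<bar>v n k\<bar> / s n ^ (4 * k)) \<le> C"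
    and W_meas: "\<And>n. W n \<in> borel_measurable borel"
    and W: "\<forall>\<^sub>F n in sequentially. \<forall>t. W n (2 * cos t) = (\<Sum>k. v n k * (2 * cos (real k * t)))"
    and rate: "(\<lambda>n. real n * s n ^ n / (1 - s n) ^ 3) \<longlonglongrightarrow> 0"
    and var: "(\<lambda>n. \<Sum>m. real m * (v n m)\<^sup>2) \<longlonglongrightarrow> \<sigma>2"
  defines "X \<equiv> \<lambda>n y. \<Sum>i<n. W n (y i)"
  shows "(\<lambda>n. \<integral>y. exp (\<i> * of_real (t * (X n y - integral\<^sup>L (ope n) (X n)))) \<partial>ope n) \<longlonglongrightarrow> exp (- (of_real (t\<^sup>2 * \<sigma>2 / 2)))"
proof -
  define M where "M n = (\<Sum>m. v n (2 * m))" for n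
  define Q where "Q n = (\<Sum>m. real m * (v n m)\<^sup>2)" for n
  \<comment> \<open>- \<open>M n\<close> is the mean suggested by the linear term of the exponent;
    after this shift the predicted exponent is purely quadratic in \<tau>.\<close>
  define Y where "Y n y = X n y + M n" for n y
  define \<Phi> where "\<Phi> n \<tau> = (\<integral>y. exp (\<tau> * complex_of_real (Y n y)) \<partial>ope n)" for n \<tau>
  define \<Psi> where "\<Psi> n a = (\<integral>y. exp (a * Y n y) \<partial>ope n)" for n a
  have \<Psi>0: "0 \<le> \<Psi> n a" for n a
    unfolding \<Psi>_def by (intro integral_nonneg_AE) auto
  define \<epsilon> where "\<epsilon> \<tau> n = (exp (norm \<tau> * C))\<^sup>2 * (real n * s n ^ n / (1 - s n) ^ 3)" for \<tau> :: complex and n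
  have \<epsilon>_lim: "\<epsilon> \<tau> \<longlonglongrightarrow> 0" for \<tau>
    unfolding \<epsilon>_def using tendsto_mult_left[OF rate, of "(exp (norm \<tau> * C))\<^sup>2"] by simp
  \<comment> \<open>No bound on the real exponential moments is known yet, so the error is stated
    with \<Psi> in it. A bound on \<Psi> then upgrades this to convergence in
    \<open>conv\<close>.\<close>
  have key: "\<exists>U. U \<longlonglongrightarrow> exp (\<tau>\<^sup>2 / 2 * of_real \<sigma>2) \<and>
      (\<forall>\<^sub>F n in sequentially. norm (\<Phi> n \<tau> - U n) \<le> 12 * \<epsilon> \<tau> n * \<Psi> n (Re \<tau>))" for \<tau>
  proof -
    define good where "good n S \<longleftrightarrow> norm (S - (\<tau>\<^sup>2 / 2 * of_real (Q n) - \<tau> * of_real (M n))) \<le> 2 * \<epsilon> \<tau> n * (norm \<tau> * C + 2) \<and>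
       norm (\<Phi> n \<tau> - exp (S + \<tau> * of_real (M n))) \<le> 12 * \<epsilon> \<tau> n * \<Psi> n (Re \<tau>)" for n S
    have "\<forall>\<^sub>F n in sequentially. \<epsilon> \<tau> n < 1 / 12"
      using \<epsilon>_lim by (rule order_tendstoD) simp
    with s summ W eventually_gt_at_top[of 0] have "\<forall>\<^sub>F n in sequentially. \<exists>S. good n S"
    proof eventually_elim
      case (elim n)
      obtain S where S: "norm (S - (\<tau>\<^sup>2 / 2 * of_real (Q n) - \<tau> * of_real (M n))) \<le> 2 * \<epsilon> \<tau> n * (norm \<tau> * C + 2)"
        "norm ((\<integral>y. exp (\<tau> * of_real (X n y)) \<partial>ope n) - exp S) \<le> 12 * \<epsilon> \<tau> n * (\<integral>y. exp (Re \<tau> * X n y) \<partial>ope n)"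
        using ope_laplace_approximation(1)[of "s n" "v n" C "W n" n \<tau>] elim v0 W_meas
        unfolding \<epsilon>_def Q_def M_def X_def by auto
      have a: "\<Phi> n \<tau> = exp (\<tau> * of_real (M n)) * (\<integral>y. exp (\<tau> * of_real (X n y)) \<partial>ope n)"
        unfolding \<Phi>_def Y_def by (simp add: distrib_left exp_add mult.commute flip: integral_mult_right_zero)
      have b: "\<Psi> n (Re \<tau>) = exp (Re \<tau> * M n) * (\<integral>y. exp (Re \<tau> * X n y) \<partial>ope n)"
        unfolding \<Psi>_def Y_def by (simp add: distrib_left exp_add mult.commute flip: integral_mult_right_zero)
      have "\<Phi> n \<tau> - exp (S + \<tau> * of_real (M n)) = exp (\<tau> * of_real (M n)) * ((\<integral>y. exp (\<tau> * of_real (X n y)) \<partial>ope n) - exp S)"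
        unfolding a by (simp add: exp_add algebra_simps)
      then have "norm (\<Phi> n \<tau> - exp (S + \<tau> * of_real (M n))) =
          exp (Re \<tau> * M n) * norm ((\<integral>y. exp (\<tau> * of_real (X n y)) \<partial>ope n) - exp S)"
        by (simp add: norm_mult)
      also have "\<dots> \<le> exp (Re \<tau> * M n) * (12 * \<epsilon> \<tau> n * (\<integral>y. exp (Re \<tau> * X n y) \<partial>ope n))"
        by (intro mult_left_mono S(2)) auto
      finally show ?case
        using S(1) unfolding good_def b by (auto simp: mult_ac intro!: exI[of _ S])
    qed
    then have ev: "\<forall>\<^sub>F n in sequentially. good n (SOME S. good n S)"
      by eventually_elim (rule someI_ex)
    define S where "S n = (SOME S. good n S)" for n
    have "(\<lambda>n. S n - (\<tau>\<^sup>2 / 2 * of_real (Q n) - \<tau> * of_real (M n))) \<longlonglongrightarrow> 0"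
    proof (rule Lim_null_comparison)
      show "\<forall>\<^sub>F n in sequentially. norm (S n - (\<tau>\<^sup>2 / 2 * of_real (Q n) - \<tau> * of_real (M n))) \<le> 2 * \<epsilon> \<tau> n * (norm \<tau> * C + 2)"
        using ev by eventually_elim (auto simp: good_def S_def)
      have "(\<lambda>n. 2 * \<epsilon> \<tau> n * (norm \<tau> * C + 2)) \<longlonglongrightarrow> 2 * 0 * (norm \<tau> * C + 2)"
        by (intro tendsto_intros \<epsilon>_lim)
      then show "(\<lambda>n. 2 * \<epsilon> \<tau> n * (norm \<tau> * C + 2)) \<longlonglongrightarrow> 0" by simp
    qed
    moreover have "(\<lambda>n. \<tau>\<^sup>2 / 2 * of_real (Q n)) \<longlonglongrightarrow> \<tau>\<^sup>2 / 2 * of_real \<sigma>2"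
      unfolding Q_def by (intro tendsto_mult tendsto_const tendsto_of_real var)
    ultimately have "(\<lambda>n. (S n - (\<tau>\<^sup>2 / 2 * of_real (Q n) - \<tau> * of_real (M n))) + \<tau>\<^sup>2 / 2 * of_real (Q n)) \<longlonglongrightarrow> 0 + \<tau>\<^sup>2 / 2 * of_real \<sigma>2"
      by (rule tendsto_add)
    then have "(\<lambda>n. exp (S n + \<tau> * of_real (M n))) \<longlonglongrightarrow> exp (\<tau>\<^sup>2 / 2 * of_real \<sigma>2)"
      by (intro tendsto_exp) (simp add: algebra_simps)
    moreover have "\<forall>\<^sub>F n in sequentially. norm (\<Phi> n \<tau> - exp (S n + \<tau> * of_real (M n))) \<le> 12 * \<epsilon> \<tau> n * \<Psi> n (Re \<tau>)"
      using ev by eventually_elim (auto simp: good_def S_def)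
    ultimately show ?thesis by blast
  qed
  have conv: "(\<lambda>n. \<Phi> n \<tau>) \<longlonglongrightarrow> exp (\<tau>\<^sup>2 / 2 * of_real \<sigma>2)"
    if B: "\<forall>\<^sub>F n in sequentially. \<Psi> n (Re \<tau>) \<le> B" for \<tau> B
  proof -
    obtain U where U: "U \<longlonglongrightarrow> exp (\<tau>\<^sup>2 / 2 * of_real \<sigma>2)"
      "\<forall>\<^sub>F n in sequentially. norm (\<Phi> n \<tau> - U n) \<le> 12 * \<epsilon> \<tau> n * \<Psi> n (Re \<tau>)" using key[of \<tau>] by blast
    have "(\<lambda>n. \<Phi> n \<tau> - U n) \<longlonglongrightarrow> 0"
    proof (rule Lim_null_comparison)
      show "\<forall>\<^sub>F n in sequentially. norm (\<Phi> n \<tau> - U n) \<le> 12 * \<epsilon> \<tau> n * B"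
        using U(2) B s
      proof eventually_elim
        case (elim n)
        have "0 \<le> \<epsilon> \<tau> n" unfolding \<epsilon>_def using elim by simp
        then have "12 * \<epsilon> \<tau> n * \<Psi> n (Re \<tau>) \<le> 12 * \<epsilon> \<tau> n * B"
          using elim by (intro mult_left_mono) auto
        then show ?case using elim by linarith
      qed
      have "(\<lambda>n. 12 * \<epsilon> \<tau> n * B) \<longlonglongrightarrow> 12 * 0 * B"
        by (intro tendsto_intros \<epsilon>_lim)
      then show "(\<lambda>n. 12 * \<epsilon> \<tau> n * B) \<longlonglongrightarrow> 0" by simp
    qed
    from tendsto_add[OF this U(1)] show ?thesis by simp
  qed
  have \<Phi>_real: "\<Phi> n (of_real a) = of_real (\<Psi> n a)" for n a
    unfolding \<Phi>_def \<Psi>_def by (simp flip: integral_complex_of_real of_real_mult exp_of_real)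
  have \<Psi>_lim: "(\<lambda>n. \<Psi> n a) \<longlonglongrightarrow> exp (a\<^sup>2 / 2 * \<sigma>2)" for a
  proof -
    obtain U where U: "U \<longlonglongrightarrow> exp ((of_real a)\<^sup>2 / 2 * of_real \<sigma>2)"
      "\<forall>\<^sub>F n in sequentially. norm (\<Phi> n (of_real a) - U n) \<le> 12 * \<epsilon> (of_real a) n * \<Psi> n a" using key[of "of_real a"] by auto
    define K where "K = norm (exp ((complex_of_real a)\<^sup>2 / 2 * of_real \<sigma>2)) + 1"
    have "\<forall>\<^sub>F n in sequentially. norm (U n) < K"
      using tendsto_norm[OF U(1)] by (rule order_tendstoD(2)) (simp add: K_def)
    then have K: "\<forall>\<^sub>F n in sequentially. norm (U n) \<le> K"
      by (rule eventually_mono) simp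
    \<comment> \<open>12/24 = 1/2: for real exponents \<Phi> and \<Psi> agree, so \<Psi> \<le> |U| +
      \<Psi>/2 and half of \<Psi> can be absorbed.\<close>
    have "\<forall>\<^sub>F n in sequentially. \<epsilon> (of_real a) n < 1 / 24"
      using \<epsilon>_lim by (rule order_tendstoD) simp
    with U(2) K have "\<forall>\<^sub>F n in sequentially. \<Psi> n a \<le> 2 * K"
    proof eventually_elim
      case (elim n)
      have "12 * \<epsilon> (of_real a) n * \<Psi> n a \<le> 1 / 2 * \<Psi> n a"
        using elim \<Psi>0 by (intro mult_right_mono) auto
      moreover have "norm (\<Phi> n (of_real a)) = \<Psi> n a" unfolding \<Phi>_real using \<Psi>0 by simp
      ultimately show ?case
        using elim norm_triangle_ineq2[of "\<Phi> n (of_real a)" "U n"] by linarith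
    qed
    then have "(\<lambda>n. \<Phi> n (of_real a)) \<longlonglongrightarrow> exp ((of_real a)\<^sup>2 / 2 * of_real \<sigma>2)"
      by (intro conv[where B="2 * K"]) simp
    moreover have "exp ((of_real a)\<^sup>2 / 2 * of_real \<sigma>2) = complex_of_real (exp (a\<^sup>2 / 2 * \<sigma>2))"
      by (simp flip: exp_of_real)
    ultimately have "(\<lambda>n. complex_of_real (\<Psi> n a)) \<longlonglongrightarrow> complex_of_real (exp (a\<^sup>2 / 2 * \<sigma>2))"
      by (simp only: \<Phi>_real)
    then show ?thesis by (simp only: tendsto_of_real_iff)
  qed
  define \<mu> where "\<mu> n = integral\<^sup>L (ope n) (Y n)" for n
  have int: "\<forall>\<^sub>F n in sequentially. integrable (ope n) (X n) \<and> (\<forall>a. integrable (ope n) (\<lambda>y. exp (a * Y n y)))"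
    using s summ W
  proof eventually_elim
    case (elim n)
    have W_le: "\<bar>W n u\<bar> \<le> 2 * C" if "u \<in> {-2..2}" for u
      by (rule cosine_series_bound[of "s n" "v n"]) (use elim that in auto)
    have "integrable (ope n) (\<lambda>y. exp (a * M n) * exp (a * X n y))" for a
      unfolding X_def by (intro integrable_mult_right ope_linear_statistic_integrable(2)[OF W_meas W_le])
    then show ?case
      unfolding Y_def distrib_left exp_add using ope_linear_statistic_integrable(1)[OF W_meas W_le]
      by (auto simp: X_def mult.commute)
  qed
  \<comment> \<open>The convergence of real exponential moments and \<open>1 + a \<mu> \<le> E exp (a Y)\<close> for both signs of \<open>a\<close> pin down the mean.\<close>
  have mean: "\<mu> \<longlonglongrightarrow> 0"
  proof (rule LIMSEQ_I)
    fix e :: real assume e: "0 < e"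
    \<comment> \<open>The mean enters at first order in a, whereas the limiting moment exceeds 1
      only at second order. So a can be fixed, before n, with the quotient below e.\<close>
    have "((\<lambda>a. (exp (a\<^sup>2 / 2 * \<sigma>2) - 1) / a) \<longlongrightarrow> 0) (at_right 0)"
      by real_asymp
    then have "\<forall>\<^sub>F a in at_right 0. (exp (a\<^sup>2 / 2 * \<sigma>2) - 1) / a < e"
      using e by (rule order_tendstoD)
    then have "\<forall>\<^sub>F a in at_right (0::real). (exp (a\<^sup>2 / 2 * \<sigma>2) - 1) / a < e \<and> 0 < a"
      using eventually_at_right_less by (rule eventually_conj)
    then obtain a where a: "0 < a" "(exp (a\<^sup>2 / 2 * \<sigma>2) - 1) / a < e"
      using eventually_happens'[of "at_right (0::real)"] by (metis (mono_tags, lifting) trivial_limit_at_right_real)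
    have lim: "(\<lambda>n. (\<Psi> n b - 1) / a) \<longlonglongrightarrow> (exp (a\<^sup>2 / 2 * \<sigma>2) - 1) / a" if "b\<^sup>2 = a\<^sup>2" for b
      using \<Psi>_lim[of b] that a(1) by (intro tendsto_intros) auto
    have "\<forall>\<^sub>F n in sequentially. (\<Psi> n a - 1) / a < e" "\<forall>\<^sub>F n in sequentially. (\<Psi> n (- a) - 1) / a < e"
      by (rule order_tendstoD(2)[OF lim a(2)]; simp)+
    with int have "\<forall>\<^sub>F n in sequentially. \<bar>\<mu> n\<bar> < e"
    proof eventually_elim
      case (elim n)
      interpret prob_space "ope n" by (rule prob_space_ope)
      have Yint: "integrable (ope n) (Y n)"
        unfolding Y_def using elim by auto
      have lower: "1 + b * \<mu> n \<le> \<Psi> n b" for b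
      proof -
        have "1 + b * \<mu> n = (\<integral>y. 1 + b * Y n y \<partial>ope n)"
          unfolding \<mu>_def using Yint by (simp add: prob_space)
        also have "\<dots> \<le> \<Psi> n b"
          unfolding \<Psi>_def using elim Yint by (intro integral_mono) auto
        finally show ?thesis .
      qed
      have "\<mu> n \<le> (\<Psi> n a - 1) / a" "- \<mu> n \<le> (\<Psi> n (- a) - 1) / a"
        using lower[of a] lower[of "- a"] a(1) by (auto simp: le_divide_eq mult.commute)
      then show ?case using elim by linarith
    qed
    then show "\<exists>N. \<forall>n\<ge>N. norm (\<mu> n - 0) < e"
      by (simp add: eventually_sequentially)
  qed
  have "(\<lambda>n. \<Phi> n (\<i> * of_real t)) \<longlonglongrightarrow> exp ((\<i> * of_real t)\<^sup>2 / 2 * of_real \<sigma>2)"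
  \<comment> \<open>At a purely imaginary exponent \<Psi> is the total mass 1.\<close>
  proof (rule conv[where B=1])
    have "\<Psi> n 0 = 1" for n
      unfolding \<Psi>_def using prob_space.prob_space[OF prob_space_ope[of n]] by simp
    then show "\<forall>\<^sub>F n in sequentially. \<Psi> n (Re (\<i> * of_real t)) \<le> 1" by simp
  qed
  moreover have "(\<lambda>n. exp (- \<i> * of_real (t * \<mu> n))) \<longlonglongrightarrow> exp (- \<i> * of_real (t * 0))"
    by (intro tendsto_intros mean)
  ultimately have lim: "(\<lambda>n. exp (- \<i> * of_real (t * \<mu> n)) * \<Phi> n (\<i> * of_real t)) \<longlonglongrightarrow> 
      exp (- \<i> * of_real (t * 0)) * exp ((\<i> * of_real t)\<^sup>2 / 2 * of_real \<sigma>2)"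
    by (intro tendsto_mult)
  have rhs: "exp (- \<i> * of_real (t * 0)) * exp ((\<i> * of_real t)\<^sup>2 / 2 * of_real \<sigma>2) = exp (- (of_real (t\<^sup>2 * \<sigma>2 / 2)))"
    by (simp add: power_mult_distrib)
  have "\<forall>\<^sub>F n in sequentially. exp (- \<i> * of_real (t * \<mu> n)) * \<Phi> n (\<i> * of_real t) =
     (\<integral>y. exp (\<i> * of_real (t * (X n y - integral\<^sup>L (ope n) (X n)))) \<partial>ope n)"
    using int
  proof eventually_elim
    case (elim n)
    interpret prob_space "ope n" by (rule prob_space_ope)
    have mu: "\<mu> n = integral\<^sup>L (ope n) (X n) + M n"
      unfolding \<mu>_def Y_def using elim by (simp add: prob_space)
    have "exp (- \<i> * of_real (t * \<mu> n)) * exp (\<i> * of_real t * of_real (Y n y)) =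
        exp (\<i> * of_real (t * (X n y - integral\<^sup>L (ope n) (X n))))" for y
      unfolding exp_add[symmetric] mu Y_def by (simp add: algebra_simps)
    then show ?case
      unfolding \<Phi>_def by (simp flip: integral_mult_right_zero)
  qed
  from Lim_transform_eventually[OF lim this] show ?thesis unfolding rhs .
qed

section \<open>The limiting variance\<close>

lemma integrable_inverse_quadratic:
  assumes "Im a \<noteq> 0"
  shows "integrable lborel (\<lambda>x. 1 / (norm (complex_of_real x - a))\<^sup>2)"
proof -
  have "integrable lborel (\<lambda>x::real. inverse (1 + x\<^sup>2))"
    using integrable_inverse_1_plus_square by (simp add: set_integrable_def)
  from lborel_integrable_real_affine[OF this, of "1 / Im a" "- Re a / Im a"] assms
  have "integrable lborel (\<lambda>x. 1 / (Im a)\<^sup>2 * inverse (1 + (- Re a / Im a + 1 / Im a * x)\<^sup>2))"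
    by (intro integrable_mult_right) auto
  moreover have "1 / (Im a)\<^sup>2 * inverse (1 + (- Re a / Im a + 1 / Im a * x)\<^sup>2) = 1 / (norm (complex_of_real x - a))\<^sup>2" for x
  proof -
    have "(Im a)\<^sup>2 * (1 + (- Re a / Im a + 1 / Im a * x)\<^sup>2) = (norm (complex_of_real x - a))\<^sup>2"
    proof -
      have n2: "(norm (complex_of_real x - a))\<^sup>2 = (x - Re a)\<^sup>2 + (Im a)\<^sup>2" by (simp add: cmod_power2)
      show ?thesis unfolding n2 using assms by (simp add: power2_eq_square field_simps)
    qed
    then show ?thesis by (metis inverse_eq_divide inverse_mult_distrib)
  qed
  ultimately show ?thesis by simp
qed

lemma integrable_cauchy_product:
  assumes "Im a \<noteq> 0" "Im b \<noteq> 0"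
  shows "integrable lborel (\<lambda>x. 1 / ((complex_of_real x - a) * (complex_of_real x - b)))"
proof (rule Bochner_Integration.integrable_bound)
  show "integrable lborel (\<lambda>x. 1 / (norm (complex_of_real x - a))\<^sup>2 + 1 / (norm (complex_of_real x - b))\<^sup>2)"
    by (intro Bochner_Integration.integrable_add integrable_inverse_quadratic assms)
  have "norm (1 / ((complex_of_real x - a) * (complex_of_real x - b))) \<le>
      1 / (norm (complex_of_real x - a))\<^sup>2 + 1 / (norm (complex_of_real x - b))\<^sup>2" for x
  proof -
    define p where "p = 1 / norm (complex_of_real x - a)"
    define q where "q = 1 / norm (complex_of_real x - b)"
    have "0 \<le> p" "0 \<le> q" by (auto simp: p_def q_def)
    have "2 * (p * q) \<le> p\<^sup>2 + q\<^sup>2" using sum_squares_bound[of p q] by simp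
    moreover have "0 \<le> p * q" using \<open>0 \<le> p\<close> \<open>0 \<le> q\<close> by simp
    ultimately have "p * q \<le> p\<^sup>2 + q\<^sup>2" by linarith
    then show ?thesis by (simp add: p_def q_def norm_divide norm_mult power_divide)
  qed
  then show "AE x in lborel. norm (1 / ((complex_of_real x - a) * (complex_of_real x - b))) \<le>
      norm (1 / (norm (complex_of_real x - a))\<^sup>2 + 1 / (norm (complex_of_real x - b))\<^sup>2)"
    unfolding real_norm_def by (intro AE_I2 order.trans[OF _ abs_ge_self])
qed measurable

section \<open>Integrals over the real line through primitives\<close>

lemma integral_line_FTC:
  fixes f F :: "real \<Rightarrow> complex"
  assumes deriv: "\<And>x. (F has_vector_derivative f x) (at x)" and cont: "\<And>x. isCont f x"
    and int: "integrable lborel f" and A: "(F \<longlongrightarrow> A) at_bot" and B: "(F \<longlongrightarrow> B) at_top"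
  shows "(\<integral>x. f x \<partial>lborel) = B - A"
proof -
  have "(LBINT x=-\<infinity>..\<infinity>. f x) = B - A"
    by (rule interval_integral_FTC_integrable[where F=F])
       (use assms in \<open>auto simp: set_integrable_def ereal_tendsto_simps\<close>)
  then show ?thesis
    by (simp add: interval_lebesgue_integral_def set_lebesgue_integral_def)
qed

text \<open>For x > 0 the principal branch splits exactly as Ln (x - c) = ln x + Ln (1 - c/x), and
  ln x cancels in the difference.\<close>

lemma tendsto_Ln_diff_at_top:
  assumes "Im a \<noteq> 0" "Im b \<noteq> 0"
  shows "((\<lambda>x. Ln (of_real x - a) - Ln (of_real x - b)) \<longlongrightarrow> 0) at_top"
proof -
  have lim: "((\<lambda>x. Ln (1 - c / of_real x)) \<longlongrightarrow> 0) at_top" for c :: complex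
  proof -
    have "((\<lambda>x. 1 - c * complex_of_real (inverse x)) \<longlongrightarrow> 1 - c * of_real 0) at_top"
      by (intro tendsto_intros tendsto_inverse_0_at_top filterlim_ident)
    then have "((\<lambda>x. Ln (1 - c * complex_of_real (inverse x))) \<longlongrightarrow> Ln 1) at_top"
      by (intro tendsto_Ln) auto
    then show ?thesis by (simp add: divide_inverse)
  qed
  have "((\<lambda>x. Ln (1 - a / of_real x) - Ln (1 - b / of_real x)) \<longlongrightarrow> 0 - 0) at_top"
    by (intro tendsto_diff lim)
  moreover have "\<forall>\<^sub>F x in at_top. Ln (1 - a / of_real x) - Ln (1 - b / of_real x) = Ln (of_real x - a) - Ln (of_real x - b)"
    using eventually_gt_at_top[of 0]
  proof eventually_elim
    case (elim x)
    have "Ln (of_real x - c) = of_real (ln x) + Ln (1 - c / of_real x)" if "Im c \<noteq> 0" for c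
    proof -
      have "1 - c / of_real x \<noteq> 0"
        using that elim by (auto simp: complex_eq_iff)
      moreover have "of_real x - c = of_real x * (1 - c / of_real x)" using elim by (simp add: field_simps)
      ultimately show ?thesis using Ln_times_of_real[OF elim] elim by (simp add: Ln_of_real)
    qed
    then show ?case using assms by simp
  qed
  ultimately show ?thesis by (simp add: Lim_transform_eventually)
qed

text \<open>Towards minus infinity x - c approaches the branch cut, from below if Im c > 0 and from
  above if Im c < 0. The arguments tend to -pi and pi respectively, so a difference of - 2 pi i
  remains exactly when the imaginary parts have opposite signs.\<close>

lemma tendsto_Ln_diff_at_bot:
  assumes "Im a > 0" "Im b \<noteq> 0"
  shows "((\<lambda>x. Ln (of_real x - a) - Ln (of_real x - b)) \<longlongrightarrow> (if Im b > 0 then 0 else - 2 * pi * \<i>)) at_bot"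
proof -
  have ev: "\<forall>\<^sub>F x in at_top. Ln (of_real x - (- a)) - Ln (of_real x - (- b)) + (if Im b > 0 then 0 else - 2 * pi * \<i>)
      = Ln (of_real (- x) - a) - Ln (of_real (- x) - b)"
  proof (rule always_eventually, rule allI)
    fix x :: real
    have 1: "Ln (of_real (- x) - c) = Ln (of_real x - (- c)) + (if Im c > 0 then - \<i> * pi else \<i> * pi)" if "Im c \<noteq> 0" for c
    proof -
      have nz: "of_real x + c \<noteq> 0" using that by (auto simp: complex_eq_iff)
      have "of_real (- x) - c = - (of_real x + c)" by simp
      then show ?thesis using Ln_minus[OF nz] that by (auto split: if_splits)
    qed
    show "Ln (of_real x - (- a)) - Ln (of_real x - (- b)) + (if Im b > 0 then 0 else - 2 * pi * \<i>)
      = Ln (of_real (- x) - a) - Ln (of_real (- x) - b)"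
      using 1[of a] 1[of b] assms by auto
  qed
  have "((\<lambda>x. Ln (of_real x - (- a)) - Ln (of_real x - (- b)) + (if Im b > 0 then 0 else - 2 * pi * \<i>)) \<longlongrightarrow>
      0 + (if Im b > 0 then 0 else - 2 * pi * \<i>)) at_top"
    using assms by (intro tendsto_add tendsto_const tendsto_Ln_diff_at_top) auto
  from Lim_transform_eventually[OF this ev] show ?thesis
    by (subst filterlim_at_bot_mirror) simp
qed

text \<open>(Ln (x - a) - Ln (x - b)) / (a - b) is a primitive on the whole line, because x - a and
  x - b never become real; the value is the jump of the logarithms at minus infinity. A double pole
  has the primitive -1/(x - a) instead.\<close>

lemma integral_cauchy_product:
  assumes a: "Im a > 0" and b: "Im b \<noteq> 0"
  shows "(\<integral>x. 1 / ((complex_of_real x - a) * (complex_of_real x - b)) \<partial>lborel) =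
         (if Im b > 0 then 0 else 2 * pi * \<i> / (a - b))"
proof -
  have nz: "complex_of_real x - c \<noteq> 0" if "Im c \<noteq> 0" for x c
    using that by (auto simp: complex_eq_iff)
  have cont: "isCont (\<lambda>x. 1 / ((complex_of_real x - a) * (complex_of_real x - b))) x" for x
    by (intro continuous_intros) (use a b nz in auto)
  show ?thesis
  proof (cases "a = b")
    case True
    have lim: "((\<lambda>x. - 1 / (complex_of_real x - a)) \<longlongrightarrow> 0) F" if "filterlim complex_of_real at_infinity F" for F
    proof -
      have "filterlim (\<lambda>x. complex_of_real x - a) at_infinity F"
        using tendsto_add_filterlim_at_infinity'[OF that tendsto_const[of "- a"]] by simp
      then show ?thesis by (intro tendsto_divide_0[OF tendsto_const])
    qed
    have "(\<integral>x. 1 / ((complex_of_real x - a) * (complex_of_real x - b)) \<partial>lborel) = 0 - 0"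
    proof (rule integral_line_FTC[where F="\<lambda>x. - 1 / (complex_of_real x - a)", OF _ cont])
      fix x
      have "((\<lambda>z. - 1 / (z - a)) has_field_derivative 1 / ((complex_of_real x - a) * (complex_of_real x - b))) (at (complex_of_real x))"
        using nz[of a x] a True by (auto intro!: derivative_eq_intros simp: power2_eq_square)
      then show "((\<lambda>x. - 1 / (complex_of_real x - a)) has_vector_derivative 1 / ((complex_of_real x - a) * (complex_of_real x - b))) (at x)"
        by (rule has_vector_derivative_real_field)
    next
      show "((\<lambda>x. - 1 / (complex_of_real x - a)) \<longlongrightarrow> 0) at_bot" "((\<lambda>x. - 1 / (complex_of_real x - a)) \<longlongrightarrow> 0) at_top"
        by (intro lim filterlim_norm_at_top_imp_at_infinity; simp; real_asymp)+
    qed (use integrable_cauchy_product a b in auto)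
    with True a show ?thesis by simp
  next
    case False
    have "(\<integral>x. 1 / ((complex_of_real x - a) * (complex_of_real x - b)) \<partial>lborel) =
        0 / (a - b) - (if Im b > 0 then 0 else - 2 * pi * \<i>) / (a - b)"
    proof (rule integral_line_FTC[where F="\<lambda>x. (Ln (of_real x - a) - Ln (of_real x - b)) / (a - b)", OF _ cont])
      fix x
      have "complex_of_real x - c \<notin> \<real>\<^sub>\<le>\<^sub>0" if "Im c \<noteq> 0" for c
        using that by (auto simp: complex_nonpos_Reals_iff)
      then have "((\<lambda>z. (Ln (z - a) - Ln (z - b)) / (a - b)) has_field_derivative
         (inverse (complex_of_real x - a) * 1 - inverse (complex_of_real x - b) * 1) / (a - b)) (at (complex_of_real x))"
        using a b False
        by (intro DERIV_cdivide DERIV_diff DERIV_chain2[OF has_field_derivative_Ln]) (auto intro!: derivative_eq_intros)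
      moreover have "(inverse (complex_of_real x - a) * 1 - inverse (complex_of_real x - b) * 1) / (a - b) =
          1 / ((complex_of_real x - a) * (complex_of_real x - b))"
      proof -
        have "(inverse u * 1 - inverse w * 1) / (w - u) = 1 / (u * w)" if "u \<noteq> 0" "w \<noteq> 0" "w \<noteq> u" for u w :: complex
          using that by (simp add: inverse_eq_divide diff_frac_eq)
        from this[of "complex_of_real x - a" "complex_of_real x - b"] show ?thesis
          using nz[of a x] nz[of b x] a b False by simp
      qed
      ultimately have "((\<lambda>z. (Ln (z - a) - Ln (z - b)) / (a - b)) has_field_derivative
         1 / ((complex_of_real x - a) * (complex_of_real x - b))) (at (complex_of_real x))"
        by (simp only:)
      then show "((\<lambda>x. (Ln (of_real x - a) - Ln (of_real x - b)) / (a - b)) has_vector_derivative 1 / ((complex_of_real x - a) * (complex_of_real x - b))) (at x)"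
        by (rule has_vector_derivative_real_field)
    next
      show "integrable lborel (\<lambda>x. 1 / ((complex_of_real x - a) * (complex_of_real x - b)))"
        using a b by (intro integrable_cauchy_product) auto
      show "((\<lambda>x. (Ln (of_real x - a) - Ln (of_real x - b)) / (a - b)) \<longlongrightarrow> (if Im b > 0 then 0 else - 2 * pi * \<i>) / (a - b)) at_bot"
        using False by (intro tendsto_divide tendsto_const tendsto_Ln_diff_at_bot a b) simp
      show "((\<lambda>x. (Ln (of_real x - a) - Ln (of_real x - b)) / (a - b)) \<longlongrightarrow> 0 / (a - b)) at_top"
        using False a by (intro tendsto_divide tendsto_const tendsto_Ln_diff_at_top b) auto
    qed
    then show ?thesis by (cases "Im b > 0") simp_all
  qed
qed

lemma integrable_times_pair:
  fixes f g :: "real \<Rightarrow> complex"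
  assumes f: "integrable lborel f" and g: "integrable lborel g"
  shows "integrable (lborel \<Otimes>\<^sub>M lborel) (\<lambda>(x, y). f x * g y)"
    and "(\<integral>(x, y). f x * g y \<partial>(lborel \<Otimes>\<^sub>M lborel)) = integral\<^sup>L lborel f * integral\<^sup>L lborel g"
proof -
  have [measurable]: "f \<in> borel_measurable lborel" "g \<in> borel_measurable lborel"
    using f g by auto
  show I: "integrable (lborel \<Otimes>\<^sub>M lborel) (\<lambda>(x, y). f x * g y)"
    by (rule lborel_pair.Fubini_integrable) (use f g in \<open>auto simp: norm_mult\<close>)
  show "(\<integral>(x, y). f x * g y \<partial>(lborel \<Otimes>\<^sub>M lborel)) = integral\<^sup>L lborel f * integral\<^sup>L lborel g"
    using lborel_pair.integral_fst'[OF I] by simp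
qed

text \<open>The difference quotient of 1/(x - \<eta>) is -1/((x - \<eta>)(y - \<eta>)), so the
  integrand is a sum of products of a function of x and a function of y. By Fubini only
  one-dimensional integrals remain: those with both poles in the upper half-plane vanish, those with
  \<eta>_i and cnj \<eta>_j give 2 pi i / (\<eta>_i - cnj \<eta>_j).\<close>

lemma sigma2_rational:
  fixes \<eta> :: "nat \<Rightarrow> complex" and c :: "nat \<Rightarrow> real"
  assumes eta: "\<And>j. j < N \<Longrightarrow> Im (\<eta> j) > 0"
    and f: "\<And>x. f x = (\<Sum>j<N. c j * Im (1 / (complex_of_real x - \<eta> j)))"
  shows "sigma2 f = (\<Sum>i<N. \<Sum>j<N. c i * c j * (Re (- 1 / (\<eta> i - cnj (\<eta> j))\<^sup>2) / 2))"
proof -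
  define p where "p i j x = 1 / ((complex_of_real x - \<eta> i) * (complex_of_real x - cnj (\<eta> j)))" for i j x
  define r where "r i j x = 1 / ((complex_of_real x - \<eta> i) * (complex_of_real x - \<eta> j))" for i j x
  have nz: "complex_of_real x - \<eta> j \<noteq> 0" if "j < N" for x j
    using eta[OF that] by (auto simp: complex_eq_iff)
  let ?P = "lborel \<Otimes>\<^sub>M lborel :: (real \<times> real) measure"
  define H where "H z = (case z of (x, y) \<Rightarrow> \<Sum>i<N. \<Sum>j<N. c i * c j * (Re (p i j x * p i j y - r i j x * r i j y) / 2))" for z
  have quotient: "((f x - f y) / (x - y))\<^sup>2 = H (x, y)" if "x \<noteq> y" for x y
  proof -
    have "(f x - f y) / (x - y) = (\<Sum>j<N. c j * Im (- (1 / ((complex_of_real x - \<eta> j) * (complex_of_real y - \<eta> j)))))"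
      unfolding f sum_subtractf[symmetric] sum_divide_distrib
    proof (intro sum.cong refl)
      fix j assume "j \<in> {..<N}"
      then have j: "j < N" by simp
      note nzj = nz[OF j, of x] nz[OF j, of y]
      have "1 / (complex_of_real x - \<eta> j) - 1 / (complex_of_real y - \<eta> j) =
         of_real (x - y) * (- (1 / ((complex_of_real x - \<eta> j) * (complex_of_real y - \<eta> j))))"
        using nzj by (simp add: divide_simps)
      from arg_cong[OF this, of Im]
      have "Im (1 / (complex_of_real x - \<eta> j)) - Im (1 / (complex_of_real y - \<eta> j)) =
         (x - y) * Im (- (1 / ((complex_of_real x - \<eta> j) * (complex_of_real y - \<eta> j))))"
        by (simp only: Im_complex_of_real minus_complex.sel times_complex.sel Re_complex_of_real)
      then show "(c j * Im (1 / (complex_of_real x - \<eta> j)) - c j * Im (1 / (complex_of_real y - \<eta> j))) / (x - y) =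
          c j * Im (- (1 / ((complex_of_real x - \<eta> j) * (complex_of_real y - \<eta> j))))"
        using that by (simp only: right_diff_distrib[symmetric]) simp
    qed
    then have "((f x - f y) / (x - y))\<^sup>2 = (\<Sum>i<N. \<Sum>j<N. c i * c j * (Im (- (1 / ((complex_of_real x - \<eta> i) * (complex_of_real y - \<eta> i))))
         * Im (- (1 / ((complex_of_real x - \<eta> j) * (complex_of_real y - \<eta> j))))))"
      by (simp only: power2_eq_square sum_product) (simp add: mult_ac)
    also have "\<dots> = H (x, y)"
    proof -
      have im: "Im u * Im w = Re (u * cnj w - u * w) / 2" for u w by simp
      show ?thesis
        unfolding H_def im p_def r_def prod.case by (intro sum.cong refl) (simp add: mult_ac)
    qed
    finally show ?thesis .
  qed
  \<comment> \<open>On the diagonal the quotient is 0 by the convention for division, whereas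
    \<open>H\<close> has its continuous value there; the diagonal is a null set.\<close>
  have AE: "AE z in ?P. (case z of (x, y) \<Rightarrow> ((f x - f y) / (x - y))\<^sup>2) = H z"
  proof -
    have "AE z in ?P. fst z \<noteq> snd z"
    proof (rule lborel_pair.AE_pair_measure)
      show "AE x in lborel. AE y in lborel. fst (x, y) \<noteq> snd (x, y :: real)"
      proof (rule AE_I2)
        fix x :: real
        show "AE y in lborel. fst (x, y) \<noteq> snd (x, y)"
          using AE_lborel_singleton[of x] by eventually_elim auto
      qed
    qed measurable
    then show ?thesis by eventually_elim (use quotient in auto)
  qed
  have fm [measurable]: "f \<in> borel_measurable borel"
    unfolding f by measurable
  have pi: "integrable lborel (p i j)" "integrable lborel (r i j)" if "i < N" "j < N" for i j
    unfolding p_def r_def using eta[OF that(1)] eta[OF that(2)] by (intro integrable_cauchy_product; simp)+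
  have Hm: "integrable ?P (\<lambda>(x, y). c i * c j * (Re (p i j x * p i j y - r i j x * r i j y) / 2))"
     and He: "(\<integral>(x, y). c i * c j * (Re (p i j x * p i j y - r i j x * r i j y) / 2) \<partial>?P) =
        4 * pi\<^sup>2 * (c i * c j * (Re (- 1 / (\<eta> i - cnj (\<eta> j))\<^sup>2) / 2))" if ij: "i < N" "j < N" for i j
  proof -
    let ?D = "\<lambda>z. (\<lambda>(x, y). p i j x * p i j y) z - (\<lambda>(x, y). r i j x * r i j y) z"
    have D: "integrable ?P ?D"
      by (intro Bochner_Integration.integrable_diff integrable_times_pair(1) pi ij)
    have eq: "(\<lambda>(x, y). c i * c j * (Re (p i j x * p i j y - r i j x * r i j y) / 2)) = (\<lambda>z. c i * c j * (Re (?D z) / 2))"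
      by auto
    show "integrable ?P (\<lambda>(x, y). c i * c j * (Re (p i j x * p i j y - r i j x * r i j y) / 2))"
      unfolding eq by (intro integrable_mult_right integrable_divide integrable_Re D)
    have P: "integral\<^sup>L lborel (p i j) = 2 * pi * \<i> / (\<eta> i - cnj (\<eta> j))"
      unfolding p_def using eta[OF ij(1)] eta[OF ij(2)] by (subst integral_cauchy_product) auto
    have R: "integral\<^sup>L lborel (r i j) = 0"
      unfolding r_def using eta[OF ij(1)] eta[OF ij(2)] by (subst integral_cauchy_product) auto
    have "integral\<^sup>L ?P ?D = (2 * pi * \<i> / (\<eta> i - cnj (\<eta> j))) * (2 * pi * \<i> / (\<eta> i - cnj (\<eta> j)))"
      using integrable_times_pair[OF pi(1)[OF ij] pi(1)[OF ij]] integrable_times_pair[OF pi(2)[OF ij] pi(2)[OF ij]]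
      by (subst Bochner_Integration.integral_diff) (auto simp: P R)
    also have "\<dots> = of_real (4 * pi\<^sup>2) * (- 1 / (\<eta> i - cnj (\<eta> j))\<^sup>2)"
    proof -
      have "(complex_of_real (2 * pi) * \<i>) * (complex_of_real (2 * pi) * \<i>) = - of_real (4 * pi\<^sup>2)"
        by (simp add: complex_eq_iff power2_eq_square)
      then have "(2 * pi * \<i> / d) * (2 * pi * \<i> / d) = of_real (4 * pi\<^sup>2) * (- 1 / d\<^sup>2)" for d
        by (simp only: times_divide_times_eq power2_eq_square[of d]) (simp only: times_divide_eq_right mult_minus1_right)
      then show ?thesis .
    qed
    finally have D_eq: "integral\<^sup>L ?P ?D = of_real (4 * pi\<^sup>2) * (- 1 / (\<eta> i - cnj (\<eta> j))\<^sup>2)" .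
    have "(\<integral>z. c i * c j * (Re (?D z) / 2) \<partial>?P) = c i * c j * (Re (integral\<^sup>L ?P ?D) / 2)"
      using integral_Re[OF D] by simp
    also have "Re (integral\<^sup>L ?P ?D) = 4 * pi\<^sup>2 * Re (- 1 / (\<eta> i - cnj (\<eta> j))\<^sup>2)"
      unfolding D_eq by (simp only: times_complex.sel Re_complex_of_real Im_complex_of_real)
    finally show "(\<integral>(x, y). c i * c j * (Re (p i j x * p i j y - r i j x * r i j y) / 2) \<partial>?P) =
        4 * pi\<^sup>2 * (c i * c j * (Re (- 1 / (\<eta> i - cnj (\<eta> j))\<^sup>2) / 2))"
      unfolding eq by simp
  qed
  have H_eq: "H = (\<lambda>z. \<Sum>i<N. \<Sum>j<N. (\<lambda>(x, y). c i * c j * (Re (p i j x * p i j y - r i j x * r i j y) / 2)) z)"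
    unfolding H_def by auto
  have H_int: "integrable ?P H"
    unfolding H_eq by (intro Bochner_Integration.integrable_sum Hm) auto
  have "integral\<^sup>L (lborel :: (real \<times> real) measure) (\<lambda>(x, y). ((f x - f y) / (x - y))\<^sup>2) = integral\<^sup>L ?P H"
    unfolding lborel_prod[symmetric]
  proof (rule integral_cong_AE)
    show "H \<in> borel_measurable ?P" using H_int by (rule borel_measurable_integrable)
  qed (measurable, rule AE)
  also have "\<dots> = (\<Sum>i<N. \<Sum>j<N. 4 * pi\<^sup>2 * (c i * c j * (Re (- 1 / (\<eta> i - cnj (\<eta> j))\<^sup>2) / 2)))"
  proof -
    have "integral\<^sup>L ?P H = (\<Sum>i<N. integral\<^sup>L ?P (\<lambda>z. \<Sum>j<N. (\<lambda>(x, y). c i * c j * (Re (p i j x * p i j y - r i j x * r i j y) / 2)) z))"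
      unfolding H_eq by (intro Bochner_Integration.integral_sum Bochner_Integration.integrable_sum Hm) auto
    also have "\<dots> = (\<Sum>i<N. \<Sum>j<N. integral\<^sup>L ?P (\<lambda>(x, y). c i * c j * (Re (p i j x * p i j y - r i j x * r i j y) / 2)))"
      by (intro sum.cong refl Bochner_Integration.integral_sum Hm) auto
    also have "\<dots> = (\<Sum>i<N. \<Sum>j<N. 4 * pi\<^sup>2 * (c i * c j * (Re (- 1 / (\<eta> i - cnj (\<eta> j))\<^sup>2) / 2)))"
      by (intro sum.cong refl He) auto
    finally show ?thesis .
  qed
  finally show ?thesis
    unfolding sigma2_def by (simp only: sum_distrib_left[symmetric]) simp
qed

section \<open>Fourier coefficients of resolvents\<close>

text \<open>The branch near \<open>(-2, 2)\<close> for which the upper half-plane goes into the unit disc.\<close>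

definition joukowsky_inv :: "complex \<Rightarrow> complex" where
  "joukowsky_inv w = (w - \<i> * csqrt (4 - w\<^sup>2)) / 2"

text \<open>(w - i r)/2 and (w + i r)/2 with r = csqrt (4 - w^2) are the roots of p^2 - w p + 1.
  Their product (w^2 + r^2)/4 is 1, so they are reciprocal to each other.\<close>

lemma joukowsky_inv:
  shows joukowsky_inv_nonzero: "joukowsky_inv w \<noteq> 0"
    and joukowsky_inv_add: "joukowsky_inv w + 1 / joukowsky_inv w = w"
    and joukowsky_inv_diff: "1 / joukowsky_inv w - joukowsky_inv w = \<i> * csqrt (4 - w\<^sup>2)"
proof -
  define r where "r = csqrt (4 - w\<^sup>2)"
  have "joukowsky_inv w * ((w + \<i> * r) / 2) = (w\<^sup>2 + r\<^sup>2) / 4"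
    unfolding joukowsky_inv_def r_def[symmetric] by (simp add: field_simps power2_eq_square)
  also have "r\<^sup>2 = 4 - w\<^sup>2" unfolding r_def by simp
  finally have 1: "joukowsky_inv w * ((w + \<i> * r) / 2) = 1" by simp
  then show "joukowsky_inv w \<noteq> 0" by auto
  then have 2: "1 / joukowsky_inv w = (w + \<i> * r) / 2"
    using 1 by (simp add: field_simps)
  show "joukowsky_inv w + 1 / joukowsky_inv w = w" "1 / joukowsky_inv w - joukowsky_inv w = \<i> * csqrt (4 - w\<^sup>2)"
    unfolding 2 r_def[symmetric] by (simp_all add: joukowsky_inv_def r_def[symmetric] field_simps)
qed

text \<open>Im w = (- Im p)(1/|p|^2 - 1), so opposite signs of Im w and Im p force |p| < 1. Bounding
  - Im p by |p| gives Im w \<le> (1 - |p|)(1 + |p|)/|p|, and the last quotient is at most 4 for |p|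
  \<ge> 1/2. This is how the distance of a pole from the real axis becomes a margin in the unit
  disc.\<close>

lemma norm_joukowsky_inv_less_1:
  assumes "Im w > 0" "Im (joukowsky_inv w) < 0"
  shows "norm (joukowsky_inv w) < 1"
    and "norm (joukowsky_inv w) \<ge> 1 / 2 \<Longrightarrow> Im w / 4 \<le> 1 - norm (joukowsky_inv w)"
proof -
  define p where "p = joukowsky_inv w"
  define m where "m = norm p"
  have m0: "0 < m" unfolding m_def p_def by (simp add: joukowsky_inv_nonzero)
  have "Im w = Im p + Im (1 / p)"
    using joukowsky_inv_add[of w] unfolding p_def[symmetric] by (metis plus_complex.sel(2))
  also have "Im (1 / p) = - Im p / m\<^sup>2"
    by (simp add: m_def Im_divide cmod_power2)
  finally have *: "Im w = (- Im p) * (1 / m\<^sup>2 - 1)" by (simp add: algebra_simps)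
  have "0 < 1 / m\<^sup>2 - 1"
    using assms zero_less_mult_pos[of "- Im p" "1 / m\<^sup>2 - 1"] unfolding * p_def[symmetric] by simp
  then have "m\<^sup>2 < 1" using m0 by (simp add: field_simps)
  then show m1: "norm (joukowsky_inv w) < 1"
    using m0 unfolding m_def p_def by (simp add: power2_less_1_iff)
  have "- Im p \<le> m" unfolding m_def using abs_Im_le_cmod[of p] by linarith
  then have "Im w \<le> m * (1 / m\<^sup>2 - 1)"
    unfolding * using \<open>0 < 1 / m\<^sup>2 - 1\<close> by (intro mult_right_mono) auto
  also have "\<dots> = (1 - m) * ((1 + m) / m)" using m0 by (simp add: field_simps power2_eq_square)
  finally have le: "Im w \<le> (1 - m) * ((1 + m) / m)" .
  show "Im w / 4 \<le> 1 - norm (joukowsky_inv w)" if "norm (joukowsky_inv w) \<ge> 1 / 2"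
  proof -
    have "(1 + m) / m \<le> 4" using that m1 m0 by (simp add: m_def p_def divide_le_eq)
    then have "(1 - m) * ((1 + m) / m) \<le> (1 - m) * 4"
      using m1 by (intro mult_left_mono) (auto simp: m_def p_def)
    then show ?thesis using le by (simp add: m_def p_def)
  qed
qed

text \<open>2 cos t - w = - (1 - p z)(1 - p/z) / p at z = cis t, so the resolvent is \<kappa> times
  the Poisson-type kernel 1 + \<Sum> p^k 2 cos (k t) over k \<ge> 1. The constant term \<kappa> is
  moved to the right-hand side.\<close>

lemma resolvent_cosine_expansion:
  fixes w p :: complex and \<epsilon> t :: real
  assumes p: "p \<noteq> 0" "norm p < 1" and w: "w = p + 1 / p"
  defines "\<kappa> \<equiv> - of_real \<epsilon> / (1 / p - p)"
  shows "(\<lambda>k. (if k = 0 then 0 else Im (\<kappa> * p ^ k)) * (2 * cos (real k * t))) sums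
           (Im (of_real \<epsilon> / (of_real (2 * cos t) - w)) - Im \<kappa>)"
proof -
  have lt: "norm (p * cis s) < 1" for s using p by (simp add: norm_mult)
  have "(\<lambda>k. (p * cis t) ^ k + (p * cis (- t)) ^ k) sums (1 / (1 - p * cis t) + 1 / (1 - p * cis (- t)))"
    by (intro sums_add geometric_sums lt)
  moreover have "(p * cis t) ^ k + (p * cis (- t)) ^ k = p ^ k * of_real (2 * cos (real k * t))" for k
    unfolding power_mult_distrib Complex.DeMoivre distrib_left[symmetric]
    by (rule arg_cong[of _ _ "\<lambda>z. p ^ k * z"]) (simp add: complex_eq_iff)
  ultimately have "(\<lambda>k. p ^ k * of_real (2 * cos (real k * t))) sums (1 / (1 - p * cis t) + 1 / (1 - p * cis (- t)))"
    by simp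
  note 0 = sums_diff[OF this sums_single[of 0 "\<lambda>k. p ^ k * of_real (2 * cos (real k * t))"]]
  have eq: "p ^ k * of_real (2 * cos (real k * t)) - (if k = 0 then p ^ k * of_real (2 * cos (real k * t)) else 0) =
      (if k = 0 then 0 else p ^ k) * of_real (2 * cos (real k * t))" for k
    by auto
  have "(\<lambda>k. (if k = 0 then 0 else p ^ k) * of_real (2 * cos (real k * t))) sums
      (1 / (1 - p * cis t) + 1 / (1 - p * cis (- t)) - 2)"
    using 0 unfolding eq by simp
  from sums_mult[OF this, of \<kappa>]
  have 1: "(\<lambda>k. \<kappa> * ((if k = 0 then 0 else p ^ k) * of_real (2 * cos (real k * t)))) sums
      (\<kappa> * (1 / (1 - p * cis t) + 1 / (1 - p * cis (- t)) - 2))" .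
  define E where "E = (1 - p * cis t) * (1 - p * cis (- t))"
  have nz: "1 - p * cis s \<noteq> 0" for s using lt[of s] by auto
  then have E0: "E \<noteq> 0" unfolding E_def by simp
  have zz: "cis t + cis (- t) = of_real (2 * cos t)" "cis t * cis (- t) = 1"
    by (simp_all add: complex_eq_iff cis_mult)
  have E: "E = 1 + p\<^sup>2 - p * of_real (2 * cos t)"
    unfolding E_def zz(1)[symmetric] using zz(2) by (simp add: algebra_simps power2_eq_square)
  have "1 / (1 - p * cis t) + 1 / (1 - p * cis (- t)) = (2 - p * (cis t + cis (- t))) / E"
    unfolding E_def using nz[of t] nz[of "- t"] by (simp add: add_frac_eq algebra_simps)
  also have "\<dots> - 2 = (1 - p\<^sup>2) / E - 1"
    unfolding zz(1) using E0 by (simp add: E field_simps)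
  finally have 2: "1 / (1 - p * cis t) + 1 / (1 - p * cis (- t)) - 2 = (1 - p\<^sup>2) / E - 1" .
  have "norm (p\<^sup>2) < 1" using p by (simp add: norm_power power_less_one_iff)
  then have p2: "1 - p\<^sup>2 \<noteq> 0" by auto
  have k: "\<kappa> = - of_real \<epsilon> * p / (1 - p\<^sup>2)"
    unfolding \<kappa>_def using p p2 by (simp add: field_simps power2_eq_square)
  have "E = - p * (of_real (2 * cos t) - w)"
    unfolding E w using p by (simp add: field_simps power2_eq_square)
  then have "\<kappa> * ((1 - p\<^sup>2) / E) = of_real \<epsilon> / (of_real (2 * cos t) - w)"
    unfolding k using p p2 by simp
  then have "\<kappa> * (1 / (1 - p * cis t) + 1 / (1 - p * cis (- t)) - 2) = of_real \<epsilon> / (of_real (2 * cos t) - w) - \<kappa>"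
    unfolding 2 by (simp add: right_diff_distrib)
  with 1 have "(\<lambda>k. \<kappa> * ((if k = 0 then 0 else p ^ k) * of_real (2 * cos (real k * t)))) sums
      (of_real \<epsilon> / (of_real (2 * cos t) - w) - \<kappa>)" by simp
  note 3 = sums_Im[OF this]
  have "Im (\<kappa> * ((if k = 0 then 0 else p ^ k) * of_real (2 * cos (real k * t)))) =
      (if k = 0 then 0 else Im (\<kappa> * p ^ k)) * (2 * cos (real k * t))" for k
    unfolding mult.assoc[symmetric] by auto
  then show ?thesis
    using 3 by (simp only: minus_complex.sel)
qed

section \<open>Asymptotics of the weighted sum of squared coefficients\<close>

lemma sums_of_nat_power:
  fixes z :: complex
  assumes "norm z < 1"
  shows "(\<lambda>k. of_nat k * z ^ k) sums (z / (1 - z)\<^sup>2)"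
proof -
  have "(\<lambda>k. z * (of_nat (Suc k) * z ^ k)) sums (z * (1 / (1 - z)\<^sup>2))"
    by (intro sums_mult geometric_deriv_sums assms)
  then have "(\<lambda>k. of_nat (Suc k) * z ^ Suc k) sums (z / (1 - z)\<^sup>2)"
    by (simp add: mult_ac)
  from sums_Suc[OF this] show ?thesis by simp
qed

text \<open>Im u Im w = (Re (u cnj w) - Re (u w)) / 2 reduces each product of coefficients to
  geometric terms. The two resulting families mirror the two kinds of pole pairs in
  \<open>sigma2_rational\<close>.\<close>

lemma sums_variance:
  fixes \<kappa> p :: "nat \<Rightarrow> complex" and c :: "nat \<Rightarrow> real"
  assumes p: "\<And>j. j < N \<Longrightarrow> norm (p j) < 1"
  shows "(\<lambda>k. real k * (\<Sum>j<N. c j * Im (\<kappa> j * p j ^ k))\<^sup>2) sums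
     (\<Sum>i<N. \<Sum>j<N. c i * c j * (Re (\<kappa> i * cnj (\<kappa> j) * (p i * cnj (p j)) / (1 - p i * cnj (p j))\<^sup>2
         - \<kappa> i * \<kappa> j * (p i * p j) / (1 - p i * p j)\<^sup>2) / 2))"
proof -
  have lt: "norm (a * b) < 1" if "norm a < 1" "norm b < 1" for a b :: complex
    using mult_strict_mono'[of "norm a" 1 "norm b" 1] that by (simp add: norm_mult)
  have "(\<lambda>k. \<Sum>i<N. \<Sum>j<N. c i * c j * (Re (\<kappa> i * cnj (\<kappa> j) * (of_nat k * (p i * cnj (p j)) ^ k)
         - \<kappa> i * \<kappa> j * (of_nat k * (p i * p j) ^ k)) / 2)) sums
     (\<Sum>i<N. \<Sum>j<N. c i * c j * (Re (\<kappa> i * cnj (\<kappa> j) * ((p i * cnj (p j)) / (1 - p i * cnj (p j))\<^sup>2)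
         - \<kappa> i * \<kappa> j * ((p i * p j) / (1 - p i * p j)\<^sup>2)) / 2))"
    by (intro sums_sum sums_mult sums_divide sums_Re sums_diff sums_of_nat_power lt) (use p in auto)
  moreover have "(\<Sum>i<N. \<Sum>j<N. c i * c j * (Re (\<kappa> i * cnj (\<kappa> j) * (of_nat k * (p i * cnj (p j)) ^ k)
         - \<kappa> i * \<kappa> j * (of_nat k * (p i * p j) ^ k)) / 2)) = real k * (\<Sum>j<N. c j * Im (\<kappa> j * p j ^ k))\<^sup>2" for k
  proof -
    have im: "Im u * Im w = Re (u * cnj w - u * w) / 2" for u w by simp
    have "real k * (\<Sum>j<N. c j * Im (\<kappa> j * p j ^ k))\<^sup>2 =
        (\<Sum>i<N. \<Sum>j<N. c i * c j * (real k * (Im (\<kappa> i * p i ^ k) * Im (\<kappa> j * p j ^ k))))"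
    proof -
      have "(\<Sum>j<N. c j * Im (\<kappa> j * p j ^ k))\<^sup>2 =
          (\<Sum>i<N. \<Sum>j<N. c i * c j * (Im (\<kappa> i * p i ^ k) * Im (\<kappa> j * p j ^ k)))"
        by (simp only: power2_eq_square sum_product) (simp only: mult_ac)
      then show ?thesis by (simp only: sum_distrib_left) (simp only: mult_ac)
    qed
    also have "\<dots> = (\<Sum>i<N. \<Sum>j<N. c i * c j * (Re (\<kappa> i * cnj (\<kappa> j) * (of_nat k * (p i * cnj (p j)) ^ k)
         - \<kappa> i * \<kappa> j * (of_nat k * (p i * p j) ^ k)) / 2))"
    proof (intro sum.cong refl)
      fix i j
      have "\<kappa> i * cnj (\<kappa> j) * (of_nat k * (p i * cnj (p j)) ^ k) - \<kappa> i * \<kappa> j * (of_nat k * (p i * p j) ^ k) =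
         of_real (real k) * ((\<kappa> i * p i ^ k) * cnj (\<kappa> j * p j ^ k) - (\<kappa> i * p i ^ k) * (\<kappa> j * p j ^ k))"
        by (simp add: power_mult_distrib algebra_simps)
      then have "Re (\<kappa> i * cnj (\<kappa> j) * (of_nat k * (p i * cnj (p j)) ^ k) - \<kappa> i * \<kappa> j * (of_nat k * (p i * p j) ^ k)) =
         real k * Re ((\<kappa> i * p i ^ k) * cnj (\<kappa> j * p j ^ k) - (\<kappa> i * p i ^ k) * (\<kappa> j * p j ^ k))"
        by (simp only: times_complex.sel(1) Re_complex_of_real Im_complex_of_real)
      then show "c i * c j * (real k * (Im (\<kappa> i * p i ^ k) * Im (\<kappa> j * p j ^ k))) =
          c i * c j * (Re (\<kappa> i * cnj (\<kappa> j) * (of_nat k * (p i * cnj (p j)) ^ k) - \<kappa> i * \<kappa> j * (of_nat k * (p i * p j) ^ k)) / 2)"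
        unfolding im by simp
    qed
    finally show ?thesis by simp
  qed
  ultimately show ?thesis by (simp add: times_divide_eq_right)
qed

text \<open>For x0 in the bulk 4 - x0^2 is positive, hence off the branch cut of the square root,
  and both expressions are continuous there.\<close>

lemma tendsto_joukowsky_inv_bulk:
  fixes x0 :: real and w :: "nat \<Rightarrow> complex"
  assumes x0: "-2 < x0" "x0 < 2" and w: "w \<longlonglongrightarrow> of_real x0"
  shows "(\<lambda>n. csqrt (4 - (w n)\<^sup>2)) \<longlonglongrightarrow> of_real (sqrt (4 - x0\<^sup>2))"
    and "(\<lambda>n. joukowsky_inv (w n)) \<longlonglongrightarrow> (of_real x0 - \<i> * of_real (sqrt (4 - x0\<^sup>2))) / 2"
proof -
  have pos: "0 < 4 - x0\<^sup>2"
  proof -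
    have "0 < (2 - x0) * (2 + x0)" using x0 by simp
    then show ?thesis by (simp add: power2_eq_square algebra_simps)
  qed
  have "(\<lambda>n. 4 - (w n)\<^sup>2) \<longlonglongrightarrow> 4 - (complex_of_real x0)\<^sup>2"
    by (intro tendsto_intros w)
  also have "4 - (complex_of_real x0)\<^sup>2 = of_real (4 - x0\<^sup>2)" by simp
  finally have 1: "(\<lambda>n. 4 - (w n)\<^sup>2) \<longlonglongrightarrow> complex_of_real (4 - x0\<^sup>2)" .
  have "complex_of_real (4 - x0\<^sup>2) \<notin> \<real>\<^sub>\<le>\<^sub>0"
    using pos by (simp only: nonpos_Reals_of_real_iff not_le)
  then have "isCont csqrt (complex_of_real (4 - x0\<^sup>2))"
    by (rule continuous_at_csqrt)
  from isCont_tendsto_compose[OF this 1]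
  show 2: "(\<lambda>n. csqrt (4 - (w n)\<^sup>2)) \<longlonglongrightarrow> of_real (sqrt (4 - x0\<^sup>2))"
    using pos csqrt_of_real_nonneg[of "complex_of_real (4 - x0\<^sup>2)"] by simp
  show "(\<lambda>n. joukowsky_inv (w n)) \<longlonglongrightarrow> (of_real x0 - \<i> * of_real (sqrt (4 - x0\<^sup>2))) / 2"
    unfolding joukowsky_inv_def by (intro tendsto_intros w 2) auto
qed

text \<open>Numerator and denominator are both of order e^2. Put z = cnj q. Subtracting the
  Joukowsky equations of p and z gives (p - z)(p z - 1) = e (h1 - cnj h2) p z, which exhibits the
  factor e in 1 - p z exactly. After cancelling e^2 the quotient is \<open>G\<close>, which is
  continuous in the limit because p - z tends to u - cnj u = - i r0 \<noteq> 0.\<close>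

lemma variance_term_limit:
  fixes x0 r0 :: real and e :: "nat \<Rightarrow> real" and h1 h2 u :: complex and p q a b :: "nat \<Rightarrow> complex"
  assumes e: "\<forall>\<^sub>F n in sequentially. e n \<noteq> 0"
    and p: "\<And>n. p n + 1 / p n = of_real x0 + of_real (e n) * h1" "\<And>n. p n \<noteq> 0" "p \<longlonglongrightarrow> u"
    and q: "\<And>n. q n + 1 / q n = of_real x0 + of_real (e n) * h2" "\<And>n. q n \<noteq> 0" "q \<longlonglongrightarrow> u"
    and a: "a \<longlonglongrightarrow> of_real r0" "\<And>n. 1 / p n - p n = \<i> * a n"
    and b: "b \<longlonglongrightarrow> of_real r0" "\<And>n. 1 / q n - q n = \<i> * b n"
    and r0: "0 < r0" and u: "u = (of_real x0 - \<i> * of_real r0) / 2" "u * cnj u = 1"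
    and h: "h1 \<noteq> cnj h2"
  defines "\<kappa> \<equiv> \<lambda>n. - of_real (e n) / (1 / p n - p n)" and "\<mu> \<equiv> \<lambda>n. - of_real (e n) / (1 / q n - q n)"
  shows "(\<lambda>n. \<kappa> n * cnj (\<mu> n) * (p n * cnj (q n)) / (1 - p n * cnj (q n))\<^sup>2) \<longlonglongrightarrow> - 1 / (h1 - cnj h2)\<^sup>2"
proof -
  have ucu: "u - cnj u = - \<i> * of_real r0"
    unfolding u(1) by (simp add: complex_eq_iff)
  define G where "G n = (p n - cnj (q n))\<^sup>2 / (a n * cnj (b n) * (p n * cnj (q n)) * (h1 - cnj h2)\<^sup>2)" for n
  have "G \<longlonglongrightarrow> (u - cnj u)\<^sup>2 / (of_real r0 * cnj (of_real r0) * (u * cnj u) * (h1 - cnj h2)\<^sup>2)"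
    unfolding G_def using r0 u(2) h by (intro tendsto_intros p(3) q(3) a(1) b(1)) auto
  also have "(u - cnj u)\<^sup>2 / (of_real r0 * cnj (of_real r0) * (u * cnj u) * (h1 - cnj h2)\<^sup>2) = - 1 / (h1 - cnj h2)\<^sup>2"
    unfolding ucu u(2) using r0 by (simp add: power2_eq_square power_mult_distrib)
  finally have G: "G \<longlonglongrightarrow> - 1 / (h1 - cnj h2)\<^sup>2" .
  have "(\<lambda>n. p n - cnj (q n)) \<longlonglongrightarrow> u - cnj u"
    by (intro tendsto_intros p(3) q(3))
  moreover have "u - cnj u \<noteq> 0" unfolding ucu using r0 by simp
  ultimately have "\<forall>\<^sub>F n in sequentially. p n - cnj (q n) \<noteq> 0"
    by (rule tendsto_imp_eventually_ne)
  moreover have "\<forall>\<^sub>F n in sequentially. a n \<noteq> 0" "\<forall>\<^sub>F n in sequentially. b n \<noteq> 0"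
    by (rule tendsto_imp_eventually_ne[OF a(1)] tendsto_imp_eventually_ne[OF b(1)], use r0 in simp)+
  ultimately have "\<forall>\<^sub>F n in sequentially. G n = \<kappa> n * cnj (\<mu> n) * (p n * cnj (q n)) / (1 - p n * cnj (q n))\<^sup>2"
    using e
  proof eventually_elim
    case (elim n)
    define z where "z = cnj (q n)"
    define D where "D = h1 - cnj h2"
    define \<epsilon> where "\<epsilon> = complex_of_real (e n)"
    define A where "A = a n"
    define B where "B = cnj (b n)"
    define P where "P = p n"
    have nz: "z \<noteq> 0" "D \<noteq> 0" "\<epsilon> \<noteq> 0" "A \<noteq> 0" "B \<noteq> 0" "P \<noteq> 0" "P - z \<noteq> 0"
      using q(2)[of n] h elim p(2) by (auto simp: z_def D_def \<epsilon>_def A_def B_def P_def)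
    have "z + 1 / z = of_real x0 + \<epsilon> * cnj h2"
      using arg_cong[OF q(1)[of n], of cnj] by (simp add: z_def \<epsilon>_def)
    then have "(P + 1 / P) - (z + 1 / z) = \<epsilon> * D"
      using p(1)[of n] by (simp add: P_def D_def \<epsilon>_def algebra_simps)
    moreover have "(P + 1 / P) - (z + 1 / z) = (P - z) * (P * z - 1) / (P * z)"
      using nz by (simp add: field_simps)
    ultimately have "(P - z) * (P * z - 1) = \<epsilon> * D * (P * z)"
      using nz by (simp add: divide_eq_eq)
    then have "P * z - 1 = \<epsilon> * D * (P * z) / (P - z)"
      using nz by (metis nonzero_mult_div_cancel_left)
    then have one: "(1 - P * z)\<^sup>2 = (\<epsilon> * D * (P * z) / (P - z))\<^sup>2"
      by (metis power2_commute)
    have "\<kappa> n = - \<epsilon> / (\<i> * A)" unfolding \<kappa>_def a(2) \<epsilon>_def A_def ..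
    moreover have "cnj (\<mu> n) = \<epsilon> / (\<i> * B)" unfolding \<mu>_def b(2) \<epsilon>_def B_def by simp
    moreover have "(- \<epsilon> / (\<i> * A)) * (\<epsilon> / (\<i> * B)) = \<epsilon>\<^sup>2 / (A * B)"
    proof -
      have "\<i> * A * (\<i> * B) = - (A * B)" by (simp add: algebra_simps)
      then show ?thesis unfolding times_divide_times_eq by (simp add: power2_eq_square)
    qed
    ultimately have km: "\<kappa> n * cnj (\<mu> n) = \<epsilon>\<^sup>2 / (A * B)" by simp
    have "\<epsilon>\<^sup>2 / (A * B) * (P * z) / (1 - P * z)\<^sup>2 = (P - z)\<^sup>2 / (A * B * (P * z) * D\<^sup>2)"
      unfolding one using nz by (simp add: power_mult_distrib power_divide power2_eq_square)
    then show ?case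
      unfolding G_def km z_def[symmetric] P_def[symmetric] A_def[symmetric] B_def[symmetric] D_def[symmetric] by simp
  qed
  from Lim_transform_eventually[OF G this] show ?thesis .
qed

section \<open>The central limit theorem\<close>

text \<open>The degenerate case is real: \<open>f = 0\<close> has variance 0, and the point mass at
  0 then obeys the same formula. Otherwise the standard normal law is rescaled.\<close>

lemma char_gaussian0:
  assumes "0 \<le> s2"
  shows "real_distribution (gaussian0 s2)" and "char (gaussian0 s2) t = exp (- (of_real (t\<^sup>2 * s2 / 2)))"
proof -
  have "real_distribution (gaussian0 s2) \<and> char (gaussian0 s2) t = exp (- (of_real (t\<^sup>2 * s2 / 2)))"
  proof (cases "s2 = 0")
    case True
    have "prob_space (return borel (0::real))" by (rule prob_space_return) simp
    then have "real_distribution (return borel (0::real))"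
      by (simp add: real_distribution_def real_distribution_axioms_def)
    moreover have "char (return borel 0) t = 1"
      unfolding char_def by (subst integral_return) auto
    ultimately show ?thesis using True by (simp add: gaussian0_def)
  next
    case False
    define \<sigma> where "\<sigma> = sqrt s2"
    have \<sigma>: "0 < \<sigma>" "\<sigma>\<^sup>2 = s2" using False assms by (auto simp: \<sigma>_def)
    define G where "G = density lborel (normal_density 0 \<sigma>)"
    interpret G: prob_space G unfolding G_def by (rule prob_space_normal_density[OF \<sigma>(1)])
    have G_eq: "gaussian0 s2 = G" using False by (simp add: gaussian0_def G_def \<sigma>_def)
    have sets_G [measurable_cong]: "sets G = sets borel" by (simp add: G_def)
    have rd: "real_distribution G"
      by (simp add: real_distribution_def real_distribution_axioms_def G.prob_space_axioms sets_G)
    have "distributed G lborel (\<lambda>x. x) (normal_density 0 \<sigma>)"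
      unfolding distributed_def G_def by (auto simp: distr_id2)
    then have "distributed G lborel (\<lambda>x. (x - 0) / \<sigma>) std_normal_density"
      by (rule iffD1[OF G.normal_standard_normal_convert[OF \<sigma>(1), of "\<lambda>x. x" 0]])
    then have d: "distr G lborel (\<lambda>x. x / \<sigma>) = std_normal_distribution"
      by (simp add: distributed_def)
    have "char G t = (\<integral>x. iexp ((t * \<sigma>) * (x / \<sigma>)) \<partial>G)"
      unfolding char_def using \<sigma> by simp
    also have "\<dots> = (\<integral>x. iexp ((t * \<sigma>) * x) \<partial>(distr G lborel (\<lambda>x. x / \<sigma>)))"
      by (rule integral_distr[symmetric]) auto
    also have "\<dots> = char std_normal_distribution (t * \<sigma>)"
      unfolding d char_def ..
    also have "\<dots> = exp (- (of_real (t\<^sup>2 * s2 / 2)))"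
      unfolding char_std_normal_distribution using \<sigma>(2)
      by (simp add: power_mult_distrib flip: exp_of_real)
    finally show ?thesis using G_eq rd by simp
  qed
  then show "real_distribution (gaussian0 s2)" "char (gaussian0 s2) t = exp (- (of_real (t\<^sup>2 * s2 / 2)))" by auto
qed

text \<open>With x = d n^-\<alpha>, (1 - x)^n \<le> exp (- n x) and n x = d n^(1-\<alpha>) grows
  because \<alpha> < 1; this beats the polynomial factors n and x^-3.\<close>

lemma mesoscopic_rate:
  fixes \<alpha> d :: real
  assumes "0 < \<alpha>" "\<alpha> < 1" "0 < d"
  shows "(\<lambda>n. real n * (1 - d * real n powr - \<alpha>) ^ n / (1 - (1 - d * real n powr - \<alpha>)) ^ 3) \<longlonglongrightarrow> 0"
proof (rule Lim_null_comparison)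
  have "(\<lambda>n. d * real n powr - \<alpha>) \<longlonglongrightarrow> 0"
    using assms by real_asymp
  then have "\<forall>\<^sub>F n in sequentially. d * real n powr - \<alpha> < 1"
    by (rule order_tendstoD) simp
  then show "\<forall>\<^sub>F n in sequentially. norm (real n * (1 - d * real n powr - \<alpha>) ^ n / (1 - (1 - d * real n powr - \<alpha>)) ^ 3) \<le>
      real n * exp (- d * real n powr (1 - \<alpha>)) / (d * real n powr - \<alpha>) ^ 3"
    using eventually_gt_at_top[of 0]
  proof eventually_elim
    case (elim n)
    define x where "x = d * real n powr - \<alpha>"
    have x: "0 < x" "x < 1" using elim assms by (auto simp: x_def)
    have "(1 - x) ^ n \<le> exp (- x) ^ n"
      using x exp_ge_add_one_self[of "- x"] by (intro power_mono) auto
    also have "\<dots> = exp (- (real n * x))" by (simp flip: exp_of_nat_mult)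
    also have "real n * x = d * real n powr (1 - \<alpha>)"
      using elim by (simp add: x_def powr_diff powr_minus divide_inverse)
    finally have "(1 - x) ^ n \<le> exp (- d * real n powr (1 - \<alpha>))" by simp
    then have "real n * (1 - x) ^ n / x ^ 3 \<le> real n * exp (- d * real n powr (1 - \<alpha>)) / x ^ 3"
      using x by (intro divide_right_mono mult_left_mono) auto
    moreover have "norm (real n * (1 - x) ^ n / (1 - (1 - x)) ^ 3) = real n * (1 - x) ^ n / x ^ 3"
      using x by simp
    ultimately show ?case unfolding x_def by simp
  qed
  show "(\<lambda>n. real n * exp (- d * real n powr (1 - \<alpha>)) / (d * real n powr - \<alpha>) ^ 3) \<longlonglongrightarrow> 0"
    using assms by real_asymp
qed

theorem theorem4p7:
  fixes x0 \<alpha> :: real and N :: nat and \<eta> :: "nat \<Rightarrow> complex" and c :: "nat \<Rightarrow> real"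
    and f :: "real \<Rightarrow> real"
  assumes "-2 < x0" "x0 < 2" "0 < \<alpha>" "\<alpha> < 1"
    and "\<And>j. j < N \<Longrightarrow> Im (\<eta> j) > 0"
    and "\<And>x. f x = (\<Sum>j<N. c j * Im (1 / (complex_of_real x - \<eta> j)))"
  shows "weak_conv_m
           (\<lambda>n. distr (ope n) borel
                  (\<lambda>x. lin_stat f \<alpha> x0 n x - integral\<^sup>L (ope n) (lin_stat f \<alpha> x0 n)))
           (gaussian0 (sigma2 f))"
proof -
  note x0 = assms(1,2) and \<alpha> = assms(3,4) and eta = assms(5) and f = assms(6)
  have f_meas [measurable]: "f \<in> borel_measurable borel"
    unfolding f by measurable
  define e where "e n = real n powr - \<alpha>" for n :: nat
  have e_lim: "e \<longlonglongrightarrow> 0"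
    unfolding e_def using \<alpha> by real_asymp
  have e_pos: "0 < e n" if "0 < n" for n
    using that by (simp add: e_def)
  define r0 where "r0 = sqrt (4 - x0\<^sup>2)"
  have "0 < (2 - x0) * (2 + x0)" using x0 by simp
  then have x02: "x0\<^sup>2 < 4" by (simp add: power2_eq_square algebra_simps)
  have r0: "0 < r0" "r0\<^sup>2 = 4 - x0\<^sup>2" using x02 by (auto simp: r0_def)
  define u where "u = (of_real x0 - \<i> * of_real r0) / 2"
  have u_cnj: "u * cnj u = 1"
    using r0(2) by (simp add: u_def complex_eq_iff power2_eq_square)
  then have u_norm: "norm u = 1"
    by (metis complex_mod_cnj mult_cancel_left2 norm_mult norm_one norm_ge_zero
        abs_norm_cancel abs_square_eq_1 power2_eq_square)
  have u_Im: "Im u < 0" using r0(1) by (simp add: u_def)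
  \<comment> \<open>The pole of the j-th resolvent in the unscaled variable: n^\<alpha> (y - x0) -
    \<eta>_j = n^\<alpha> (y - w).\<close>
  define w where "w n j = of_real x0 + of_real (e n) * \<eta> j" for n j
  define p where "p n j = joukowsky_inv (w n j)" for n j
  define R where "R n j = csqrt (4 - (w n j)\<^sup>2)" for n j
  define \<kappa> where "\<kappa> n j = - of_real (e n) / (1 / p n j - p n j)" for n j
  have w_lim: "(\<lambda>n. w n j) \<longlonglongrightarrow> of_real x0" for j
  proof -
    have "(\<lambda>n. w n j) \<longlonglongrightarrow> of_real x0 + of_real 0 * \<eta> j"
      unfolding w_def by (intro tendsto_intros e_lim)
    then show ?thesis by simp
  qed
  have R_lim: "(\<lambda>n. R n j) \<longlonglongrightarrow> of_real r0" for j
    unfolding R_def r0_def by (rule tendsto_joukowsky_inv_bulk(1)[OF x0 w_lim])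
  have p_lim: "(\<lambda>n. p n j) \<longlonglongrightarrow> u" for j
    unfolding p_def u_def r0_def by (rule tendsto_joukowsky_inv_bulk(2)[OF x0 w_lim])
  have p_nz: "p n j \<noteq> 0" and p_add: "p n j + 1 / p n j = w n j" and p_diff: "1 / p n j - p n j = \<i> * R n j" for n j
    unfolding p_def R_def by (rule joukowsky_inv_nonzero joukowsky_inv_add joukowsky_inv_diff)+
  \<comment> \<open>32 = 4 * 8. The margin of |p| below 1 is at least Im w / 4, hence at least 8 d
    e, and Bernoulli's inequality gives |p| \<le> 1 - 8 d e \<le> s^8. Dividing by s^4 then still
    leaves s^4 per index for summability. The extra 1 in the minimum covers
    \<open>N = 0\<close>.\<close>
  obtain d where d: "0 < d" "\<And>j. j < N \<Longrightarrow> 32 * d \<le> Im (\<eta> j)"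
  proof -
    define m where "m = Min (insert 1 ((\<lambda>j. Im (\<eta> j)) ` {..<N}))"
    have "0 < m" unfolding m_def using eta by (subst Min_gr_iff) auto
    moreover have "m \<le> Im (\<eta> j)" if "j < N" for j unfolding m_def using that by (intro Min_le) auto
    ultimately show ?thesis by (intro that[of "m / 32"]) auto
  qed
  define s where "s n = 1 - d * e n" for n
  have "(\<lambda>n. d * e n) \<longlonglongrightarrow> d * 0" by (intro tendsto_intros e_lim)
  then have "\<forall>\<^sub>F n in sequentially. d * e n < 1"
    by (rule order_tendstoD) simp
  then have s_ev: "\<forall>\<^sub>F n in sequentially. 0 < s n \<and> s n < 1"
    using eventually_gt_at_top[of 0] by eventually_elim (use e_pos d(1) in \<open>auto simp: s_def\<close>)
  \<comment> \<open>The limit u lies on the unit circle in the lower half-plane, which supplies the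
    hypotheses of the margin estimate; the lower bound on R is what makes \<kappa> of order
    \<open>e n\<close>.\<close>
  have "\<forall>\<^sub>F n in sequentially. \<forall>j\<in>{..<N}. Im (p n j) < 0 \<and> 1 / 2 < norm (p n j) \<and> r0 / 2 < norm (R n j)"
  proof (intro eventually_ball_finite finite_lessThan ballI eventually_conj)
    fix j
    show "\<forall>\<^sub>F n in sequentially. Im (p n j) < 0"
      by (rule order_tendstoD(2)[OF tendsto_Im[OF p_lim] u_Im])
    show "\<forall>\<^sub>F n in sequentially. 1 / 2 < norm (p n j)"
      by (rule order_tendstoD(1)[OF tendsto_norm[OF p_lim]]) (simp add: u_norm)
    show "\<forall>\<^sub>F n in sequentially. r0 / 2 < norm (R n j)"
      by (rule order_tendstoD(1)[OF tendsto_norm[OF R_lim]]) (use r0(1) in simp)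
  qed
  then have pk: "\<forall>\<^sub>F n in sequentially. \<forall>j<N. norm (p n j) < 1 \<and> norm (p n j) \<le> s n ^ 8 \<and> norm (\<kappa> n j) \<le> 2 / r0 * e n"
    using s_ev eventually_gt_at_top[of 0]
  proof eventually_elim
    case (elim n)
    show ?case
    proof (intro allI impI)
      fix j assume j: "j < N"
      have en: "0 < e n" using elim e_pos by simp
      have wpos: "0 < Im (w n j)" using en eta[OF j] by (simp add: w_def)
      have P: "Im (joukowsky_inv (w n j)) < 0" "1 / 2 \<le> norm (joukowsky_inv (w n j))" "r0 / 2 < norm (R n j)"
        using elim j unfolding p_def by (auto intro: less_imp_le)
      note 1 = norm_joukowsky_inv_less_1[OF wpos P(1)]
      have "32 * d * e n \<le> Im (\<eta> j) * e n" using d(2)[OF j] en by (intro mult_right_mono) auto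
      then have "8 * (d * e n) \<le> Im (w n j) / 4" by (simp add: w_def mult_ac)
      also have "\<dots> \<le> 1 - norm (p n j)" unfolding p_def by (rule 1(2)[OF P(2)])
      finally have "norm (p n j) \<le> 1 + real 8 * (- (d * e n))" by simp
      also have "\<dots> \<le> (1 + - (d * e n)) ^ 8"
        using elim by (intro Bernoulli_inequality) (auto simp: s_def)
      finally have 2: "norm (p n j) \<le> s n ^ 8" by (simp add: s_def)
      have "norm (\<kappa> n j) = e n / norm (R n j)"
        unfolding \<kappa>_def p_diff using en by (simp add: norm_divide norm_mult)
      also have "\<dots> \<le> e n / (r0 / 2)"
        using P(3) r0(1) en by (intro divide_left_mono mult_pos_pos) auto
      finally show "norm (p n j) < 1 \<and> norm (p n j) \<le> s n ^ 8 \<and> norm (\<kappa> n j) \<le> 2 / r0 * e n"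
        using 1(1) 2 unfolding p_def by (simp add: mult.commute)
    qed
  qed
  define v where "v n k = (if k = 0 then 0 else \<Sum>j<N. c j * Im (\<kappa> n j * p n j ^ k))" for n k :: nat
  define v0 where "v0 n = (\<Sum>j<N. c j * Im (\<kappa> n j))" for n
  define W where "W n y = f (real n powr \<alpha> * (y - x0)) - v0 n" for n y
  have W_meas: "W n \<in> borel_measurable borel" for n
    unfolding W_def by measurable
  define X where "X n y = (\<Sum>i<n. W n (y i))" for n and y :: "nat \<Rightarrow> real"
  \<comment> \<open>The coefficients are of order e through \<kappa>, and the geometric series sums
    to 1 / (1 - s) = 1 / (d e). The scale e cancels, so the bound does not depend on n.\<close>
  define C where "C = (\<Sum>j<N. \<bar>c j\<bar>) * (2 / r0) / d"
  have summ: "\<forall>\<^sub>F n in sequentially. summable (\<lambda>k. \<bar>v n k\<bar> / s n ^ (4 * k)) \<and> (\<Sum>k. \<bar>v n k\<bar> / s n ^ (4 * k)) \<le> C"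
    using pk s_ev eventually_gt_at_top[of 0]
  proof eventually_elim
    case (elim n)
    then have s: "0 < s n" "s n < 1" and en: "0 < e n" using e_pos by auto
    define B where "B = (\<Sum>j<N. \<bar>c j\<bar>) * (2 / r0 * e n)"
    have B0: "0 \<le> B" unfolding B_def using en r0(1) by (intro mult_nonneg_nonneg sum_nonneg) auto
    have term_le: "\<bar>v n k\<bar> / s n ^ (4 * k) \<le> B * s n ^ k" for k
    proof -
      have "\<bar>v n k\<bar> \<le> (\<Sum>j<N. \<bar>c j\<bar> * (2 / r0 * e n * s n ^ (8 * k)))"
      proof (cases "k = 0")
        case True
        then show ?thesis using en r0(1) by (auto simp: v_def intro!: sum_nonneg)
      next
        case False
        then have "\<bar>v n k\<bar> \<le> (\<Sum>j<N. \<bar>c j * Im (\<kappa> n j * p n j ^ k)\<bar>)" by (simp add: v_def)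
        also have "\<dots> \<le> (\<Sum>j<N. \<bar>c j\<bar> * (2 / r0 * e n * s n ^ (8 * k)))"
        proof (intro sum_mono)
          fix j assume "j \<in> {..<N}"
          then have j: "norm (p n j) \<le> s n ^ 8" "norm (\<kappa> n j) \<le> 2 / r0 * e n" using elim by auto
          have "\<bar>Im (\<kappa> n j * p n j ^ k)\<bar> \<le> norm (\<kappa> n j) * norm (p n j) ^ k"
            using abs_Im_le_cmod[of "\<kappa> n j * p n j ^ k"] by (simp only: norm_mult norm_power)
          also have "\<dots> \<le> 2 / r0 * e n * (s n ^ 8) ^ k"
            using j en r0(1) by (intro mult_mono power_mono) auto
          finally show "\<bar>c j * Im (\<kappa> n j * p n j ^ k)\<bar> \<le> \<bar>c j\<bar> * (2 / r0 * e n * s n ^ (8 * k))"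
            by (simp only: abs_mult power_mult) (rule mult_left_mono, auto)
        qed
        finally show ?thesis .
      qed
      also have "\<dots> = B * s n ^ (8 * k)"
        unfolding B_def sum_distrib_right by (simp add: mult_ac)
      finally have "\<bar>v n k\<bar> / s n ^ (4 * k) \<le> B * s n ^ (8 * k) / s n ^ (4 * k)"
        using s by (intro divide_right_mono) auto
      also have "\<dots> = B * s n ^ (4 * k)"
      proof -
        have "s n ^ (8 * k) = s n ^ (4 * k) * s n ^ (4 * k)" by (simp flip: power_add)
        then show ?thesis using s by simp
      qed
      also have "\<dots> \<le> B * s n ^ k"
        using s B0 by (intro mult_left_mono power_decreasing) auto
      finally show ?thesis .
    qed
    have geo: "summable (\<lambda>k. B * s n ^ k)"
      using s by (intro summable_mult summable_geometric) auto
    have 1: "summable (\<lambda>k. \<bar>v n k\<bar> / s n ^ (4 * k))"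
      by (rule summable_comparison_test'[OF geo, of 0]) (use term_le s in auto)
    have "(\<Sum>k. \<bar>v n k\<bar> / s n ^ (4 * k)) \<le> (\<Sum>k. B * s n ^ k)"
      by (intro suminf_le term_le 1 geo)
    also have "\<dots> = B * (1 / (1 - s n))"
      using s by (subst suminf_mult) (auto intro!: summable_geometric simp: suminf_geometric)
    also have "\<dots> = C"
      unfolding B_def C_def s_def using en d(1) r0(1) by (simp add: field_simps)
    finally show ?case using 1 by simp
  qed
  have W_sum: "\<forall>\<^sub>F n in sequentially. \<forall>t. W n (2 * cos t) = (\<Sum>k. v n k * (2 * cos (real k * t)))"
    using pk eventually_gt_at_top[of 0]
  proof eventually_elim
    case (elim n)
    show ?case
    proof
      fix t
      have "(\<lambda>k. \<Sum>j<N. c j * ((if k = 0 then 0 else Im (\<kappa> n j * p n j ^ k)) * (2 * cos (real k * t)))) sums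
         (\<Sum>j<N. c j * (Im (of_real (e n) / (of_real (2 * cos t) - w n j)) - Im (\<kappa> n j)))"
        unfolding \<kappa>_def
        by (intro sums_sum sums_mult resolvent_cosine_expansion p_nz p_add[symmetric]) (use elim in auto)
      moreover have "(\<Sum>j<N. c j * ((if k = 0 then 0 else Im (\<kappa> n j * p n j ^ k)) * (2 * cos (real k * t)))) =
         v n k * (2 * cos (real k * t))" for k
        by (cases "k = 0") (simp_all only: v_def sum_distrib_right mult.assoc if_True if_False, simp_all)
      moreover have "(\<Sum>j<N. c j * (Im (of_real (e n) / (of_real (2 * cos t) - w n j)) - Im (\<kappa> n j))) = W n (2 * cos t)"
      proof -
        have ne: "real n powr \<alpha> \<noteq> 0" "e n = 1 / real n powr \<alpha>"
          using elim by (auto simp: e_def powr_minus divide_inverse)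
        have "of_real (e n) / (of_real (2 * cos t) - w n j) =
            1 / (complex_of_real (real n powr \<alpha> * (2 * cos t - x0)) - \<eta> j)" for j
        proof -
          have "complex_of_real (real n powr \<alpha> * (2 * cos t - x0)) - \<eta> j =
              of_real (real n powr \<alpha>) * (of_real (2 * cos t) - w n j)"
            unfolding w_def ne(2) using ne(1) by (simp add: field_simps)
          then show ?thesis unfolding ne(2) by simp
        qed
        then show ?thesis
          unfolding W_def f v0_def by (simp only: right_diff_distrib sum_subtractf)
      qed
      ultimately have "(\<lambda>k. v n k * (2 * cos (real k * t))) sums W n (2 * cos t)" by simp
      then show "W n (2 * cos t) = (\<Sum>k. v n k * (2 * cos (real k * t)))" by (rule sums_unique)
    qed
  qed
  have rate: "(\<lambda>n. real n * s n ^ n / (1 - s n) ^ 3) \<longlonglongrightarrow> 0"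
    unfolding s_def e_def by (rule mesoscopic_rate[OF \<alpha> d(1)])
  have var: "(\<lambda>n. \<Sum>k. real k * (v n k)\<^sup>2) \<longlonglongrightarrow> sigma2 f"
  proof -
    let ?V = "\<lambda>n. \<Sum>i<N. \<Sum>j<N. c i * c j * (Re (\<kappa> n i * cnj (\<kappa> n j) * (p n i * cnj (p n j)) / (1 - p n i * cnj (p n j))\<^sup>2
         - \<kappa> n i * \<kappa> n j * (p n i * p n j) / (1 - p n i * p n j)\<^sup>2) / 2)"
    \<comment> \<open>Only the terms with p cnj p survive: there 1 - p cnj p tends to 0 at the same
      rate as \<kappa>. In the other terms 1 - p p tends to 1 - u^2 \<noteq> 0 while \<kappa> tends
      to 0.\<close>
    have "?V \<longlonglongrightarrow> (\<Sum>i<N. \<Sum>j<N. c i * c j * (Re (- 1 / (\<eta> i - cnj (\<eta> j))\<^sup>2 - 0) / 2))"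
    proof (intro tendsto_sum)
      fix i j assume ij: "i \<in> {..<N}" "j \<in> {..<N}"
      have h: "\<eta> i \<noteq> cnj (\<eta> j)"
      proof
        assume "\<eta> i = cnj (\<eta> j)"
        then have "Im (\<eta> i) = - Im (\<eta> j)" by simp
        then show False using eta[of i] eta[of j] ij by simp
      qed
      have e_nz: "\<forall>\<^sub>F n in sequentially. e n \<noteq> 0"
        using eventually_gt_at_top[of 0]
      proof eventually_elim
        case (elim n)
        then show ?case using e_pos[of n] by simp
      qed
      have 1: "(\<lambda>n. \<kappa> n i * cnj (\<kappa> n j) * (p n i * cnj (p n j)) / (1 - p n i * cnj (p n j))\<^sup>2) \<longlonglongrightarrow> - 1 / (\<eta> i - cnj (\<eta> j))\<^sup>2"
        unfolding \<kappa>_def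
        by (rule variance_term_limit[OF e_nz p_add[unfolded w_def] p_nz p_lim p_add[unfolded w_def] p_nz p_lim
              R_lim p_diff R_lim p_diff r0(1) u_def u_cnj h])
      have k_lim: "(\<lambda>n. \<kappa> n i) \<longlonglongrightarrow> 0" for i
      proof -
        have "(\<lambda>n. \<kappa> n i) \<longlonglongrightarrow> - of_real 0 / (\<i> * of_real r0)"
          unfolding \<kappa>_def p_diff using r0(1) by (intro tendsto_intros e_lim R_lim) auto
        then show ?thesis by simp
      qed
      have "u * u \<noteq> 1"
      proof
        assume "u * u = 1"
        then have "u = 1 \<or> u = -1" by (simp add: square_eq_1_iff)
        then show False using u_Im by auto
      qed
      then have "(\<lambda>n. \<kappa> n i * \<kappa> n j * (p n i * p n j) / (1 - p n i * p n j)\<^sup>2) \<longlonglongrightarrow> 0 * 0 * (u * u) / (1 - u * u)\<^sup>2"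
        by (intro tendsto_intros k_lim p_lim) auto
      then have 2: "(\<lambda>n. \<kappa> n i * \<kappa> n j * (p n i * p n j) / (1 - p n i * p n j)\<^sup>2) \<longlonglongrightarrow> 0" by simp
      show "(\<lambda>n. c i * c j * (Re (\<kappa> n i * cnj (\<kappa> n j) * (p n i * cnj (p n j)) / (1 - p n i * cnj (p n j))\<^sup>2
          - \<kappa> n i * \<kappa> n j * (p n i * p n j) / (1 - p n i * p n j)\<^sup>2) / 2)) \<longlonglongrightarrow>
          c i * c j * (Re (- 1 / (\<eta> i - cnj (\<eta> j))\<^sup>2 - 0) / 2)"
        by (rule tendsto_mult[OF tendsto_const tendsto_divide[OF tendsto_Re[OF tendsto_diff[OF 1 2]] tendsto_const]]) simp
    qed
    also have "(\<Sum>i<N. \<Sum>j<N. c i * c j * (Re (- 1 / (\<eta> i - cnj (\<eta> j))\<^sup>2 - 0) / 2)) = sigma2 f"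
      using sigma2_rational[OF eta f] by simp
    finally have "?V \<longlonglongrightarrow> sigma2 f" .
    moreover have "\<forall>\<^sub>F n in sequentially. ?V n = (\<Sum>k. real k * (v n k)\<^sup>2)"
      using pk
    proof eventually_elim
      case (elim n)
      have "(\<lambda>k. real k * (\<Sum>j<N. c j * Im (\<kappa> n j * p n j ^ k))\<^sup>2) sums ?V n"
        by (rule sums_variance) (use elim in auto)
      moreover have "real k * (\<Sum>j<N. c j * Im (\<kappa> n j * p n j ^ k))\<^sup>2 = real k * (v n k)\<^sup>2" for k
        by (simp add: v_def)
      ultimately have "(\<lambda>k. real k * (v n k)\<^sup>2) sums ?V n" by (simp only:)
      then show ?case by (rule sums_unique)
    qed
    ultimately show ?thesis by (rule Lim_transform_eventually)
  qed
  \<comment> \<open>The zeroth coefficient shifts the statistic by a deterministic amount, which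
    disappears on centring.\<close>
  have lin_stat_eq: "lin_stat f \<alpha> x0 n y = X n y + real n * v0 n" for n y
    unfolding lin_stat_def X_def W_def by (simp add: sum_subtractf)
  have lin_meas [measurable]: "lin_stat f \<alpha> x0 n \<in> borel_measurable (ope n)" for n
    unfolding lin_stat_def[abs_def] by measurable
  have int: "\<forall>\<^sub>F n in sequentially. integrable (ope n) (X n)"
    using s_ev summ W_sum
  proof eventually_elim
    case (elim n)
    have "\<bar>W n y\<bar> \<le> 2 * C" if "y \<in> {-2..2}" for y
      by (rule cosine_series_bound[of "s n" "v n"]) (use elim that in auto)
    from ope_linear_statistic_integrable(1)[OF W_meas this] show ?case
      unfolding X_def[abs_def] by simp
  qed
  have s2: "0 \<le> sigma2 f"
    unfolding sigma2_def by (intro mult_nonneg_nonneg integral_nonneg_AE AE_I2) auto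
  show ?thesis
  proof (rule levy_continuity)
    show "real_distribution (distr (ope n) borel (\<lambda>x. lin_stat f \<alpha> x0 n x - integral\<^sup>L (ope n) (lin_stat f \<alpha> x0 n)))" for n
      by (rule prob_space.real_distribution_distr[OF prob_space_ope]) measurable
    show "real_distribution (gaussian0 (sigma2 f))" by (rule char_gaussian0(1)[OF s2])
    fix t
    have lim: "(\<lambda>n. \<integral>y. exp (\<i> * of_real (t * (X n y - integral\<^sup>L (ope n) (X n)))) \<partial>ope n) \<longlonglongrightarrow> exp (- (of_real (t\<^sup>2 * sigma2 f / 2)))"
      unfolding X_def
      by (rule ope_mesoscopic_characteristic_limit[OF s_ev _ summ W_meas W_sum rate var]) (simp add: v_def)
    have "\<forall>\<^sub>F n in sequentially. (\<integral>y. exp (\<i> * of_real (t * (X n y - integral\<^sup>L (ope n) (X n)))) \<partial>ope n) =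
        char (distr (ope n) borel (\<lambda>x. lin_stat f \<alpha> x0 n x - integral\<^sup>L (ope n) (lin_stat f \<alpha> x0 n))) t"
      using int
    proof eventually_elim
      case (elim n)
      interpret prob_space "ope n" by (rule prob_space_ope)
      have "integral\<^sup>L (ope n) (lin_stat f \<alpha> x0 n) = integral\<^sup>L (ope n) (X n) + real n * v0 n"
        unfolding lin_stat_eq using elim by (simp add: prob_space)
      then have "lin_stat f \<alpha> x0 n y - integral\<^sup>L (ope n) (lin_stat f \<alpha> x0 n) = X n y - integral\<^sup>L (ope n) (X n)" for y
        by (simp add: lin_stat_eq)
      then show ?case
        unfolding char_def using borel_measurable_integrable[OF elim] by (subst integral_distr) auto
    qed
    from Lim_transform_eventually[OF lim this]
    show "(\<lambda>n. char (distr (ope n) borel (\<lambda>x. lin_stat f \<alpha> x0 n x - integral\<^sup>L (ope n) (lin_stat f \<alpha> x0 n))) t) \<longlonglongrightarrow> char (gaussian0 (sigma2 f)) t"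
      unfolding char_gaussian0(2)[OF s2] .
  qed
qed

end
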